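(* Let $V$ be a $4$-dimensional complex vector space with basis $f_1,f_2,f_3,f_4$. For $i,j,k\in\{1,2,3,4\}$ let $\psi^{ij}_k:V\otimes V\to V$ be the bilinear map with $\psi^{ij}_k(f_i,f_j)=f_k$ and $\psi^{ij}_k(f_a,f_b)=0$ for $(a,b)\neq(i,j)$. Consider the following bilinear multiplications on $V$ (in the families $d_{37}(p:q)$ and $d_{38}(p:q)$, $(p,q)$ ranges over all of $\mathbb{C}^2$, including $(0,0)$): $d_{1}=\psi^{11}_1+\psi^{12}_2+\psi^{23}_1+\psi^{24}_2+\psi^{32}_4+\psi^{31}_3+\psi^{43}_3+\psi^{44}_4$; $d_{2}=\psi^{33}_3+\psi^{44}_4+\psi^{22}_2+\psi^{11}_1$; $d_{3}=\psi^{33}_3+\psi^{44}_4+\psi^{22}_2+\psi^{21}_1+\psi^{13}_1$; $d_{4}=\psi^{33}_3+\psi^{44}_4+\psi^{22}_2+\psi^{12}_1$; $d_{5}=\psi^{33}_3+\psi^{44}_4+\psi^{22}_2+\psi^{21}_1$; $d_{6}=\psi^{33}_3+\psi^{44}_4+\psi^{22}_2+\psi^{21}_1+\psi^{12}_1$; $d_{7}=\psi^{33}_3+\psi^{44}_4+\psi^{22}_2$; $d_{8}=\psi^{33}_3+\psi^{44}_4+\psi^{22}_1+\psi^{31}_1+\psi^{32}_2+\psi^{13}_1+\psi^{23}_2$; $d_{9}=\psi^{33}_3+\psi^{44}_4+\psi^{22}_1$; $d_{10}=\psi^{33}_3+\psi^{44}_4+\psi^{31}_1+\psi^{32}_2+\psi^{14}_1$;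 $d_{11}=\psi^{33}_3+\psi^{44}_4+\psi^{41}_1+\psi^{13}_1+\psi^{23}_2$; $d_{12}=\psi^{33}_3+\psi^{44}_4+\psi^{31}_1+\psi^{42}_2$; $d_{13}=\psi^{33}_3+\psi^{44}_4+\psi^{13}_1+\psi^{24}_2$; $d_{14}=\psi^{33}_3+\psi^{44}_4+\psi^{31}_1+\psi^{24}_2$; $d_{15}=\psi^{33}_3+\psi^{44}_4+\psi^{31}_1+\psi^{14}_1+\psi^{42}_2$; $d_{16}=\psi^{33}_3+\psi^{44}_4+\psi^{13}_1+\psi^{41}_1+\psi^{24}_2$; $d_{17}=\psi^{33}_3+\psi^{44}_4+\psi^{31}_1+\psi^{32}_2+\psi^{14}_1+\psi^{24}_2$; $d_{18}=\psi^{33}_3+\psi^{44}_4+\psi^{31}_1+\psi^{32}_2$; $d_{19}=\psi^{33}_3+\psi^{44}_4+\psi^{13}_1+\psi^{23}_2$; $d_{20}=\psi^{33}_3+\psi^{44}_4+\psi^{23}_2+\psi^{31}_1$; $d_{21}=\psi^{33}_3+\psi^{44}_4+\psi^{13}_1+\psi^{32}_2+\psi^{41}_1+\psi^{24}_2$; $d_{22}=\psi^{33}_3+\psi^{44}_4+\psi^{32}_2+\psi^{23}_2+\psi^{31}_1$; $d_{23}=\psi^{33}_3+\psi^{44}_4+\psi^{32}_2+\psi^{23}_2+\psi^{13}_1$; $d_{24}=\psi^{33}_3+\psi^{44}_4+\psi^{31}_1+\psi^{14}_1$; $d_{25}=\psi^{33}_3+\psi^{44}_4+\psi^{31}_1+\psi^{42}_2+\psi^{24}_2$;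 $d_{26}=\psi^{33}_3+\psi^{44}_4+\psi^{13}_1+\psi^{42}_2+\psi^{24}_2$; $d_{27}=\psi^{33}_3+\psi^{44}_4+\psi^{13}_1+\psi^{41}_1+\psi^{42}_2+\psi^{24}_2$; $d_{28}=\psi^{33}_3+\psi^{44}_4+\psi^{31}_1+\psi^{14}_1+\psi^{42}_2+\psi^{24}_2$; $d_{29}=\psi^{33}_3+\psi^{44}_4+\psi^{32}_2$; $d_{30}=\psi^{33}_3+\psi^{44}_4+\psi^{23}_2$; $d_{31}=\psi^{33}_3+\psi^{44}_4+\psi^{32}_2+\psi^{23}_2$; $d_{32}=\psi^{33}_3+\psi^{44}_4+\psi^{31}_1+\psi^{13}_1+\psi^{42}_2+\psi^{24}_2$; $d_{33}=\psi^{33}_3+\psi^{44}_4+\psi^{31}_1+\psi^{13}_1+\psi^{32}_2+\psi^{23}_2$; $d_{34}=\psi^{33}_3+\psi^{44}_4$; $d_{35}=\psi^{44}_4+\psi^{31}_2+\psi^{13}_2+\psi^{33}_1+\psi^{41}_1+\psi^{42}_2+\psi^{43}_3+\psi^{14}_1+\psi^{24}_2+\psi^{34}_3$; $d_{36}=\psi^{44}_4+\psi^{31}_2+\psi^{13}_2+\psi^{33}_1$; $d_{37}(p:q)=\psi^{44}_4+q\psi^{31}_2+p\psi^{13}_2+\psi^{33}_2+\psi^{41}_1+\psi^{42}_2+\psi^{43}_3+\psi^{14}_1+\psi^{24}_2+\psi^{34}_3$; $d_{38}(p:q)=\psi^{44}_4+q\psi^{31}_2+p\psi^{13}_2+\psi^{33}_2$;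 $d_{39}=\psi^{44}_4+\psi^{13}_2+\psi^{33}_2+\psi^{41}_1+\psi^{42}_2+\psi^{43}_1-\psi^{34}_1+\psi^{24}_2+\psi^{34}_3$; $d_{40}=\psi^{44}_4+\psi^{13}_2+\psi^{33}_2-\psi^{43}_1+\psi^{43}_3+\psi^{14}_1+\psi^{34}_1$; $d_{41}=\psi^{44}_4+\psi^{13}_2+\psi^{33}_2+\psi^{41}_1+\psi^{42}_2+\psi^{43}_1$; $d_{42}=\psi^{44}_4+\psi^{13}_2+\psi^{33}_2-\psi^{34}_1+\psi^{24}_2+\psi^{34}_3$; $d_{43}=\psi^{44}_4+\psi^{13}_2+\psi^{33}_2-\psi^{43}_1+\psi^{43}_3+\psi^{14}_1+\psi^{24}_2+\psi^{34}_3$; $d_{44}=\psi^{44}_4+\psi^{13}_2+\psi^{33}_2+\psi^{41}_1+\psi^{42}_2+\psi^{43}_3+\psi^{14}_1+\psi^{34}_1$; $d_{45}=\psi^{44}_4+\psi^{33}_2+\psi^{41}_1+\psi^{24}_2+\psi^{42}_2+\psi^{34}_3+\psi^{43}_3$; $d_{46}=\psi^{44}_4+\psi^{33}_2+\psi^{14}_1+\psi^{24}_2+\psi^{42}_2+\psi^{34}_3+\psi^{43}_3$; $d_{47}=\psi^{44}_4+\psi^{33}_2+\psi^{14}_1$; $d_{48}=\psi^{44}_4+\psi^{33}_2+\psi^{41}_1$; $d_{49}=\psi^{44}_4+\psi^{33}_2+\psi^{14}_1+\psi^{41}_1$; $d_{50}=\psi^{44}_4+\psi^{33}_2+\psi^{24}_2+\psi^{42}_2+\psi^{34}_3+\psi^{43}_3$;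 $d_{51}=\psi^{44}_4-\psi^{31}_2+\psi^{13}_2+\psi^{41}_1+\psi^{42}_2+\psi^{43}_3+\psi^{14}_1+\psi^{24}_2+\psi^{34}_3$; $d_{52}=\psi^{44}_4-\psi^{31}_2+\psi^{13}_2$; $d_{53}=\psi^{44}_4+\psi^{14}_1+\psi^{24}_2+\psi^{43}_3$; $d_{54}=\psi^{44}_4+\psi^{41}_1+\psi^{42}_2+\psi^{34}_3$; $d_{55}=\psi^{44}_4+\psi^{41}_1+\psi^{42}_2+\psi^{43}_3$; $d_{56}=\psi^{44}_4+\psi^{14}_1+\psi^{24}_2+\psi^{34}_3$; $d_{57}=\psi^{44}_4+\psi^{14}_1+\psi^{41}_1+\psi^{24}_2+\psi^{43}_3$; $d_{58}=\psi^{44}_4+\psi^{14}_1+\psi^{41}_1+\psi^{42}_2$; $d_{59}=\psi^{44}_4+\psi^{14}_1+\psi^{41}_1+\psi^{24}_2$; $d_{60}=\psi^{44}_4+\psi^{41}_1+\psi^{34}_3$; $d_{61}=\psi^{44}_4+\psi^{14}_1+\psi^{41}_1+\psi^{42}_2+\psi^{43}_3$; $d_{62}=\psi^{44}_4+\psi^{14}_1+\psi^{41}_1+\psi^{24}_2+\psi^{34}_3$; $d_{63}=\psi^{44}_4+\psi^{41}_1+\psi^{42}_2$; $d_{64}=\psi^{44}_4+\psi^{14}_1+\psi^{24}_2$; $d_{65}=\psi^{44}_4+\psi^{14}_1+\psi^{41}_1+\psi^{24}_2+\psi^{42}_2$; $d_{66}=\psi^{44}_4+\psi^{14}_1+\psi^{41}_1+\psi^{24}_2+\psi^{42}_2+\psi^{43}_3$;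 $d_{67}=\psi^{44}_4+\psi^{14}_1+\psi^{41}_1+\psi^{24}_2+\psi^{42}_2+\psi^{34}_3$; $d_{68}=\psi^{44}_4+\psi^{14}_1+\psi^{41}_1$; $d_{69}=\psi^{44}_4+\psi^{41}_1$; $d_{70}=\psi^{44}_4+\psi^{14}_1$; $d_{71}=\psi^{44}_4+\psi^{14}_1+\psi^{41}_1+\psi^{24}_2+\psi^{42}_2+\psi^{34}_3+\psi^{43}_3$; $d_{72}=\psi^{44}_4$. Then each of these multiplications makes $V$ a non-nilpotent associative algebra, and every non-nilpotent $4$-dimensional complex associative algebra is isomorphic to one of them. Moreover, algebras in this list carrying different indices $i\in\{1,\dots,72\}$ are never isomorphic (whatever the parameters $(p:q)$ when $i\in\{37,38\}$), and for $i\in\{37,38\}$ the algebras $d_i(p:q)$ and $d_i(p':q')$ are isomorphic if and only if there is $t\in\mathbb{C}\setminus\{0\}$ with $(p',q')=(tp,tq)$ or $(p',q')=(tq,tp)$. (So each of the two families is parameterized by $\mathbb{P}^1(\mathbb{C})/\Sigma_2$, where $\Sigma_2$ interchanges the coordinates, together with the additional point $(0:0)$.)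
   Context: Algebras are associative algebras over $\mathbb{C}$, not assumed to be commutative or to have a unit. An algebra $A$ is nilpotent if $A^n=0$ for some $n\geq 1$ (every product of $n$ elements vanishes), and non-nilpotent otherwise. Isomorphism means isomorphism of $\mathbb{C}$-algebras, i.e. a linear bijection preserving products. A sum of terms $c\,\psi^{ij}_k$ is a bilinear multiplication on $V$: the product $f_if_j$ is the sum of $c f_k$ over all terms $c\,\psi^{ij}_k$ with that upper index pair $ij$, and $f_if_j=0$ when no such term occurs. For example, in $d_{40}$ one has $f_4f_3=f_3-f_1$. The notation $(p:q)$ refers to a pair $(p,q)\in\mathbb{C}^2$ considered up to multiplication by nonzero scalars, with $(0:0)$ allowed. *)

theory Defs
  imports Complex_Main
begin

text \<open>A complex algebra is given by a scalar multiplication on a type of class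
  \<^class>\<open>ab_group_add\<close> and a product; neither a unit nor commutativity is assumed.\<close>

locale complex_algebra = vector_space scale
  for scale :: "complex \<Rightarrow> 'a::ab_group_add \<Rightarrow> 'a"
    and mult :: "'a \<Rightarrow> 'a \<Rightarrow> 'a" +
  assumes linear_right: "\<And>x. Vector_Spaces.linear scale scale (\<lambda>y. mult x y)"
    and linear_left: "\<And>y. Vector_Spaces.linear scale scale (\<lambda>x. mult x y)"
    and assoc: "\<And>x y z. mult (mult x y) z = mult x (mult y z)"

text \<open>All products \<open>x * x\<^sub>2 * \<dots> * x\<^sub>n\<close> of some fixed number \<open>n \<ge> 1\<close> of factors vanish. The factors
  are split as \<open>x\<close> and the list of the others because there is no empty product.\<close>

definition nilpotent_mult :: "('a::zero \<Rightarrow> 'a \<Rightarrow> 'a) \<Rightarrow> bool" where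
  "nilpotent_mult mult \<longleftrightarrow>
     (\<exists>n\<ge>1. \<forall>x xs. Suc (length xs) = n \<longrightarrow> foldl mult x xs = 0)"

definition algebra_iso ::
  "(complex \<Rightarrow> 'a::ab_group_add \<Rightarrow> 'a) \<Rightarrow> ('a \<Rightarrow> 'a \<Rightarrow> 'a) \<Rightarrow>
   (complex \<Rightarrow> 'b::ab_group_add \<Rightarrow> 'b) \<Rightarrow> ('b \<Rightarrow> 'b \<Rightarrow> 'b) \<Rightarrow> bool" where
  "algebra_iso scaleA multA scaleB multB \<longleftrightarrow>
     (\<exists>\<phi>. Vector_Spaces.linear scaleA scaleB \<phi> \<and> bij \<phi> \<and>
          (\<forall>x y. \<phi> (multA x y) = multB (\<phi> x) (\<phi> y)))"

locale four_dim_basis = vector_space scale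
  for scale :: "complex \<Rightarrow> 'v::ab_group_add \<Rightarrow> 'v"
    and f :: "nat \<Rightarrow> 'v" +
  assumes inj_basis: "inj_on f {1..4}"
    and independent_basis: "independent (f ` {1..4})"
    and span_basis: "span (f ` {1..4}) = UNIV"

text \<open>\<open>psi scale f i j k\<close> is \<open>\<psi>\<^sup>i\<^sup>j\<^sub>k\<close>: the product of the \<open>i\<close>-th coordinate of the first argument and
  the \<open>j\<close>-th coordinate of the second, times \<open>f\<^sub>k\<close>.\<close>

definition psi ::
  "(complex \<Rightarrow> 'v::ab_group_add \<Rightarrow> 'v) \<Rightarrow> (nat \<Rightarrow> 'v) \<Rightarrow> nat \<Rightarrow> nat \<Rightarrow> nat \<Rightarrow> 'v \<Rightarrow> 'v \<Rightarrow> 'v" where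
  "psi scale f i j k x y =
     scale (module.representation scale (f ` {1..4}) x (f i) *
            module.representation scale (f ` {1..4}) y (f j)) (f k)"

lemma (in four_dim_basis) psi_basis:
  assumes "a \<in> {1..4}" "b \<in> {1..4}" "i \<in> {1..4}" "j \<in> {1..4}"
  shows "psi scale f i j k (f a) (f b) = (if (a, b) = (i, j) then f k else 0)"
proof -
  have "representation (f ` {1..4}) (f c) (f l) = (if c = l then 1 else 0)"
    if "c \<in> {1..4}" "l \<in> {1..4}" for c l
    using representation_basis[OF independent_basis, of "f c"] inj_onD[OF inj_basis, of c l] that
    by auto
  then show ?thesis
    using assms by (simp add: psi_def)
qed

lemma (in four_dim_basis) psi_linear_right:
  "Vector_Spaces.linear scale scale (\<lambda>y. psi scale f i j k x y)"
  by unfold_locales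
     (simp_all add: psi_def representation_add representation_scale
        independent_basis span_basis algebra_simps del: One_nat_def)

lemma (in four_dim_basis) psi_linear_left:
  "Vector_Spaces.linear scale scale (\<lambda>x. psi scale f i j k x y)"
  by unfold_locales
     (simp_all add: psi_def representation_add representation_scale
        independent_basis span_basis algebra_simps del: One_nat_def)

text \<open>A term \<open>(c, i, j, k)\<close> stands for \<open>c \<psi>\<^sup>i\<^sup>j\<^sub>k\<close>, and a list of terms for their sum.\<close>

definition sum_of_terms ::
  "(complex \<Rightarrow> 'v::ab_group_add \<Rightarrow> 'v) \<Rightarrow> (nat \<Rightarrow> 'v) \<Rightarrow>
   (complex \<times> nat \<times> nat \<times> nat) list \<Rightarrow> 'v \<Rightarrow> 'v \<Rightarrow> 'v" where
  "sum_of_terms scale f ts x y =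
     (\<Sum>(c, i, j, k)\<leftarrow>ts. scale c (psi scale f i j k x y))"

text \<open>The parameters \<open>p\<close> and \<open>q\<close> occur only in the entries 37 and 38.\<close>

definition d_terms ::
  "complex \<Rightarrow> complex \<Rightarrow> (nat \<times> (complex \<times> nat \<times> nat \<times> nat) list) list" where
  "d_terms p q = [
    (1, [(1, 1, 1, 1), (1, 1, 2, 2), (1, 2, 3, 1), (1, 2, 4, 2), (1, 3, 2, 4), (1, 3, 1, 3),
          (1, 4, 3, 3), (1, 4, 4, 4)]),
    (2, [(1, 3, 3, 3), (1, 4, 4, 4), (1, 2, 2, 2), (1, 1, 1, 1)]),
    (3, [(1, 3, 3, 3), (1, 4, 4, 4), (1, 2, 2, 2), (1, 2, 1, 1), (1, 1, 3, 1)]),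
    (4, [(1, 3, 3, 3), (1, 4, 4, 4), (1, 2, 2, 2), (1, 1, 2, 1)]),
    (5, [(1, 3, 3, 3), (1, 4, 4, 4), (1, 2, 2, 2), (1, 2, 1, 1)]),
    (6, [(1, 3, 3, 3), (1, 4, 4, 4), (1, 2, 2, 2), (1, 2, 1, 1), (1, 1, 2, 1)]),
    (7, [(1, 3, 3, 3), (1, 4, 4, 4), (1, 2, 2, 2)]),
    (8, [(1, 3, 3, 3), (1, 4, 4, 4), (1, 2, 2, 1), (1, 3, 1, 1), (1, 3, 2, 2), (1, 1, 3, 1),
          (1, 2, 3, 2)]),
    (9, [(1, 3, 3, 3), (1, 4, 4, 4), (1, 2, 2, 1)]),
    (10, [(1, 3, 3, 3), (1, 4, 4, 4), (1, 3, 1, 1), (1, 3, 2, 2), (1, 1, 4, 1)]),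
    (11, [(1, 3, 3, 3), (1, 4, 4, 4), (1, 4, 1, 1), (1, 1, 3, 1), (1, 2, 3, 2)]),
    (12, [(1, 3, 3, 3), (1, 4, 4, 4), (1, 3, 1, 1), (1, 4, 2, 2)]),
    (13, [(1, 3, 3, 3), (1, 4, 4, 4), (1, 1, 3, 1), (1, 2, 4, 2)]),
    (14, [(1, 3, 3, 3), (1, 4, 4, 4), (1, 3, 1, 1), (1, 2, 4, 2)]),
    (15, [(1, 3, 3, 3), (1, 4, 4, 4), (1, 3, 1, 1), (1, 1, 4, 1), (1, 4, 2, 2)]),
    (16, [(1, 3, 3, 3), (1, 4, 4, 4), (1, 1, 3, 1), (1, 4, 1, 1), (1, 2, 4, 2)]),
    (17, [(1, 3, 3, 3), (1, 4, 4, 4), (1, 3, 1, 1), (1, 3, 2, 2), (1, 1, 4, 1),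
          (1, 2, 4, 2)]),
    (18, [(1, 3, 3, 3), (1, 4, 4, 4), (1, 3, 1, 1), (1, 3, 2, 2)]),
    (19, [(1, 3, 3, 3), (1, 4, 4, 4), (1, 1, 3, 1), (1, 2, 3, 2)]),
    (20, [(1, 3, 3, 3), (1, 4, 4, 4), (1, 2, 3, 2), (1, 3, 1, 1)]),
    (21, [(1, 3, 3, 3), (1, 4, 4, 4), (1, 1, 3, 1), (1, 3, 2, 2), (1, 4, 1, 1),
          (1, 2, 4, 2)]),
    (22, [(1, 3, 3, 3), (1, 4, 4, 4), (1, 3, 2, 2), (1, 2, 3, 2), (1, 3, 1, 1)]),
    (23, [(1, 3, 3, 3), (1, 4, 4, 4), (1, 3, 2, 2), (1, 2, 3, 2), (1, 1, 3, 1)]),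
    (24, [(1, 3, 3, 3), (1, 4, 4, 4), (1, 3, 1, 1), (1, 1, 4, 1)]),
    (25, [(1, 3, 3, 3), (1, 4, 4, 4), (1, 3, 1, 1), (1, 4, 2, 2), (1, 2, 4, 2)]),
    (26, [(1, 3, 3, 3), (1, 4, 4, 4), (1, 1, 3, 1), (1, 4, 2, 2), (1, 2, 4, 2)]),
    (27, [(1, 3, 3, 3), (1, 4, 4, 4), (1, 1, 3, 1), (1, 4, 1, 1), (1, 4, 2, 2),
          (1, 2, 4, 2)]),
    (28, [(1, 3, 3, 3), (1, 4, 4, 4), (1, 3, 1, 1), (1, 1, 4, 1), (1, 4, 2, 2),
          (1, 2, 4, 2)]),
    (29, [(1, 3, 3, 3), (1, 4, 4, 4), (1, 3, 2, 2)]),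
    (30, [(1, 3, 3, 3), (1, 4, 4, 4), (1, 2, 3, 2)]),
    (31, [(1, 3, 3, 3), (1, 4, 4, 4), (1, 3, 2, 2), (1, 2, 3, 2)]),
    (32, [(1, 3, 3, 3), (1, 4, 4, 4), (1, 3, 1, 1), (1, 1, 3, 1), (1, 4, 2, 2),
          (1, 2, 4, 2)]),
    (33, [(1, 3, 3, 3), (1, 4, 4, 4), (1, 3, 1, 1), (1, 1, 3, 1), (1, 3, 2, 2),
          (1, 2, 3, 2)]),
    (34, [(1, 3, 3, 3), (1, 4, 4, 4)]),
    (35, [(1, 4, 4, 4), (1, 3, 1, 2), (1, 1, 3, 2), (1, 3, 3, 1), (1, 4, 1, 1),
          (1, 4, 2, 2), (1, 4, 3, 3), (1, 1, 4, 1), (1, 2, 4, 2), (1, 3, 4, 3)]),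
    (36, [(1, 4, 4, 4), (1, 3, 1, 2), (1, 1, 3, 2), (1, 3, 3, 1)]),
    (37, [(1, 4, 4, 4), (q, 3, 1, 2), (p, 1, 3, 2), (1, 3, 3, 2), (1, 4, 1, 1),
          (1, 4, 2, 2), (1, 4, 3, 3), (1, 1, 4, 1), (1, 2, 4, 2), (1, 3, 4, 3)]),
    (38, [(1, 4, 4, 4), (q, 3, 1, 2), (p, 1, 3, 2), (1, 3, 3, 2)]),
    (39, [(1, 4, 4, 4), (1, 1, 3, 2), (1, 3, 3, 2), (1, 4, 1, 1), (1, 4, 2, 2),
          (1, 4, 3, 1), (-1, 3, 4, 1), (1, 2, 4, 2), (1, 3, 4, 3)]),
    (40, [(1, 4, 4, 4), (1, 1, 3, 2), (1, 3, 3, 2), (-1, 4, 3, 1), (1, 4, 3, 3),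
          (1, 1, 4, 1), (1, 3, 4, 1)]),
    (41, [(1, 4, 4, 4), (1, 1, 3, 2), (1, 3, 3, 2), (1, 4, 1, 1), (1, 4, 2, 2),
          (1, 4, 3, 1)]),
    (42, [(1, 4, 4, 4), (1, 1, 3, 2), (1, 3, 3, 2), (-1, 3, 4, 1), (1, 2, 4, 2),
          (1, 3, 4, 3)]),
    (43, [(1, 4, 4, 4), (1, 1, 3, 2), (1, 3, 3, 2), (-1, 4, 3, 1), (1, 4, 3, 3),
          (1, 1, 4, 1), (1, 2, 4, 2), (1, 3, 4, 3)]),
    (44, [(1, 4, 4, 4), (1, 1, 3, 2), (1, 3, 3, 2), (1, 4, 1, 1), (1, 4, 2, 2),
          (1, 4, 3, 3), (1, 1, 4, 1), (1, 3, 4, 1)]),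
    (45, [(1, 4, 4, 4), (1, 3, 3, 2), (1, 4, 1, 1), (1, 2, 4, 2), (1, 4, 2, 2),
          (1, 3, 4, 3), (1, 4, 3, 3)]),
    (46, [(1, 4, 4, 4), (1, 3, 3, 2), (1, 1, 4, 1), (1, 2, 4, 2), (1, 4, 2, 2),
          (1, 3, 4, 3), (1, 4, 3, 3)]),
    (47, [(1, 4, 4, 4), (1, 3, 3, 2), (1, 1, 4, 1)]),
    (48, [(1, 4, 4, 4), (1, 3, 3, 2), (1, 4, 1, 1)]),
    (49, [(1, 4, 4, 4), (1, 3, 3, 2), (1, 1, 4, 1), (1, 4, 1, 1)]),
    (50, [(1, 4, 4, 4), (1, 3, 3, 2), (1, 2, 4, 2), (1, 4, 2, 2), (1, 3, 4, 3),
          (1, 4, 3, 3)]),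
    (51, [(1, 4, 4, 4), (-1, 3, 1, 2), (1, 1, 3, 2), (1, 4, 1, 1), (1, 4, 2, 2),
          (1, 4, 3, 3), (1, 1, 4, 1), (1, 2, 4, 2), (1, 3, 4, 3)]),
    (52, [(1, 4, 4, 4), (-1, 3, 1, 2), (1, 1, 3, 2)]),
    (53, [(1, 4, 4, 4), (1, 1, 4, 1), (1, 2, 4, 2), (1, 4, 3, 3)]),
    (54, [(1, 4, 4, 4), (1, 4, 1, 1), (1, 4, 2, 2), (1, 3, 4, 3)]),
    (55, [(1, 4, 4, 4), (1, 4, 1, 1), (1, 4, 2, 2), (1, 4, 3, 3)]),
    (56, [(1, 4, 4, 4), (1, 1, 4, 1), (1, 2, 4, 2), (1, 3, 4, 3)]),
    (57, [(1, 4, 4, 4), (1, 1, 4, 1), (1, 4, 1, 1), (1, 2, 4, 2), (1, 4, 3, 3)]),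
    (58, [(1, 4, 4, 4), (1, 1, 4, 1), (1, 4, 1, 1), (1, 4, 2, 2)]),
    (59, [(1, 4, 4, 4), (1, 1, 4, 1), (1, 4, 1, 1), (1, 2, 4, 2)]),
    (60, [(1, 4, 4, 4), (1, 4, 1, 1), (1, 3, 4, 3)]),
    (61, [(1, 4, 4, 4), (1, 1, 4, 1), (1, 4, 1, 1), (1, 4, 2, 2), (1, 4, 3, 3)]),
    (62, [(1, 4, 4, 4), (1, 1, 4, 1), (1, 4, 1, 1), (1, 2, 4, 2), (1, 3, 4, 3)]),
    (63, [(1, 4, 4, 4), (1, 4, 1, 1), (1, 4, 2, 2)]),
    (64, [(1, 4, 4, 4), (1, 1, 4, 1), (1, 2, 4, 2)]),
    (65, [(1, 4, 4, 4), (1, 1, 4, 1), (1, 4, 1, 1), (1, 2, 4, 2), (1, 4, 2, 2)]),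
    (66, [(1, 4, 4, 4), (1, 1, 4, 1), (1, 4, 1, 1), (1, 2, 4, 2), (1, 4, 2, 2),
          (1, 4, 3, 3)]),
    (67, [(1, 4, 4, 4), (1, 1, 4, 1), (1, 4, 1, 1), (1, 2, 4, 2), (1, 4, 2, 2),
          (1, 3, 4, 3)]),
    (68, [(1, 4, 4, 4), (1, 1, 4, 1), (1, 4, 1, 1)]),
    (69, [(1, 4, 4, 4), (1, 4, 1, 1)]),
    (70, [(1, 4, 4, 4), (1, 1, 4, 1)]),
    (71, [(1, 4, 4, 4), (1, 1, 4, 1), (1, 4, 1, 1), (1, 2, 4, 2), (1, 4, 2, 2),
          (1, 3, 4, 3), (1, 4, 3, 3)]),
    (72, [(1, 4, 4, 4)])]"

definition d_mult ::
  "(complex \<Rightarrow> 'v::ab_group_add \<Rightarrow> 'v) \<Rightarrow> (nat \<Rightarrow> 'v) \<Rightarrow>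
   nat \<Rightarrow> complex \<Rightarrow> complex \<Rightarrow> 'v \<Rightarrow> 'v \<Rightarrow> 'v" where
  "d_mult scale f n p q = sum_of_terms scale f (the (map_of (d_terms p q) n))"

lemma (in four_dim_basis) d40_f4_f3: "d_mult scale f 40 p q (f 4) (f 3) = f 3 - f 1"
  by (simp add: d_mult_def sum_of_terms_def d_terms_def psi_basis)

end

theory Submission
  imports Defs "HOL-Computational_Algebra.Fundamental_Theorem_Algebra"
begin

text \<open>Completeness: a minimal subalgebra \<open>S\<close> that is not nil satisfies \<open>S = S S\<close>, so that some
  \<open>a \<in> S\<close> fixes a nonzero vector and \<open>S a = S\<close>; solving \<open>e a = a\<close> yields an idempotent. Take a
  maximal system \<open>e\<^sub>1, \<dots>, e\<^sub>k\<close> of orthogonal idempotents and the Peirce pieces \<open>e\<^sub>i A e\<^sub>j\<close>, where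
  \<open>e\<^sub>0 = 1 - e\<^sub>1 - \<dots> - e\<^sub>k\<close>. By maximality and since eigenvalues exist, \<open>e\<^sub>i A e\<^sub>i\<close> is spanned by
  \<open>e\<^sub>i\<close> and a nil ideal. Either two pieces contain matrix units, and the algebra is \<open>d\<^sub>1\<close>, or the nil
  parts and the remaining pieces span an ideal \<open>R\<close> of dimension \<open>4 - k\<close> with a homogeneous basis. The
  types \<open>(i, j)\<close> of its members leave room for few products; only for \<open>k = 1\<close> and a two-dimensional
  \<open>R / R\<^sup>2\<close> of a single type a bilinear form has to be brought to normal form.

  Separation: the traces of the maps \<open>z \<mapsto> e z\<close>, \<open>z \<mapsto> z e\<close> and \<open>z \<mapsto> e z e'\<close> for idempotents
  \<open>e, e'\<close> are the dimensions of sums of Peirce pieces. They determine the entry up to the products of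
  nilpotent elements, which are compared directly. In the families 37 and 38 an isomorphism induces a
  similitude of the forms \<open>p x\<^sub>1 y\<^sub>3 + q x\<^sub>3 y\<^sub>1 + x\<^sub>3 y\<^sub>3\<close> and permutes their two isotropic lines.\<close>

section \<open>Idempotents and eigenvectors\<close>

text \<open>Without a unit there are no inverses, and \<open>1 - e\<close> is not an element.
  Invertibility is replaced by surjectivity of right multiplication on a finite-dimensional
  subspace: surjective means injective, so the factor can be cancelled. This one principle turns
  \<open>e a = a\<close> into \<open>e e = e\<close> and makes the corners local. Algebraic
  closedness enters through eigenvectors, which force the residue field of a corner to be the
  complex numbers, and through a square root that yields an isotropic vector of a bilinear form.
  Idempotents are not unique, so the separating traces must not depend on their choice: they are
  polynomials in the characters alone, and characters take only the values 0 and 1 on idempotents.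
  In the families 37 and 38 squares are governed by x3((p + q) x1 + x3). The vector f1 spans one of
  the isotropic lines x3 = 0 and (p + q) x1 + x3 = 0; starting from the other line interchanges p
  and q up to a common factor. If p + q = 0 the lines coincide, and the interchange is the scaling
  by -1.\<close>

context complex_algebra
begin

lemma mult_add_right: "mult x (y + z) = mult x y + mult x z"
  and mult_scale_right: "mult x (scale c y) = scale c (mult x y)"
  and mult_add_left: "mult (x + y) z = mult x z + mult y z"
  and mult_scale_left: "mult (scale c x) y = scale c (mult x y)"
  using linear_right linear_left by (simp_all add: Vector_Spaces.linear_iff)

lemma mult_zero_right [simp]: "mult x 0 = 0"
  using mult_scale_right[of x 0 0] by simp

lemma mult_zero_left [simp]: "mult 0 x = 0"
  using mult_scale_left[of 0 0 x] by simp

lemma mult_minus_right: "mult x (- y) = - mult x y"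
  using mult_scale_right[of x "-1" y] by simp

lemma mult_minus_left: "mult (- x) y = - mult x y"
  using mult_scale_left[of "-1" x y] by simp

lemma mult_diff_right: "mult x (y - z) = mult x y - mult x z"
  using mult_add_right[of x y "- z"] by (simp add: mult_minus_right)

lemma mult_diff_left: "mult (x - y) z = mult x z - mult y z"
  using mult_add_left[of x "- y" z] by (simp add: mult_minus_left)

lemmas mult_distribs = mult_add_right mult_add_left mult_diff_right mult_diff_left
  mult_scale_right mult_scale_left mult_minus_right mult_minus_left

section \<open>Products of sets, nil sets and subalgebras\<close>

definition products :: "'a set \<Rightarrow> 'a set \<Rightarrow> 'a set" where
  "products S T = {mult s t |s t. s \<in> S \<and> t \<in> T}"

lemma productsI: "s \<in> S \<Longrightarrow> t \<in> T \<Longrightarrow> mult s t \<in> products S T"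
  by (auto simp: products_def)

lemma products_mono: "S \<subseteq> S' \<Longrightarrow> T \<subseteq> T' \<Longrightarrow> products S T \<subseteq> products S' T'"
  by (auto simp: products_def)

text \<open>The index counts the factors after the first: \<open>set_power S n\<close> consists of
  products of n + 1 elements, there being no empty product.\<close>

primrec set_power :: "'a set \<Rightarrow> nat \<Rightarrow> 'a set" where
  "set_power S 0 = S"
| "set_power S (Suc n) = products S (set_power S n)"

text \<open>Nilpotency of the whole set: one length bound for all products, not only for powers of
  single elements.\<close>

definition nil :: "'a set \<Rightarrow> bool" where
  "nil S \<longleftrightarrow> (\<exists>n. set_power S n \<subseteq> {0})"

definition closed :: "'a set \<Rightarrow> bool" where
  "closed S \<longleftrightarrow> subspace S \<and> products S S \<subseteq> S"

lemma closedD: "closed S \<Longrightarrow> x \<in> S \<Longrightarrow> y \<in> S \<Longrightarrow> mult x y \<in> S"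
  by (auto simp: closed_def products_def)

lemma closed_subspace: "closed S \<Longrightarrow> subspace S"
  by (simp add: closed_def)

lemma nil_mono:
  assumes "nil T" "S \<subseteq> T"
  shows "nil S"
proof -
  have "set_power S n \<subseteq> set_power T n" for n
    by (induction n) (use assms(2) in \<open>simp_all add: products_mono\<close>)
  then show ?thesis
    using assms(1) by (meson nil_def order_trans)
qed

text \<open>The powers of \<open>b\<close> lie in the powers of \<open>S\<close> and multiply
  \<open>x\<close> by powers of \<open>c\<close>; one of them is zero.\<close>

lemma nil_product_not_fixed:
  assumes "nil S" "b \<in> S" "mult b x = scale c x" "c \<noteq> 0"
  shows "x = 0"
proof -
  obtain n where n: "set_power S n \<subseteq> {0}"
    using assms(1) by (auto simp: nil_def)
  have "\<exists>t\<in>set_power S n. \<exists>d. d \<noteq> 0 \<and> mult t x = scale d x" for n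
  proof (induction n)
    case (Suc n)
    then obtain t d where "t \<in> set_power S n" "d \<noteq> 0" "mult t x = scale d x"
      by blast
    then have "mult b t \<in> set_power S (Suc n)" "mult (mult b t) x = scale (c * d) x"
      using assms(2,3) by (auto simp: assoc mult_scale_right productsI mult.commute)
    then show ?case
      using \<open>d \<noteq> 0\<close> assms(4) by (metis mult_eq_0_iff)
  qed (use assms in auto)
  then show ?thesis
    using n by fastforce
qed

lemma nil_square:
  assumes "nil (span (products S S))"
  shows "nil S"
proof -
  let ?T = "span (products S S)"
  \<comment> \<open>Index 2n + 1 means 2n + 2 factors, which associativity groups into n + 1 pairs,
    that is, index n for \<open>?T\<close>.\<close>
  have "set_power S (Suc (2 * n)) \<subseteq> set_power ?T n" for n
  proof (induction n)
    case (Suc n)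
    show ?case
    proof
      fix x assume "x \<in> set_power S (Suc (2 * Suc n))"
      moreover have "Suc (2 * Suc n) = Suc (Suc (Suc (2 * n)))"
        by simp
      ultimately have "x \<in> products S (products S (set_power S (Suc (2 * n))))"
        by (simp only: set_power.simps(2))
      then obtain s t u where x: "x = mult s (mult t u)"
        and stu: "s \<in> S" "t \<in> S" "u \<in> set_power S (Suc (2 * n))"
        unfolding products_def by blast
      have "mult s t \<in> ?T"
        using stu by (intro span_base productsI)
      moreover have "u \<in> set_power ?T n"
        using Suc stu(3) by blast
      ultimately have "mult (mult s t) u \<in> set_power ?T (Suc n)"
        unfolding set_power.simps(2) by (rule productsI)
      then show "x \<in> set_power ?T (Suc n)"
        by (simp only: x assoc)
    qed
  qed (auto intro: span_base)
  then show ?thesis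
    using assms by (meson nil_def order_trans)
qed

lemma foldl_mult_in_set_power: "foldl mult x xs \<in> set_power UNIV (length xs)"
proof (induction xs arbitrary: x)
  case (Cons y ys)
  have "foldl mult (mult x y) ys = mult x (foldl mult y ys)" for ys
    by (induction ys rule: rev_induct) (auto simp: assoc)
  then show ?case
    using Cons by (auto intro: productsI)
qed simp

lemma nilpotent_multI:
  assumes "nil UNIV"
  shows "nilpotent_mult mult"
proof -
  obtain n where n: "set_power UNIV n \<subseteq> {0}"
    using assms by (auto simp: nil_def)
  show ?thesis
    unfolding nilpotent_mult_def
    using n foldl_mult_in_set_power by (intro exI[of _ "Suc n"]) fastforce
qed

lemma subspace_image_mult:
  assumes "subspace S"
  shows "subspace ((\<lambda>s. mult s x) ` S)"
proof (rule subspaceI)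
  show "0 \<in> (\<lambda>s. mult s x) ` S"
    using subspace_0[OF assms] mult_zero_left[of x] by (metis imageI)
next
  fix u v assume "u \<in> (\<lambda>s. mult s x) ` S" "v \<in> (\<lambda>s. mult s x) ` S"
  then obtain s t where "s \<in> S" "t \<in> S" "u = mult s x" "v = mult t x"
    by auto
  then show "u + v \<in> (\<lambda>s. mult s x) ` S"
    using subspace_add[OF assms] mult_add_left[of s t x] by (metis imageI)
next
  fix c u assume "u \<in> (\<lambda>s. mult s x) ` S"
  then obtain s where "s \<in> S" "u = mult s x"
    by auto
  then show "scale c u \<in> (\<lambda>s. mult s x) ` S"
    using subspace_scale[OF assms] mult_scale_left[of c s x] by (metis imageI)
qed

lemma span_products_induct [consumes 1, case_names prod subspace]:
  assumes "x \<in> span (products S T)"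
    and "\<And>s t. s \<in> S \<Longrightarrow> t \<in> T \<Longrightarrow> P (mult s t)"
    and "subspace (Collect P)"
  shows "P x"
  using span_minimal[of "products S T" "Collect P"] assms by (auto simp: products_def)

end

section \<open>Finite dimension: cancellation, idempotents and eigenvectors\<close>

locale fin_dim_algebra =
  complex_algebra scale mult + finite_dimensional_vector_space scale Basis
  for scale :: "complex \<Rightarrow> 'a::ab_group_add \<Rightarrow> 'a" (infixr \<open>*s\<close> 75)
    and mult :: "'a \<Rightarrow> 'a \<Rightarrow> 'a" (infixl \<open>\<cdot>\<close> 70)
    and Basis :: "'a set"
begin

sublocale endo: finite_dimensional_vector_space_pair_1 scale Basis scale ..

lemma inj_on_surjective_endo:
  assumes "Vector_Spaces.linear scale scale T" "subspace S" "T ` S = S"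
  shows "inj_on T S"
proof -
  obtain B where B: "finite B" "B \<subseteq> S" "independent B" "span B = S" "card B = dim S"
    using basis_subspace_exists[OF assms(2)] by metis
  have "span (T ` B) = S"
    using endo.linear_span_image[OF assms(1)] B(4) assms(3) by metis
  then have "dim S \<le> card (T ` B)"
    using B(1) by (metis dim_le_card finite_imageI order_refl)
  then have card: "card (T ` B) = card B"
    using card_image_le[OF B(1), of T] B(5) by simp
  have "independent (T ` B)"
    using card_le_dim_spanning[of "T ` B" S] \<open>span (T ` B) = S\<close> card B assms(3)
    by (metis finite_imageI image_mono order_refl)
  moreover have "inj_on T B"
    using card B(1) by (simp add: eq_card_imp_inj_on)
  ultimately show ?thesis
    using endo.linear_inj_on_span_independent_image[OF assms(1)] B(4) by metis
qed

text \<open>The substitute for dividing by \<open>a\<close>, available without a unit.\<close>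

lemma eq_of_mult_right_eq:
  assumes "subspace S" "(\<lambda>s. s \<cdot> a) ` S = S" "s \<in> S" "t \<in> S" "s \<cdot> a = t \<cdot> a"
  shows "s = t"
  using inj_on_surjective_endo[OF linear_left[of a] assms(1,2)] assms(3-5)
  by (auto simp: inj_on_def)

lemma nonnil_has_idempotent:
  assumes "closed S" "\<not> nil S"
  shows "\<exists>e\<in>S. e \<noteq> 0 \<and> e \<cdot> e = e"
  using assms
proof (induction "dim S" arbitrary: S rule: less_induct)
  case less
  note sub = closed_subspace[OF less.prems(1)]
  show ?case
  proof (cases "\<exists>T. T \<subset> S \<and> closed T \<and> \<not> nil T")
    case True
    then obtain T where T: "T \<subset> S" "closed T" "\<not> nil T"
      by blast
    then have "dim T < dim S"
      using dim_psubset[of T S] span_eq_iff[THEN iffD2, OF sub]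
        span_eq_iff[THEN iffD2, OF closed_subspace[OF T(2)]] by simp
    then show ?thesis
      using less.hyps[OF _ T(2,3)] T(1) by blast
  next
    case False
    then have minimal: "T = S" if "T \<subseteq> S" "closed T" "\<not> nil T" for T
      using that by blast
    have "span (products S S) \<subseteq> S"
      using less.prems(1) by (simp add: closed_def span_minimal)
    moreover from this have "products (span (products S S)) (span (products S S))
        \<subseteq> span (products S S)"
      using products_mono[of "span (products S S)" S] span_superset[of "products S S"] by blast
    then have "closed (span (products S S))"
      by (simp only: closed_def subspace_span simp_thms)
    ultimately have SS: "span (products S S) = S"
      using minimal[of "span (products S S)"] nil_square less.prems(2) by blast
    \<comment> \<open>A member of \<open>F\<close> of least dimension plays the role of a simple
      left module with nontrivial action. For \<open>x\<close> in it that is not killed by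
      \<open>S\<close>, the submodule \<open>S x\<close> is everything, so \<open>x\<close> itself
      has the form \<open>a x\<close>.\<close>
    define F where "F = (\<lambda>J. subspace J \<and> J \<subseteq> S \<and> products S J \<subseteq> J \<and> (\<exists>s\<in>S. \<exists>j\<in>J. s \<cdot> j \<noteq> 0))"
    have "\<exists>s\<in>S. \<exists>j\<in>S. s \<cdot> j \<noteq> 0"
    proof (rule ccontr)
      assume "\<not> ?thesis"
      then have "products S S \<subseteq> {0}"
        by (auto simp: products_def)
      then have "set_power S 1 \<subseteq> {0}"
        by simp
      then show False
        using less.prems(2) nil_def by blast
    qed
    then have "F S"
      using less.prems(1) by (auto simp: F_def closed_def)
    then obtain J where J: "F J" and least: "\<And>K. F K \<Longrightarrow> dim J \<le> dim K"
      using ex_has_least_nat[of F S dim] by blast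
    then obtain s x where sx: "s \<in> S" "x \<in> J" "s \<cdot> x \<noteq> 0"
      by (auto simp: F_def)
    let ?K = "(\<lambda>s. s \<cdot> x) ` S"
    have KJ: "?K \<subseteq> J"
      using J sx by (auto simp: F_def products_def)
    \<comment> \<open>If \<open>S\<close> killed \<open>S x\<close>, then the span of
      \<open>S S\<close>, which is \<open>S\<close>, would kill \<open>x\<close>.\<close>
    have "\<exists>s\<in>S. \<exists>t\<in>S. s \<cdot> (t \<cdot> x) \<noteq> 0"
    proof (rule ccontr)
      assume contr: "\<not> ?thesis"
      have "u \<cdot> x = 0" if "u \<in> span (products S S)" for u
        using that
      proof (induction rule: span_products_induct)
        case subspace
        show ?case
          by (auto intro!: subspaceI simp: mult_distribs)
      qed (use contr in \<open>simp add: assoc\<close>)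
      then show False
        using sx SS by blast
    qed
    moreover have "products S ?K \<subseteq> ?K"
      using less.prems(1) by (auto simp: products_def closedD assoc[symmetric])
    ultimately have "F ?K"
      using KJ J subspace_image_mult[OF sub] by (auto simp: F_def)
    then have "?K = J"
      using least[of ?K] subspace_dim_equal[of ?K J] KJ J by (auto simp: F_def)
    then obtain a where a: "a \<in> S" "a \<cdot> x = x"
      using sx(2) by (auto simp: image_iff)
    \<comment> \<open>The left ideal \<open>S a\<close> is a subalgebra. It contains
      \<open>a a\<close>, which fixes \<open>x\<close>, so it is not nil and minimality makes it all
      of \<open>S\<close>.\<close>
    let ?L = "(\<lambda>s. s \<cdot> a) ` S"
    have "closed ?L"
      using a less.prems(1) subspace_image_mult[OF sub]
      by (auto simp: closed_def products_def closedD assoc[symmetric])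
    moreover have "\<not> nil ?L"
    proof
      assume "nil ?L"
      moreover have "a \<cdot> a \<in> ?L" "(a \<cdot> a) \<cdot> x = 1 *s x"
        using a by (simp_all add: assoc)
      ultimately have "x = 0"
        using nil_product_not_fixed[of ?L "a \<cdot> a" x 1] by simp
      then show False
        using sx by simp
    qed
    moreover have "?L \<subseteq> S"
      using a less.prems(1) by (auto simp: closedD)
    ultimately have L: "?L = S"
      using minimal by blast
    then have "a \<in> ?L"
      using a(1) by simp
    then obtain e where e: "e \<in> S" "e \<cdot> a = a"
      by (metis (no_types, lifting) imageE)
    moreover have "e \<cdot> e = e"
      using eq_of_mult_right_eq[OF sub L, of "e \<cdot> e" e] e less.prems(1)
        by (simp add: closedD assoc)
    moreover have "e \<noteq> 0"
      using e a sx by auto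
    ultimately show ?thesis
      by blast
  qed
qed

text \<open>A polynomial p of least degree with p(T) v = 0 has a root c; with p = (X - c) q,
  minimality gives q(T) v nonzero, and this is the eigenvector. The stable subspace \<open>S\<close>
  is kept because corners are the intended use.\<close>

lemma eigenvector_exists:
  assumes lin: "Vector_Spaces.linear scale scale T" and sub: "subspace S" "T ` S \<subseteq> S" and "v \<in> S" "v \<noteq> 0"
  shows "\<exists>c w. w \<in> S \<and> w \<noteq> 0 \<and> T w = c *s w"
proof -
  note T_add = endo.linear_add[OF lin] and T_scale = endo.linear_scale[OF lin]
    and T_zero = endo.linear_0[OF lin]
  \<comment> \<open>\<open>act p v\<close> is p(T) v in Horner form.\<close>
  define act where "act p v = fold_coeffs (\<lambda>a w. a *s v + T w) p 0" for p v
  have act_0: "act 0 v = 0" for v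
    by (simp add: act_def)
  have act_pCons: "act (pCons a p) v = a *s v + T (act p v)" for a p v
    by (cases "p = 0 \<and> a = 0") (auto simp: act_def T_zero)
  have act_add: "act (p + q) v = act p v + act q v" for p q v
    by (induction p q rule: poly_induct2)
      (simp_all add: act_0 act_pCons T_add scale_left_distrib add_ac)
  have act_smult: "act (smult a p) v = a *s act p v" for a p v
    by (induction p) (simp_all add: act_0 act_pCons T_scale scale_right_distrib)
  have act_factor: "act ([:-c, 1:] * p) v = T (act p v) - c *s act p v" for c p v
  proof -
    have "[:-c, 1:] * p = pCons 0 p + smult (- c) p"
      by simp
    then show ?thesis
      by (simp only: act_add act_smult act_pCons scale_zero_left scale_minus_left add_0_left
          diff_conv_add_uminus)
  qed
  have act_in: "act p v \<in> S" for p
  proof (induction p)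
    case (pCons a p)
    then have "T (act p v) \<in> S"
      using sub(2) by blast
    then show ?case
      using sub(1) \<open>v \<in> S\<close> by (simp add: act_pCons subspace_add subspace_scale)
  qed (simp add: act_0 subspace_0[OF sub(1)])
  have act_sum: "act (sum g A) v = (\<Sum>i\<in>A. act (g i) v)" for g :: "nat \<Rightarrow> complex poly" and A
    by (induction A rule: infinite_finite_induct) (simp_all add: act_0 act_add)
  \<comment> \<open>The vectors T^n v for n up to \<open>dimension\<close> are one too many to be
    distinct and independent: either two coincide or they are linearly dependent, and both give an
    annihilating polynomial.\<close>
  let ?h = "\<lambda>n. act (monom 1 n) v"
  have "\<exists>p. p \<noteq> 0 \<and> act p v = 0"
  proof (cases "inj_on ?h {..dimension}")
    case False
    then obtain i j where ij: "i \<noteq> j" "?h i = ?h j"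
      by (auto simp: inj_on_def)
    have "act (monom 1 i + smult (-1) (monom 1 j)) v = 0"
      unfolding act_add act_smult using ij(2) by simp
    moreover have "coeff (monom 1 i + smult (-1) (monom (1::complex) j)) i \<noteq> 0"
      using ij(1) by simp
    ultimately show ?thesis
      by (metis coeff_0)
  next
    case True
    then have "card (?h ` {..dimension}) = Suc dimension"
      by (simp add: card_image)
    moreover have "dim (?h ` {..dimension}) \<le> dimension"
      by (rule dim_subset_UNIV)
    ultimately have "dependent (?h ` {..dimension})"
      using dependent_biggerset_general by simp
    then obtain u w where uw: "(\<Sum>v\<in>?h ` {..dimension}. u v *s v) = 0"
        "w \<in> ?h ` {..dimension}" "u w \<noteq> 0"
      by (auto simp: dependent_finite)
    then obtain k where k: "k \<le> dimension" "u (?h k) \<noteq> 0"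
      by auto
    let ?p = "\<Sum>i\<le>dimension. smult (u (?h i)) (monom 1 i)"
    have "act ?p v = 0"
      unfolding act_sum act_smult using uw(1) unfolding sum.reindex[OF True] o_def .
    moreover have "coeff ?p k = u (?h k)"
      using k(1) sum.remove[of "{..dimension}" k "\<lambda>i. u (?h i) * (if i = k then 1 else 0)"]
      by (simp add: coeff_sum sum.neutral)
    ultimately show ?thesis
      using k(2) by (metis coeff_0)
  qed
  then obtain p where p: "p \<noteq> 0" "act p v = 0"
    and least: "\<And>q. q \<noteq> 0 \<and> act q v = 0 \<Longrightarrow> degree p \<le> degree q"
    using ex_has_least_nat[of "\<lambda>p. p \<noteq> 0 \<and> act p v = 0" _ degree] by blast
  have "\<exists>z. poly p z = 0"
  proof (rule fundamental_theorem_of_algebra_alt, safe)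
    fix a :: complex assume "a \<noteq> 0" "p = [:a:]"
    then show False
      using p(2) \<open>v \<noteq> 0\<close> by (simp add: act_pCons act_0 T_zero)
  qed
  then obtain c q where q: "p = [:-c, 1:] * q"
    by (auto simp: poly_eq_0_iff_dvd elim: dvdE)
  then have "q \<noteq> 0" "degree q < degree p"
    using p(1) by (auto simp: degree_mult_eq simp del: mult_pCons_left)
  then have "act q v \<noteq> 0"
    using least[of q] by auto
  moreover have "T (act q v) = c *s act q v"
    using p(2) act_factor[of c q] q by simp
  ultimately show ?thesis
    using act_in by blast
qed

end

section \<open>Peirce decomposition\<close>

context complex_algebra
begin

lemma mult_sum_right: "mult x (sum g A) = (\<Sum>a\<in>A. mult x (g a))"
  by (induction A rule: infinite_finite_induct) (simp_all add: mult_add_right)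

lemma mult_sum_left: "mult (sum g A) x = (\<Sum>a\<in>A. mult (g a) x)"
  by (induction A rule: infinite_finite_induct) (simp_all add: mult_add_left)

definition corner :: "'a \<Rightarrow> 'a set" where
  "corner e = {x. mult e x = x \<and> mult x e = x}"

text \<open>The elements of the unital algebra \<open>e A e\<close> without a left inverse there.
  Right multiplication is onto exactly when \<open>e\<close> is hit.\<close>

definition nonunits :: "'a \<Rightarrow> 'a set" where
  "nonunits e = {x \<in> corner e. (\<lambda>s. mult s x) ` corner e \<noteq> corner e}"

lemma closed_corner: "closed (corner e)"
proof -
  have "mult x y \<in> corner e" if "x \<in> corner e" "y \<in> corner e" for x y
    using that by (simp add: corner_def assoc) (simp add: assoc[symmetric])
  then show ?thesis
    by (auto simp: closed_def products_def corner_def mult_distribs intro!: subspaceI)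
qed

end

section \<open>The corner of a primitive idempotent is local, with residue field the complex
  numbers\<close>

locale primitive_idempotent = fin_dim_algebra +
  fixes e :: 'a
  assumes idempotent: "e \<cdot> e = e" and nonzero: "e \<noteq> 0"
    and primitive: "\<And>g. g \<in> corner e \<Longrightarrow> g \<cdot> g = g \<Longrightarrow> g = 0 \<or> g = e"
begin

abbreviation "B \<equiv> corner e"
abbreviation "N \<equiv> nonunits e"

lemma e_in: "e \<in> B"
  by (simp add: corner_def idempotent)

lemma BD: "x \<in> B \<Longrightarrow> e \<cdot> x = x" "x \<in> B \<Longrightarrow> x \<cdot> e = x"
  by (simp_all add: corner_def)

lemmas B_mult = closedD[OF closed_corner[of e]]
  and B_subspace = closed_subspace[OF closed_corner[of e]]

lemma nonunitsI:
  assumes "x \<in> B" "\<And>y. y \<in> B \<Longrightarrow> y \<cdot> x \<noteq> e"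
  shows "x \<in> N"
proof -
  have False if "(\<lambda>s. s \<cdot> x) ` B = B"
  proof -
    have "e \<in> (\<lambda>s. s \<cdot> x) ` B"
      using e_in that by simp
    then show False
      using assms(2) by fastforce
  qed
  then show ?thesis
    using assms(1) by (auto simp: nonunits_def)
qed

lemma unitI:
  assumes "x \<in> B" "y \<in> B" "y \<cdot> x = e"
  shows "x \<notin> N"
proof -
  have "s \<in> (\<lambda>s. s \<cdot> x) ` B" if "s \<in> B" for s
    by (rule image_eqI[of _ _ "s \<cdot> y"])
      (use that assms in \<open>simp_all only: assoc B_mult BD(2)\<close>)
  then have "(\<lambda>s. s \<cdot> x) ` B = B"
    using assms B_mult by auto
  then show ?thesis
    by (simp add: nonunits_def)
qed

lemma nonunits_in: "x \<in> N \<Longrightarrow> x \<in> B"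
  by (simp add: nonunits_def)

lemma e_notin_nonunits: "e \<notin> N"
  using unitI[OF e_in e_in] idempotent by simp

text \<open>Otherwise \<open>B x\<close> contains a nonzero idempotent, which is \<open>e\<close> by
  primitivity, and \<open>x\<close> gets a left inverse.\<close>

lemma nil_left_ideal:
  assumes "x \<in> N"
  shows "nil ((\<lambda>s. s \<cdot> x) ` B)"
proof (rule ccontr)
  let ?L = "(\<lambda>s. s \<cdot> x) ` B"
  assume "\<not> nil ?L"
  moreover have "closed ?L"
    using nonunits_in[OF assms] subspace_image_mult[OF B_subspace]
    by (auto simp: closed_def products_def B_mult assoc[symmetric])
  ultimately obtain g where g: "g \<in> ?L" "g \<noteq> 0" "g \<cdot> g = g"
    using nonnil_has_idempotent by blast
  then have "g = e"
    using primitive[of g] nonunits_in[OF assms] B_mult by blast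
  then show False
    using g(1) unitI nonunits_in[OF assms] assms by auto
qed

lemma nonunits_mult_left:
  assumes "b \<in> B" "x \<in> N"
  shows "b \<cdot> x \<in> N"
proof (rule nonunitsI)
  show "y \<cdot> (b \<cdot> x) \<noteq> e" if "y \<in> B" for y
    using unitI[of x "y \<cdot> b"] that assms B_mult nonunits_in by (auto simp: assoc)
qed (use assms in \<open>simp add: B_mult nonunits_in\<close>)

text \<open>The step that makes \<open>N\<close> additive. An eigenvector \<open>w\<close> of
  \<open>m\<close> has eigenvalue 0 because \<open>m\<close> lies in the nil left ideal
  \<open>B m\<close>; if \<open>m + n = e\<close>, then \<open>n\<close> fixes \<open>w\<close>,
  although \<open>B n\<close> is nil.\<close>

lemma nonunits_sum_not_e:
  assumes "m \<in> N" "n \<in> N"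
  shows "m + n \<noteq> e"
proof
  assume eq: "m + n = e"
  have in_ideal: "x \<in> (\<lambda>s. s \<cdot> x) ` B" if "x \<in> N" for x
    using that e_in BD(1)[of x] nonunits_in by force
  obtain c w where w: "w \<in> B" "w \<noteq> 0" "m \<cdot> w = c *s w"
    using eigenvector_exists[OF linear_right[of m] B_subspace _ e_in nonzero] assms B_mult nonunits_in
    by blast
  then have "c = 0"
    using nil_product_not_fixed[OF nil_left_ideal[OF assms(1)] in_ideal[OF assms(1)]] by auto
  then have "n \<cdot> w = 1 *s w"
    using w BD(1)[of w] mult_add_left[of m n w] by (simp add: eq)
  then show False
    using nil_product_not_fixed[OF nil_left_ideal[OF assms(2)] in_ideal[OF assms(2)], of w 1] w(2)
    by simp
qed

lemma subspace_nonunits: "subspace N"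
proof (rule subspaceI)
  show "0 \<in> N"
    using subspace_0[OF B_subspace] nonzero by (intro nonunitsI) auto
next
  fix x y assume xy: "x \<in> N" "y \<in> N"
  show "x + y \<in> N"
  proof (rule nonunitsI)
    show "x + y \<in> B"
      using xy subspace_add[OF B_subspace] nonunits_in by auto
    show "z \<cdot> (x + y) \<noteq> e" if "z \<in> B" for z
      unfolding mult_add_right using that xy by (intro nonunits_sum_not_e nonunits_mult_left)
  qed
next
  fix c x assume x: "x \<in> N"
  have "c *s x = (c *s e) \<cdot> x"
    using BD(1)[of x] x nonunits_in by (simp add: mult_scale_left)
  then show "c *s x \<in> N"
    using nonunits_mult_left[OF subspace_scale[OF B_subspace e_in] x, of c] by simp
qed

text \<open>For an eigenvector \<open>w\<close> of right multiplication by \<open>x\<close> with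
  eigenvalue c, \<open>w\<close> is killed by \<open>x - c e\<close>. Right multiplication by this
  element is then not injective, hence not onto.\<close>

lemma corner_decomposition:
  assumes "x \<in> B"
  shows "\<exists>c. x - c *s e \<in> N"
proof -
  obtain c w where w: "w \<in> B" "w \<noteq> 0" "w \<cdot> x = c *s w"
    using eigenvector_exists[OF linear_left[of x] B_subspace _ e_in nonzero] assms B_mult by blast
  let ?y = "x - c *s e"
  have "?y \<in> B"
    using assms e_in B_subspace by (simp add: subspace_diff subspace_scale)
  moreover have "w \<cdot> ?y = 0 \<cdot> ?y"
    using w BD(2)[of w] by (simp add: mult_distribs)
  ultimately show ?thesis
    using eq_of_mult_right_eq[OF B_subspace, of ?y w 0] w subspace_0[OF B_subspace]
    by (intro exI[of _ c]) (auto simp: nonunits_def)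
qed

lemma closed_nonunits: "closed N"
  using subspace_nonunits by (auto simp: closed_def products_def nonunits_mult_left nonunits_in)

text \<open>An idempotent in \<open>N\<close> would be \<open>e\<close> by primitivity, but
  \<open>e\<close> is a unit.\<close>

lemma nil_nonunits: "nil N"
  using nonnil_has_idempotent[OF closed_nonunits] primitive nonunits_in e_notin_nonunits by blast

end

section \<open>Systems of orthogonal idempotents and their Peirce pieces\<close>

context complex_algebra
begin

definition orthogonal_idempotents :: "nat \<Rightarrow> (nat \<Rightarrow> 'a) \<Rightarrow> bool" where
  "orthogonal_idempotents k e \<longleftrightarrow>
     (\<forall>i\<in>{1..k}. e i \<noteq> 0 \<and> (\<forall>j\<in>{1..k}. mult (e i) (e j) = (if i = j then e i else 0)))"

lemma orthogonal_idempotents_inj_on: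
  assumes "orthogonal_idempotents k e"
  shows "inj_on e {1..k}"
  using assms unfolding orthogonal_idempotents_def by (intro inj_onI) metis

lemma orthogonal_idempotents_independent:
  assumes "orthogonal_idempotents k e"
  shows "independent (e ` {1..k})"
proof (rule independent_if_scalars_zero)
  fix g x assume g: "(\<Sum>x\<in>e ` {1..k}. scale (g x) x) = 0" and "x \<in> e ` {1..k}"
  then obtain b where b: "b \<in> {1..k}" "x = e b"
    by blast
  have "mult (e b) (scale (g (e a)) (e a)) = (if a = b then scale (g (e b)) (e b) else 0)"
    if "a \<in> {1..k}" for a
    using assms that b by (auto simp: orthogonal_idempotents_def mult_scale_right)
  then have "(\<Sum>a=1..k. mult (e b) (scale (g (e a)) (e a))) = scale (g (e b)) (e b)"
    using b(1) by (simp del: One_nat_def atLeastAtMost_iff cong: sum.cong)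
  moreover have "(\<Sum>a=1..k. scale (g (e a)) (e a)) = 0"
    using g by (simp add: sum.reindex[OF orthogonal_idempotents_inj_on[OF assms]] del: One_nat_def)
  then have "(\<Sum>a=1..k. mult (e b) (scale (g (e a)) (e a))) = 0"
    unfolding mult_sum_right[symmetric] by simp
  ultimately show "g x = 0"
    using assms b by (simp add: orthogonal_idempotents_def)
qed simp

end

text \<open>Maximality is in number: no k + 1 orthogonal idempotents exist at all, whether or not
  they extend \<open>e\<close>. This matters when a system unrelated to \<open>e\<close> has to be
  excluded.\<close>

locale maximal_idempotents = fin_dim_algebra +
  fixes k :: nat and e :: "nat \<Rightarrow> 'a"
  assumes orth: "orthogonal_idempotents k e"
    and maximal: "\<And>e'. \<not> orthogonal_idempotents (Suc k) e'"
begin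

lemma e_mult: "i \<in> {1..k} \<Longrightarrow> j \<in> {1..k} \<Longrightarrow> e i \<cdot> e j = (if i = j then e i else 0)"
  and e_nonzero: "i \<in> {1..k} \<Longrightarrow> e i \<noteq> 0"
  using orth by (auto simp: orthogonal_idempotents_def)

text \<open>Index \<open>0\<close> stands for the formal idempotent \<open>1 - e\<^sub>1 - \<dots> - e\<^sub>k\<close>.\<close>

definition piece :: "nat \<Rightarrow> nat \<Rightarrow> 'a set" where
  "piece i j = {x. \<forall>a\<in>{1..k}. e a \<cdot> x = (if a = i then x else 0) \<and> x \<cdot> e a = (if a = j then x else 0)}"

lemma pieceD:
  assumes "x \<in> piece i j" "a \<in> {1..k}"
  shows "e a \<cdot> x = (if a = i then x else 0)" "x \<cdot> e a = (if a = j then x else 0)"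
  using assms by (auto simp: piece_def)

lemma subspace_piece: "subspace (piece i j)"
proof (rule subspaceI)
  show "x + y \<in> piece i j" if "x \<in> piece i j" "y \<in> piece i j" for x y
    unfolding piece_def using pieceD[OF that(1)] pieceD[OF that(2)]
    by (intro CollectI ballI) (simp add: mult_add_left mult_add_right)
  show "c *s x \<in> piece i j" if "x \<in> piece i j" for c x
    unfolding piece_def using pieceD[OF that]
    by (intro CollectI ballI) (simp add: mult_scale_left mult_scale_right)
qed (simp add: piece_def)

lemma piece_mult:
  assumes "x \<in> piece i j" "y \<in> piece j l"
  shows "x \<cdot> y \<in> piece i l"
proof -
  have "e a \<cdot> (x \<cdot> y) = (if a = i then x \<cdot> y else 0)" if "a \<in> {1..k}" for a
    unfolding assoc[symmetric] using pieceD(1)[OF assms(1) that] by simp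
  moreover have "(x \<cdot> y) \<cdot> e a = (if a = l then x \<cdot> y else 0)" if "a \<in> {1..k}" for a
    unfolding assoc using pieceD(2)[OF assms(2) that] by simp
  ultimately show ?thesis
    by (simp add: piece_def)
qed

text \<open>Of two different indices one is nonzero, and its idempotent can be inserted between the
  factors; the formal idempotent with index 0 cannot.\<close>

lemma piece_mult_eq_0:
  assumes "x \<in> piece i j" "y \<in> piece j' l" "j \<noteq> j'" "j \<le> k" "j' \<le> k"
  shows "x \<cdot> y = 0"
proof (cases "j = 0")
  case True
  then have "x \<cdot> (e j' \<cdot> y) = 0"
    using pieceD(2)[OF assms(1), of j'] assms(3,5) by (simp add: assoc[symmetric])
  then show ?thesis
    using pieceD(1)[OF assms(2), of j'] assms(3,5) True by simp
next
  case False
  then have "(x \<cdot> e j) \<cdot> y = 0"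
    using pieceD(1)[OF assms(2), of j] assms(3,4) by (simp add: assoc)
  then show ?thesis
    using pieceD(2)[OF assms(1), of j] assms(4) False by simp
qed

lemma piece_corner:
  assumes "i \<in> {1..k}"
  shows "piece i i = corner (e i)"
proof
  show "piece i i \<subseteq> corner (e i)"
    using assms by (auto simp: piece_def corner_def)
  show "corner (e i) \<subseteq> piece i i"
  proof
    fix x assume x: "x \<in> corner (e i)"
    have ex: "e i \<cdot> x = x" "x \<cdot> e i = x"
      using x by (simp_all add: corner_def)
    have "e a \<cdot> x = (e a \<cdot> e i) \<cdot> x" for a
      unfolding assoc ex(1) ..
    moreover have "x \<cdot> e a = x \<cdot> (e i \<cdot> e a)" for a
      unfolding assoc[symmetric] ex(2) ..
    ultimately have "e a \<cdot> x = (if a = i then x else 0)" "x \<cdot> e a = (if a = i then x else 0)"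
      if "a \<in> {1..k}" for a
      using ex e_mult[OF that assms] e_mult[OF assms that]
        by (metis mult_zero_left, metis mult_zero_right)
    then show "x \<in> piece i i"
      by (simp add: piece_def)
  qed
qed

lemma e_in_piece: "i \<in> {1..k} \<Longrightarrow> e i \<in> piece i i"
  by (simp add: piece_corner corner_def e_mult)

lemma piece_0_idempotent:
  assumes "x \<in> piece 0 0" "x \<cdot> x = x"
  shows "x = 0"
proof (rule ccontr)
  assume "x \<noteq> 0"
  then have "orthogonal_idempotents (Suc k) (e(Suc k := x))"
    unfolding orthogonal_idempotents_def
  proof (intro ballI conjI)
    fix a b assume ab: "a \<in> {1..Suc k}" "b \<in> {1..Suc k}"
    show "(e(Suc k := x)) a \<noteq> 0"
      using \<open>x \<noteq> 0\<close> e_nonzero[of a] ab by auto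
    show "(e(Suc k := x)) a \<cdot> (e(Suc k := x)) b = (if a = b then (e(Suc k := x)) a else 0)"
      using e_mult[of a b] ab pieceD[OF assms(1), of a] pieceD[OF assms(1), of b] assms(2)
      by (cases "a = Suc k"; cases "b = Suc k") auto
  qed
  then show False
    using maximal by blast
qed

text \<open>A further idempotent \<open>x\<close> would split \<open>e i\<close> into the orthogonal
  idempotents \<open>x\<close> and \<open>e i - x\<close>, giving k + 1 of them.\<close>

lemma piece_idempotent:
  assumes "i \<in> {1..k}" "x \<in> corner (e i)" "x \<cdot> x = x"
  shows "x = 0 \<or> x = e i"
proof (rule ccontr)
  assume contr: "\<not> ?thesis"
  let ?e = "e(i := x, Suc k := e i - x)"
  have x: "x \<in> piece i i"
    using assms piece_corner by simp
  have "orthogonal_idempotents (Suc k) ?e"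
    unfolding orthogonal_idempotents_def
  proof (intro ballI conjI)
    fix a b assume ab: "a \<in> {1..Suc k}" "b \<in> {1..Suc k}"
    then show "?e a \<noteq> 0"
      using contr e_nonzero by auto
    have xe: "e i \<cdot> x = x" "x \<cdot> e i = x" "e i \<cdot> e i = e i"
      using pieceD[OF x assms(1)] e_mult[OF assms(1) assms(1)] by simp_all
    have cases: P if "c \<in> {1..Suc k}" "c = Suc k \<Longrightarrow> P" "c = i \<Longrightarrow> P"
        "c \<in> {1..k} \<Longrightarrow> c \<noteq> i \<Longrightarrow> P" for c P
      using that by fastforce
    have ne: "i \<noteq> Suc k"
      using assms(1) by simp
    have c0: "e c \<cdot> x = 0" "x \<cdot> e c = 0" "e c \<cdot> e i = 0" "e i \<cdot> e c = 0" "c \<noteq> Suc k"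
      if "c \<in> {1..k}" "c \<noteq> i" for c
      using pieceD[OF x that(1)] e_mult[OF assms(1) that(1)] e_mult[OF that(1) assms(1)] that
        by auto
    show "?e a \<cdot> ?e b = (if a = b then ?e a else 0)"
      by (rule cases[OF ab(1)]; rule cases[OF ab(2)])
        (simp_all add: ne ne[symmetric] xe c0 e_mult assms(3) mult_distribs)
  qed
  then show False
    using maximal by blast
qed

lemma primitive_e: "i \<in> {1..k} \<Longrightarrow> primitive_idempotent scale mult Basis (e i)"
  by unfold_locales (use piece_idempotent e_nonzero e_mult in auto)

lemma nil_piece_0: "nil (piece 0 0)"
proof -
  have "closed (piece 0 0)"
    using subspace_piece piece_mult by (auto simp: closed_def products_def)
  then show ?thesis
    using nonnil_has_idempotent piece_0_idempotent by blast
qed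

text \<open>Only the diagonal pieces of nonzero index contain an idempotent to be removed. The other
  pieces are taken whole, so products may leave these sets when matrix units are present;
  \<open>rad_closed\<close> excludes that.\<close>

definition rad :: "nat \<Rightarrow> nat \<Rightarrow> 'a set" where
  "rad i j = (if i = j \<and> i \<noteq> 0 then nonunits (e i) else piece i j)"

definition homogeneous :: "'a set" where
  "homogeneous = (\<Union>i\<le>k. \<Union>j\<le>k. rad i j)"

lemma subspace_rad: "i \<le> k \<Longrightarrow> subspace (rad i j)"
  using primitive_idempotent.subspace_nonunits[OF primitive_e] subspace_piece by (simp add: rad_def)

lemma rad_in_piece: "i \<le> k \<Longrightarrow> x \<in> rad i j \<Longrightarrow> x \<in> piece i j"
  by (auto simp: rad_def nonunits_def piece_corner split: if_splits)

lemma homogeneousI: "i \<le> k \<Longrightarrow> j \<le> k \<Longrightarrow> x \<in> rad i j \<Longrightarrow> x \<in> homogeneous"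
  by (auto simp: homogeneous_def)

lemma nil_rad_diag: "i \<le> k \<Longrightarrow> nil (rad i i)"
  using primitive_idempotent.nil_nonunits[OF primitive_e] nil_piece_0 by (auto simp: rad_def)

section \<open>Peirce projections and homogeneous spanning sets\<close>

definition left_part :: "nat \<Rightarrow> 'a \<Rightarrow> 'a" where
  "left_part i x = (if i = 0 then x - (\<Sum>a=1..k. e a \<cdot> x) else e i \<cdot> x)"

definition right_part :: "nat \<Rightarrow> 'a \<Rightarrow> 'a" where
  "right_part j x = (if j = 0 then x - (\<Sum>a=1..k. x \<cdot> e a) else x \<cdot> e j)"

lemma e_mult_sum:
  assumes "b \<in> {1..k}"
  shows "e b \<cdot> (\<Sum>a=1..k. e a \<cdot> x) = e b \<cdot> x" "(\<Sum>a=1..k. x \<cdot> e a) \<cdot> e b = x \<cdot> e b"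
proof -
  have "e b \<cdot> (e a \<cdot> x) = (if a = b then e b \<cdot> x else 0)"
    "(x \<cdot> e a) \<cdot> e b = (if a = b then x \<cdot> e b else 0)" if "a \<in> {1..k}" for a
    using assms that e_mult by (simp_all add: assoc) (simp add: assoc[symmetric] e_mult)
  then show "e b \<cdot> (\<Sum>a=1..k. e a \<cdot> x) = e b \<cdot> x" "(\<Sum>a=1..k. x \<cdot> e a) \<cdot> e b = x \<cdot> e b"
    using assms by (simp_all add: mult_sum_right mult_sum_left del: One_nat_def atLeastAtMost_iff
      cong: sum.cong)
qed

lemma parts_in_piece:
  assumes "i \<le> k" "j \<le> k"
  shows "right_part j (left_part i x) \<in> piece i j"
proof -
  have left: "e a \<cdot> left_part i x = (if a = i then left_part i x else 0)" if "a \<in> {1..k}" for a x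
    using that assms(1) e_mult[OF that, of i]
    by (auto simp: left_part_def mult_diff_right e_mult_sum[OF that]
        assoc[symmetric] simp del: One_nat_def)
  have right: "right_part j x \<cdot> e a = (if a = j then right_part j x else 0)" if "a \<in> {1..k}" for a x
    using that assms(2) e_mult[OF _ that, of j]
    by (auto simp: right_part_def mult_diff_left e_mult_sum[OF that]
        assoc simp del: One_nat_def)
  have comm: "e a \<cdot> right_part j x = right_part j (e a \<cdot> x)" for a x
    by (simp add: right_part_def mult_diff_right mult_sum_right assoc)
  have "right_part j 0 = 0"
    by (simp add: right_part_def)
  then show ?thesis
    using left right by (simp add: piece_def comm)
qed

lemma sum_parts: "x = (\<Sum>i\<le>k. \<Sum>j\<le>k. right_part j (left_part i x))"
proof -
  have *: "sum g {..k} = g 0 + sum g {1..k}" for g :: "nat \<Rightarrow> 'a"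
    by (simp add: sum.atLeast1_atMost_eq sum.atMost_shift)
  have "(\<Sum>j\<le>k. right_part j y) = y" "(\<Sum>i\<le>k. left_part i y) = y" for y
    by (simp_all add: * right_part_def left_part_def)
  then show ?thesis
    by simp
qed

text \<open>Each Peirce component is homogeneous, up to a multiple of \<open>e i\<close> when it is
  diagonal, since corners are local.\<close>

lemma span_homogeneous: "span (e ` {1..k} \<union> homogeneous) = UNIV"
proof -
  let ?U = "span (e ` {1..k} \<union> homogeneous)"
  have "y \<in> ?U" if y: "y \<in> piece i j" "i \<le> k" "j \<le> k" for y i j
  proof (cases "i = j \<and> i \<noteq> 0")
    case True
    then have i: "i \<in> {1..k}"
      using y by auto
    then obtain c where c: "y - c *s e i \<in> nonunits (e i)"
      using primitive_idempotent.corner_decomposition[OF primitive_e[OF i]] y True piece_corner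
      by blast
    then have "y - c *s e i \<in> homogeneous"
      using y True by (intro homogeneousI[of i j]) (auto simp: rad_def)
    then have "(y - c *s e i) + c *s e i \<in> ?U"
      using i by (intro span_add span_scale) (auto intro: span_base)
    then show ?thesis
      by simp
  next
    case False
    then have "y \<in> rad i j"
      using y(1) by (auto simp: rad_def)
    then show ?thesis
      using homogeneousI[OF y(2,3)] by (simp add: span_base)
  qed
  then have "(\<Sum>i\<le>k. \<Sum>j\<le>k. right_part j (left_part i x)) \<in> ?U" for x
    by (intro span_sum) (meson parts_in_piece atMost_iff)
  then have "x \<in> ?U" for x
    using sum_parts[of x] by metis
  then show ?thesis
    by auto
qed

lemma ex_homogeneous_notin:
  assumes "subspace U" "U \<noteq> UNIV" "e ` {1..k} \<subseteq> U"
  shows "\<exists>i\<le>k. \<exists>j\<le>k. \<exists>x\<in>rad i j. x \<notin> U"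
proof (rule ccontr)
  assume "\<not> ?thesis"
  then have "e ` {1..k} \<union> homogeneous \<subseteq> U"
    using assms by (auto simp: homogeneous_def)
  then show False
    using span_minimal[OF _ assms(1)] span_homogeneous assms(2) by blast
qed

lemma diagonal_part_of_piece:
  assumes "x \<in> piece i j" "i \<le> k" "j \<le> k" "a \<in> {1..k}"
  shows "e a \<cdot> x \<cdot> e a = (if i = a \<and> j = a then x else 0)"
  using pieceD[OF assms(1,4)] by auto

text \<open>Compression by \<open>e b\<close> on both sides sends homogeneous elements into
  \<open>rad b b\<close> and the combination to \<open>c b\<close> times \<open>e b\<close>; but
  \<open>e b\<close> is not a nonunit of its corner.\<close>

lemma idempotents_independent_mod_homogeneous:
  assumes "(\<Sum>a=1..k. c a *s e a) \<in> span homogeneous" "b \<in> {1..k}"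
  shows "c b = 0"
proof -
  let ?P = "\<lambda>x. e b \<cdot> x \<cdot> e b"
  have sub: "subspace (rad b b)"
    using assms(2) by (intro subspace_rad) auto
  have "?P x \<in> rad b b" if "x \<in> span homogeneous" for x
  proof -
    have "span homogeneous \<subseteq> {x. ?P x \<in> rad b b}"
    proof (rule span_minimal)
      show "homogeneous \<subseteq> {x. ?P x \<in> rad b b}"
        using diagonal_part_of_piece[OF rad_in_piece] assms(2) subspace_0[OF sub]
        by (auto simp: homogeneous_def)
      show "subspace {x. ?P x \<in> rad b b}"
        using sub
          by (auto simp: mult_distribs subspace_0 subspace_add subspace_scale intro!: subspaceI)
    qed
    then show ?thesis
      using that by blast
  qed
  then have "?P (\<Sum>a=1..k. c a *s e a) \<in> rad b b"
    using assms(1) by blast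
  moreover have "?P (c a *s e a) = (if a = b then c b *s e b else 0)" if "a \<in> {1..k}" for a
    using that assms(2) by (simp add: mult_distribs e_mult)
  then have "?P (\<Sum>a=1..k. c a *s e a) = c b *s e b"
    using assms(2) by (simp add: mult_sum_right mult_sum_left del: One_nat_def atLeastAtMost_iff
      cong: sum.cong)
  ultimately have *: "c b *s e b \<in> rad b b"
    by simp
  show ?thesis
  proof (rule ccontr)
    assume "c b \<noteq> 0"
    then have "e b \<in> nonunits (e b)"
      using subspace_scale[OF sub *, of "1 / c b"] assms(2) by (simp add: rad_def)
    then show False
      using primitive_idempotent.e_notin_nonunits[OF primitive_e] assms(2) by blast
  qed
qed

lemmas inj_on_idempotents = orthogonal_idempotents_inj_on[OF orth]
  and independent_idempotents = orthogonal_idempotents_independent[OF orth]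

definition rad_closed :: bool where
  "rad_closed \<longleftrightarrow> (\<forall>i\<le>k. \<forall>j\<le>k. \<forall>l\<le>k. \<forall>x\<in>rad i j. \<forall>y\<in>rad j l. x \<cdot> y \<in> rad i l)"

lemma rad_mult:
  assumes "rad_closed" "i \<le> k" "j \<le> k" "l \<le> k" "x \<in> rad i j" "y \<in> rad j l"
  shows "x \<cdot> y \<in> rad i l"
  using assms by (simp add: rad_closed_def)

text \<open>A product that leaves the radical parts must lie in some \<open>piece i i\<close> and be
  left invertible there. Rescaling \<open>u\<close> by that inverse gives \<open>u v = e i\<close>;
  then \<open>v u\<close> is a nonzero idempotent of \<open>piece j j\<close>. Hence j is not 0 and
  \<open>v u = e j\<close>.\<close>

lemma rad_closed_or_matrix_units:
  obtains rad_closed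
  | i j u v where "i \<in> {1..k}" "j \<in> {1..k}" "i \<noteq> j" "u \<in> piece i j" "v \<in> piece j i"
    "u \<cdot> v = e i" "v \<cdot> u = e j"
proof (cases rad_closed)
  case True
  then show ?thesis
    using that(1) by blast
next
  case False
  then obtain i j l u v where ijl: "i \<le> k" "j \<le> k" "l \<le> k" and uv: "u \<in> rad i j" "v \<in> rad j l"
    and notin: "u \<cdot> v \<notin> rad i l"
    unfolding rad_closed_def by blast
  have uvp: "u \<in> piece i j" "v \<in> piece j l"
    using uv ijl rad_in_piece by auto
  then have il: "i = l" "i \<in> {1..k}"
    using notin piece_mult[of u i j v l] ijl by (auto simp: rad_def split: if_splits)
  interpret P: primitive_idempotent scale mult Basis "e i"
    by (rule primitive_e[OF il(2)])
  have ij: "i \<noteq> j"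
  proof
    assume "i = j"
    then show False
      using notin uv il closedD[OF P.closed_nonunits] by (simp add: rad_def)
  qed
  have "u \<cdot> v \<in> corner (e i)"
    using piece_mult[of u i j v i] uvp il piece_corner by auto
  then obtain w where w: "w \<in> corner (e i)" "w \<cdot> (u \<cdot> v) = e i"
    using P.nonunitsI[of "u \<cdot> v"] notin il by (auto simp: rad_def)
  let ?u = "w \<cdot> u"
  have u: "?u \<in> piece i j"
    using piece_mult[of w i i u j] w uvp piece_corner[OF il(2)] by auto
  have v: "v \<in> piece j i"
    using uvp il by simp
  have uv1: "?u \<cdot> v = e i"
    using w by (simp add: assoc)
  have "(v \<cdot> ?u) \<cdot> (v \<cdot> ?u) = v \<cdot> (?u \<cdot> v) \<cdot> ?u"
    by (simp add: assoc)
  also have "\<dots> = v \<cdot> ?u"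
    using pieceD(2)[OF v il(2)] unfolding uv1 by simp
  finally have idem: "(v \<cdot> ?u) \<cdot> (v \<cdot> ?u) = v \<cdot> ?u" .
  have "?u \<cdot> (v \<cdot> ?u) \<cdot> v = (?u \<cdot> v) \<cdot> (?u \<cdot> v)"
    by (simp add: assoc)
  also have "\<dots> = e i"
    unfolding uv1 using il(2) by (simp add: e_mult)
  finally have "v \<cdot> ?u \<noteq> 0"
    using e_nonzero[OF il(2)] by auto
  moreover have vu: "v \<cdot> ?u \<in> piece j j"
    using piece_mult[OF v u] .
  ultimately have "j \<noteq> 0"
    using piece_0_idempotent[OF _ idem] by metis
  then have j: "j \<in> {1..k}"
    using ijl by auto
  then have "v \<cdot> ?u = e j"
    using piece_idempotent[OF j _ idem] vu \<open>v \<cdot> ?u \<noteq> 0\<close> piece_corner[OF j]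
      by auto
  then show ?thesis
    using that(2)[OF il(2) j ij u v uv1] by blast
qed

end

section \<open>Bases with a multiplication table of the list\<close>

definition entry :: "nat \<Rightarrow> complex \<Rightarrow> complex \<Rightarrow> (complex \<times> nat \<times> nat \<times> nat) list" where
  "entry i p q = the (map_of (d_terms p q) i)"

text \<open>One lookup per literal index, evaluated once, so that the many case splits rewrite with
  finished lists instead of unfolding \<open>d_terms\<close>.\<close>

lemmas entry_lookups =
  entry_def[of 1] entry_def[of 2] entry_def[of 3] entry_def[of 4] entry_def[of 5]
  entry_def[of 6] entry_def[of 7] entry_def[of 8] entry_def[of 9] entry_def[of 10]
  entry_def[of 11] entry_def[of 12] entry_def[of 13] entry_def[of 14] entry_def[of 15]
  entry_def[of 16] entry_def[of 17] entry_def[of 18] entry_def[of 19] entry_def[of 20]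
  entry_def[of 21] entry_def[of 22] entry_def[of 23] entry_def[of 24] entry_def[of 25]
  entry_def[of 26] entry_def[of 27] entry_def[of 28] entry_def[of 29] entry_def[of 30]
  entry_def[of 31] entry_def[of 32] entry_def[of 33] entry_def[of 34] entry_def[of 35]
  entry_def[of 36] entry_def[of 37] entry_def[of 38] entry_def[of 39] entry_def[of 40]
  entry_def[of 41] entry_def[of 42] entry_def[of 43] entry_def[of 44] entry_def[of 45]
  entry_def[of 46] entry_def[of 47] entry_def[of 48] entry_def[of 49] entry_def[of 50]
  entry_def[of 51] entry_def[of 52] entry_def[of 53] entry_def[of 54] entry_def[of 55]
  entry_def[of 56] entry_def[of 57] entry_def[of 58] entry_def[of 59] entry_def[of 60]
  entry_def[of 61] entry_def[of 62] entry_def[of 63] entry_def[of 64] entry_def[of 65]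
  entry_def[of 66] entry_def[of 67] entry_def[of 68] entry_def[of 69] entry_def[of 70]
  entry_def[of 71] entry_def[of 72]

lemmas entry_eqs = entry_lookups[unfolded d_terms_def map_of_Cons_code(2) rel_simps refl
    if_True if_False option.sel simp_thms]

lemma d_mult_entry: "d_mult scale f i p q = sum_of_terms scale f (entry i p q)"
  by (simp add: d_mult_def entry_def)

lemma atLeastAtMost_1_4: "{1..4::nat} = {1, 2, 3, 4}"
  by auto

text \<open>All indices other than 1, 2, 3 are sent to \<open>z\<close>; of these only 4 is
  meant.\<close>

definition basis_of :: "'a \<Rightarrow> 'a \<Rightarrow> 'a \<Rightarrow> 'a \<Rightarrow> nat \<Rightarrow> 'a" where
  "basis_of w x y z n = (if n = 1 then w else if n = 2 then x else if n = 3 then y else z)"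

context complex_algebra
begin

definition has_table :: "(complex \<times> nat \<times> nat \<times> nat) list \<Rightarrow> (nat \<Rightarrow> 'a) \<Rightarrow> bool" where
  "has_table ts b \<longleftrightarrow> (\<forall>i\<in>{1..4}. \<forall>j\<in>{1..4}.
     mult (b i) (b j) = (\<Sum>(c, i', j', l)\<leftarrow>ts. if i' = i \<and> j' = j then scale c (b l) else 0))"

definition listed :: bool where
  "listed \<longleftrightarrow> (\<exists>i\<in>{1..72}. \<exists>p q b. four_dim_basis scale b \<and> has_table (entry i p q) b)"

end

locale four_dim_algebra = fin_dim_algebra +
  assumes dim_4: "dim UNIV = 4"
begin

text \<open>Spanning is enough: four vectors that span a space of dimension 4 are distinct and
  independent.\<close>

definition basis4 :: "'a \<Rightarrow> 'a \<Rightarrow> 'a \<Rightarrow> 'a \<Rightarrow> bool" where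
  "basis4 w x y z \<longleftrightarrow> span {w, x, y, z} = UNIV"

lemma basis4_imp_four_dim_basis:
  assumes "basis4 w x y z"
  shows "four_dim_basis scale (basis_of w x y z)"
proof -
  let ?S = "{w, x, y, z}"
  have image: "basis_of w x y z ` {1..4} = ?S"
    unfolding atLeastAtMost_1_4 by (auto simp: basis_of_def)
  have le: "4 \<le> card ?S"
    using dim_le_card[of UNIV ?S] assms dim_4 by (simp add: basis4_def)
  have "card ?S = 4"
    using le card_length[of "[w, x, y, z]"] by simp
  then have "inj_on (basis_of w x y z) {1..4}"
    using image by (intro eq_card_imp_inj_on) auto
  moreover have "independent ?S"
    using card_le_dim_spanning[of ?S UNIV] \<open>card ?S = 4\<close> assms dim_4
      by (simp add: basis4_def)
  ultimately show ?thesis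
    using assms image by unfold_locales (simp_all add: basis4_def del: One_nat_def)
qed

lemma listedI:
  assumes "basis4 w x y z" "has_table (entry i p q) (basis_of w x y z)" "i \<in> {1..72}"
  shows listed
  using assms basis4_imp_four_dim_basis unfolding listed_def by blast

lemma basis4_swap: "basis4 w x y z \<Longrightarrow> basis4 x w y z"
  and basis4_rot: "basis4 w x y z \<Longrightarrow> basis4 x y z w"
  by (simp_all add: basis4_def insert_commute)



lemma basis4_change:
  assumes "basis4 w x y z" "{w, x, y, z} \<subseteq> span {w', x', y', z'}"
  shows "basis4 w' x' y' z'"
  using span_minimal[OF assms(2) subspace_span] assms(1) by (auto simp: basis4_def)

lemma basis4_nonzero:
  assumes "basis4 w x y z"
  shows "w \<noteq> 0" "x \<noteq> 0" "y \<noteq> 0" "z \<noteq> 0"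
proof -
  have "w \<noteq> 0" if "basis4 w x y z" for w x y z
  proof
    assume "w = 0"
    then have "span {x, y, z} = UNIV"
      using that by (simp add: basis4_def)
    then have "4 \<le> card {x, y, z}"
      using dim_le_card[of UNIV "{x, y, z}"] dim_4 by simp
    moreover have "card {x, y, z} \<le> 3"
      using card_length[of "[x, y, z]"] by simp
    ultimately show False
      by simp
  qed
  then show "w \<noteq> 0" "x \<noteq> 0" "y \<noteq> 0" "z \<noteq> 0"
    using assms basis4_rot by blast+
qed

lemmas table_simps = has_table_def atLeastAtMost_1_4 ball_simps entry_eqs list.map sum_list.Cons
  sum_list.Nil prod.case basis_of_def rel_simps refl if_True if_False simp_thms

section \<open>Radicals with zero multiplication: classification by Peirce types\<close>

definition acts1 :: "'a \<Rightarrow> 'a \<Rightarrow> nat \<times> nat \<Rightarrow> bool" where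
  "acts1 e x t \<longleftrightarrow> e \<cdot> x = (if fst t = 1 then x else 0) \<and> x \<cdot> e = (if snd t = 1 then x else 0)"

definition acts2 :: "'a \<Rightarrow> 'a \<Rightarrow> 'a \<Rightarrow> nat \<times> nat \<Rightarrow> bool" where
  "acts2 e1 e2 x t \<longleftrightarrow>
     e1 \<cdot> x = (if fst t = 1 then x else 0) \<and> x \<cdot> e1 = (if snd t = 1 then x else 0) \<and>
     e2 \<cdot> x = (if fst t = 2 then x else 0) \<and> x \<cdot> e2 = (if snd t = 2 then x else 0)"

text \<open>With zero products on the radical, the three types determine the whole table. The order
  of the types is irrelevant, and for two idempotents so is their numbering.\<close>

definition null1 :: "nat \<times> nat \<Rightarrow> nat \<times> nat \<Rightarrow> nat \<times> nat \<Rightarrow> bool" where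
  "null1 t1 t2 t3 \<longleftrightarrow> (\<exists>x y z e. basis4 x y z e \<and> e \<cdot> e = e \<and>
     acts1 e x t1 \<and> acts1 e y t2 \<and> acts1 e z t3 \<and>
     (\<forall>u\<in>{x, y, z}. \<forall>v\<in>{x, y, z}. u \<cdot> v = 0))"

definition null2 :: "nat \<times> nat \<Rightarrow> nat \<times> nat \<Rightarrow> bool" where
  "null2 t1 t2 \<longleftrightarrow> (\<exists>x y e1 e2. basis4 x y e1 e2 \<and>
     e1 \<cdot> e1 = e1 \<and> e2 \<cdot> e2 = e2 \<and> e1 \<cdot> e2 = 0 \<and> e2 \<cdot> e1 = 0 \<and>
     acts2 e1 e2 x t1 \<and> acts2 e1 e2 y t2 \<and> (\<forall>u\<in>{x, y}. \<forall>v\<in>{x, y}. u \<cdot> v = 0))"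

lemma null1_swap: "null1 t1 t2 t3 \<Longrightarrow> null1 t2 t1 t3"
proof -
  assume "null1 t1 t2 t3"
  then obtain x y z e where "basis4 x y z e" "e \<cdot> e = e"
    "acts1 e x t1" "acts1 e y t2" "acts1 e z t3" "\<forall>u\<in>{x, y, z}. \<forall>v\<in>{x, y, z}. u \<cdot> v = 0"
    by (auto simp: null1_def)
  then show "null1 t2 t1 t3"
    unfolding null1_def using basis4_swap[of x y z e]
    by (intro exI[of _ y] exI[of _ x] exI[of _ z] exI[of _ e]) auto
qed

lemma null1_swap': "null1 t1 t2 t3 \<Longrightarrow> null1 t1 t3 t2"
proof -
  assume "null1 t1 t2 t3"
  then obtain x y z e where "basis4 x y z e" "e \<cdot> e = e"
    "acts1 e x t1" "acts1 e y t2" "acts1 e z t3" "\<forall>u\<in>{x, y, z}. \<forall>v\<in>{x, y, z}. u \<cdot> v = 0"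
    by (auto simp: null1_def)
  moreover from this have "basis4 x z y e"
    by (simp add: basis4_def insert_commute)
  ultimately show "null1 t1 t3 t2"
    unfolding null1_def
    by (intro exI[of _ x] exI[of _ z] exI[of _ y] exI[of _ e]) auto
qed

definition swap12 :: "nat \<Rightarrow> nat" where
  "swap12 i = (if i = 1 then 2 else if i = 2 then 1 else i)"

lemma null2_swap: "null2 t1 t2 \<Longrightarrow> null2 t2 t1"
proof -
  assume "null2 t1 t2"
  then obtain x y e1 e2 where *: "basis4 x y e1 e2" "e1 \<cdot> e1 = e1" "e2 \<cdot> e2 = e2"
    "e1 \<cdot> e2 = 0" "e2 \<cdot> e1 = 0" "acts2 e1 e2 x t1" "acts2 e1 e2 y t2"
    "\<forall>u\<in>{x, y}. \<forall>v\<in>{x, y}. u \<cdot> v = 0"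
    by (auto simp: null2_def)
  then show "null2 t2 t1"
    unfolding null2_def using basis4_swap[of x y e1 e2]
    by (intro exI[of _ y] exI[of _ x] exI[of _ e1] exI[of _ e2]) auto
qed

lemma acts2_swap12: "acts2 e1 e2 x t \<Longrightarrow> acts2 e2 e1 x (map_prod swap12 swap12 t)"
  by (auto simp: acts2_def swap12_def)

lemma null2_swap12:
  assumes "null2 t1 t2"
  shows "null2 (map_prod swap12 swap12 t1) (map_prod swap12 swap12 t2)"
proof -
  from assms obtain x y e1 e2 where *: "basis4 x y e1 e2" "e1 \<cdot> e1 = e1" "e2 \<cdot> e2 = e2"
    "e1 \<cdot> e2 = 0" "e2 \<cdot> e1 = 0" "acts2 e1 e2 x t1" "acts2 e1 e2 y t2"
    "\<forall>u\<in>{x, y}. \<forall>v\<in>{x, y}. u \<cdot> v = 0"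
    by (auto simp: null2_def)
  have "basis4 x y e2 e1"
    using *(1) by (simp add: basis4_def insert_commute)
  then show ?thesis
    unfolding null2_def using * acts2_swap12 by blast
qed

text \<open>For each entry with square-zero radical, the Peirce types of the radical basis vectors; the
  index \<open>1\<close> (and \<open>2\<close>) refers to the idempotent \<open>f\<^sub>4\<close> (to \<open>f\<^sub>3\<close> and \<open>f\<^sub>4\<close>), the
  index \<open>0\<close> to its formal complement.\<close>

definition types1 :: "(nat \<times> (nat \<times> nat) \<times> (nat \<times> nat) \<times> (nat \<times> nat)) list" where
  "types1 = [
     (53, (0, 1), (0, 1), (1, 0)), (54, (1, 0), (1, 0), (0, 1)), (55, (1, 0), (1, 0), (1, 0)),
     (56, (0, 1), (0, 1), (0, 1)), (57, (1, 1), (0, 1), (1, 0)), (58, (1, 1), (1, 0), (0, 0)),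
     (59, (1, 1), (0, 1), (0, 0)), (60, (1, 0), (0, 0), (0, 1)), (61, (1, 1), (1, 0), (1, 0)),
     (62, (1, 1), (0, 1), (0, 1)), (63, (1, 0), (1, 0), (0, 0)), (64, (0, 1), (0, 1), (0, 0)),
     (65, (1, 1), (1, 1), (0, 0)), (66, (1, 1), (1, 1), (1, 0)), (67, (1, 1), (1, 1), (0, 1)),
     (68, (1, 1), (0, 0), (0, 0)), (69, (1, 0), (0, 0), (0, 0)), (70, (0, 1), (0, 0), (0, 0)),
     (71, (1, 1), (1, 1), (1, 1)), (72, (0, 0), (0, 0), (0, 0))]"

definition types2 :: "(nat \<times> (nat \<times> nat) \<times> (nat \<times> nat)) list" where
  "types2 = [
     (10, (1, 2), (1, 0)), (11, (2, 1), (0, 1)), (12, (1, 0), (2, 0)), (13, (0, 1), (0, 2)),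
     (14, (1, 0), (0, 2)), (15, (1, 2), (2, 0)), (16, (2, 1), (0, 2)), (17, (1, 2), (1, 2)),
     (18, (1, 0), (1, 0)), (19, (0, 1), (0, 1)), (20, (1, 0), (0, 1)), (21, (2, 1), (1, 2)),
     (22, (1, 0), (1, 1)), (23, (0, 1), (1, 1)), (24, (1, 2), (0, 0)), (25, (1, 0), (2, 2)),
     (26, (0, 1), (2, 2)), (27, (2, 1), (2, 2)), (28, (1, 2), (2, 2)), (29, (0, 0), (1, 0)),
     (30, (0, 0), (0, 1)), (31, (0, 0), (1, 1)), (32, (1, 1), (2, 2)), (33, (1, 1), (1, 1)),
     (34, (0, 0), (0, 0))]"

text \<open>Four possible types, three radical vectors in any order: 20 multisets, the length of
  \<open>types1\<close>.\<close>

lemma types1_complete: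
  "\<forall>t1\<in>{(0, 0), (0, 1), (1, 0), (1, 1)}. \<forall>t2\<in>{(0, 0), (0, 1), (1, 0), (1, 1)}.
     \<forall>t3\<in>{(0, 0), (0, 1), (1, 0), (1, 1)}. \<exists>(i, s)\<in>set types1.
     s \<in> {(t1, t2, t3), (t1, t3, t2), (t2, t1, t3), (t2, t3, t1), (t3, t1, t2), (t3, t2, t1)}"
  by (simp only: types1_def list.set ball_simps bex_simps prod.case insert_iff empty_iff prod.inject
      zero_neq_one one_neq_zero simp_thms)

text \<open>Nine types give 45 unordered pairs. Exchanging the two idempotents fixes 5 of them,
  which leaves (45 + 5) / 2 = 25 orbits, the length of \<open>types2\<close>.\<close>

lemma types2_complete:
  "\<forall>t1\<in>{0, 1, 2} \<times> {0, 1, 2}. \<forall>t2\<in>{0, 1, 2} \<times> {0, 1, 2}. \<exists>(i, s)\<in>set types2.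
     s \<in> {(t1, t2), (t2, t1),
       (map_prod swap12 swap12 t1, map_prod swap12 swap12 t2),
       (map_prod swap12 swap12 t2, map_prod swap12 swap12 t1)}"
proof -
  have swap: "swap12 0 = 0" "swap12 1 = 2" "swap12 2 = 1"
    by (simp_all add: swap12_def)
  show ?thesis
  proof (intro ballI)
    fix t1 t2 :: "nat \<times> nat"
    assume "t1 \<in> {0, 1, 2} \<times> {0, 1, 2}" "t2 \<in> {0, 1, 2} \<times> {0, 1, 2}"
    then show "\<exists>(i, s)\<in>set types2. s \<in> {(t1, t2), (t2, t1),
        (map_prod swap12 swap12 t1, map_prod swap12 swap12 t2),
        (map_prod swap12 swap12 t2, map_prod swap12 swap12 t1)}"
      by (elim SigmaE insertE emptyE; hypsubst; simp only: types2_def list.set bex_simps prod.case insert_iff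
          empty_iff prod.inject map_prod_simp swap zero_neq_one one_neq_zero simp_thms rel_simps)
  qed
qed

lemma types1_listed:
  assumes "(i, t1, t2, t3) \<in> set types1" "null1 t1 t2 t3"
  shows listed
proof -
  from assms(2) obtain x y z e where *: "basis4 x y z e" "e \<cdot> e = e"
    "acts1 e x t1" "acts1 e y t2" "acts1 e z t3"
    and 0: "\<forall>u\<in>{x, y, z}. \<forall>v\<in>{x, y, z}. u \<cdot> v = 0"
    by (auto simp: null1_def)
  have 0: "x \<cdot> x = 0" "x \<cdot> y = 0" "x \<cdot> z = 0" "y \<cdot> x = 0" "y \<cdot> y = 0" "y \<cdot> z = 0"
    "z \<cdot> x = 0" "z \<cdot> y = 0" "z \<cdot> z = 0"
    using 0 by auto
  have "has_table (entry i 0 0) (basis_of x y z e)"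
    using assms(1) *(2-) unfolding types1_def list.set insert_iff prod.inject empty_iff acts1_def
    by (elim disjE conjE FalseE; simp only: table_simps) (simp_all add: 0)
  moreover have "i \<in> {1..72}"
    using assms(1) by (auto simp: types1_def)
  ultimately show ?thesis
    using listedI *(1) by blast
qed

lemma types2_listed:
  assumes "(i, t1, t2) \<in> set types2" "null2 t1 t2"
  shows listed
proof -
  from assms(2) obtain x y e1 e2 where *: "basis4 x y e1 e2"
    "e1 \<cdot> e1 = e1" "e2 \<cdot> e2 = e2" "e1 \<cdot> e2 = 0" "e2 \<cdot> e1 = 0"
    "acts2 e1 e2 x t1" "acts2 e1 e2 y t2"
    and 0: "\<forall>u\<in>{x, y}. \<forall>v\<in>{x, y}. u \<cdot> v = 0"
    by (auto simp: null2_def)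
  have 0: "x \<cdot> x = 0" "x \<cdot> y = 0" "y \<cdot> x = 0" "y \<cdot> y = 0"
    using 0 by auto
  have "has_table (entry i 0 0) (basis_of x y e1 e2)"
    using assms(1) *(2-) unfolding types2_def list.set insert_iff prod.inject empty_iff acts2_def
    by (elim disjE conjE FalseE; simp only: table_simps) (simp_all add: 0)
  moreover have "i \<in> {1..72}"
    using assms(1) by (auto simp: types2_def)
  ultimately show ?thesis
    using listedI *(1) by blast
qed

lemma null1_listed:
  assumes "null1 t1 t2 t3" "{t1, t2, t3} \<subseteq> {0, 1} \<times> {0, 1}"
  shows listed
proof -
  have "{0, 1::nat} \<times> {0, 1::nat} = {(0, 0), (0, 1), (1, 0), (1, 1)}"
    by auto
  then have "t1 \<in> {(0, 0), (0, 1), (1, 0), (1, 1)}" "t2 \<in> {(0, 0), (0, 1), (1, 0), (1, 1)}"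
    "t3 \<in> {(0, 0), (0, 1), (1, 0), (1, 1)}"
    using assms(2) by simp_all
  from bspec[OF bspec[OF bspec[OF types1_complete this(1)] this(2)] this(3)]
  obtain i s where s: "(i, s) \<in> set types1"
    "s \<in> {(t1, t2, t3), (t1, t3, t2), (t2, t1, t3), (t2, t3, t1), (t3, t1, t2), (t3, t2, t1)}"
    by (elim bexE case_prodE) simp
  have "null1 t1 t3 t2" "null1 t2 t1 t3" "null1 t2 t3 t1" "null1 t3 t1 t2" "null1 t3 t2 t1"
    using assms(1) null1_swap null1_swap' by blast+
  then have "\<forall>(t1, t2, t3)\<in>{(t1, t2, t3), (t1, t3, t2), (t2, t1, t3), (t2, t3, t1), (t3, t1, t2),
      (t3, t2, t1)}. null1 t1 t2 t3"
    using assms(1) by simp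
  from bspec[OF this s(2)] show ?thesis
    by (elim case_prodE) (use types1_listed s(1) in simp)
qed

lemma null2_listed:
  assumes "null2 t1 t2" "{t1, t2} \<subseteq> {0, 1, 2} \<times> {0, 1, 2}"
  shows listed
proof -
  let ?s = "map_prod swap12 swap12"
  have "t1 \<in> {0, 1, 2} \<times> {0, 1, 2}" "t2 \<in> {0, 1, 2} \<times> {0, 1, 2}"
    using assms(2) by simp_all
  from bspec[OF bspec[OF types2_complete this(1)] this(2)]
  obtain i s where s: "(i, s) \<in> set types2" "s \<in> {(t1, t2), (t2, t1), (?s t1, ?s t2), (?s t2, ?s t1)}"
    by (elim bexE case_prodE) simp
  have "null2 t2 t1" "null2 (?s t1) (?s t2)" "null2 (?s t2) (?s t1)"
    using assms(1) null2_swap null2_swap12 by blast+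
  then have "\<forall>(t1, t2)\<in>{(t1, t2), (t2, t1), (?s t1, ?s t2), (?s t2, ?s t1)}. null2 t1 t2"
    using assms(1) by simp
  from bspec[OF this s(2)] show ?thesis
    by (elim case_prodE) (use types2_listed s(1) in simp)
qed

section \<open>Tables with given basis vectors and nonzero products\<close>

lemma listed_2:
  fixes e :: "nat \<Rightarrow> 'a"
  assumes "basis4 (e 1) (e 2) (e 3) (e 4)"
    and "\<And>i j. i \<in> {1..4} \<Longrightarrow> j \<in> {1..4} \<Longrightarrow> e i \<cdot> e j = (if i = j then e i else 0)"
  shows listed
  using assms(1) by (rule listedI[where i = 2], simp only: table_simps) (use assms(2) in simp_all)

lemma listed_1:
  assumes "basis4 e u v e'"
    and "e \<cdot> e = e" "e' \<cdot> e' = e'" "e \<cdot> e' = 0" "e' \<cdot> e = 0"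
    and "e \<cdot> u = u" "u \<cdot> e' = u" "u \<cdot> e = 0" "e' \<cdot> u = 0"
    and "e' \<cdot> v = v" "v \<cdot> e = v" "v \<cdot> e' = 0" "e \<cdot> v = 0"
    and "u \<cdot> u = 0" "v \<cdot> v = 0" "u \<cdot> v = e" "v \<cdot> u = e'"
  shows listed
  using assms(1) by (rule listedI[where i = 1], simp only: table_simps) (simp_all add: assms(2-))

text \<open>The idempotents are renumbered as \<open>a\<close>, \<open>b\<close>, \<open>c\<close>
  to serve as f2, f3, f4; up to this renumbering the type of \<open>x\<close> is one of the five
  pairs.\<close>

lemma listed_3_7:
  fixes e :: "nat \<Rightarrow> 'a"
  assumes "basis4 x (e a) (e b) (e c)" "distinct [a, b, c]" "{a, b, c} \<subseteq> {1..3}"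
    and e: "\<And>i j. i \<in> {1..3} \<Longrightarrow> j \<in> {1..3} \<Longrightarrow> e i \<cdot> e j = (if i = j then e i else 0)"
    and x: "\<And>l. l \<in> {1..3} \<Longrightarrow> e l \<cdot> x = (if l = i then x else 0) \<and> x \<cdot> e l = (if l = j then x else 0)"
    and "x \<cdot> x = 0"
    and ij: "(i, j) \<in> {(a, b), (0, a), (a, 0), (a, a), (0, 0)}"
  shows listed
proof -
  have e': "e a \<cdot> e a = e a" "e b \<cdot> e b = e b" "e c \<cdot> e c = e c" "e a \<cdot> e b = 0" "e a \<cdot> e c = 0"
    "e b \<cdot> e a = 0" "e b \<cdot> e c = 0" "e c \<cdot> e a = 0" "e c \<cdot> e b = 0"
    using e assms(2,3) by auto
  have ac: "a \<noteq> 0" "b \<noteq> 0" "c \<noteq> 0" "a \<noteq> b" "a \<noteq> c" "b \<noteq> c" "b \<noteq> a" "c \<noteq> a" "c \<noteq> b"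
    using assms(2,3) by auto
  have x': "e l \<cdot> x = (if l = i then x else 0)" "x \<cdot> e l = (if l = j then x else 0)"
    if "l \<in> {a, b, c}" for l
    using x that assms(3) by auto
  note facts = e' x'[of a, simplified] x'[of b, simplified] x'[of c, simplified] \<open>x \<cdot> x = 0\<close> ac
  let ?b = "basis_of x (e a) (e b) (e c)"
  have "has_table (entry 3 0 0) ?b \<or> has_table (entry 4 0 0) ?b \<or> has_table (entry 5 0 0) ?b \<or>
    has_table (entry 6 0 0) ?b \<or> has_table (entry 7 0 0) ?b"
    using ij unfolding insert_iff prod.inject empty_iff
  proof (elim disjE conjE FalseE)
    assume "i = a" "j = b"
    then have "has_table (entry 3 0 0) ?b"
      by (simp only: table_simps) (simp add: facts)
    then show ?thesis by simp
  next
    assume "i = 0" "j = a"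
    then have "has_table (entry 4 0 0) ?b"
      by (simp only: table_simps) (simp add: facts)
    then show ?thesis by simp
  next
    assume "i = a" "j = 0"
    then have "has_table (entry 5 0 0) ?b"
      by (simp only: table_simps) (simp add: facts)
    then show ?thesis by simp
  next
    assume "i = a" "j = a"
    then have "has_table (entry 6 0 0) ?b"
      by (simp only: table_simps) (simp add: facts)
    then show ?thesis by simp
  next
    assume "i = 0" "j = 0"
    then have "has_table (entry 7 0 0) ?b"
      by (simp only: table_simps) (simp add: facts)
    then show ?thesis by simp
  qed
  then show ?thesis
    using listedI[OF assms(1)] by (elim disjE) simp_all
qed

lemma listed_8_9:
  assumes "basis4 (x \<cdot> x) x e1 e2"
    and "e1 \<cdot> e1 = e1" "e2 \<cdot> e2 = e2" "e1 \<cdot> e2 = 0" "e2 \<cdot> e1 = 0"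
    and "acts2 e1 e2 x t" "acts2 e1 e2 (x \<cdot> x) t" "t \<in> {(1, 1), (0, 0)}"
    and "x \<cdot> (x \<cdot> x) = 0"
  shows listed
proof -
  have "has_table (entry 8 0 0) (basis_of (x \<cdot> x) x e1 e2) \<or>
    has_table (entry 9 0 0) (basis_of (x \<cdot> x) x e1 e2)"
  proof (cases "t = (1, 1)")
    case True
    have "has_table (entry 8 0 0) (basis_of (x \<cdot> x) x e1 e2)"
      using assms(2-) True by (simp only: table_simps) (simp add: acts2_def assoc)
    then show ?thesis ..
  next
    case False
    then have "has_table (entry 9 0 0) (basis_of (x \<cdot> x) x e1 e2)"
      using assms(2-) by (simp only: table_simps) (simp add: acts2_def assoc)
    then show ?thesis ..
  qed
  then show ?thesis
    using listedI[OF assms(1)] by (elim disjE) simp_all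
qed

lemma listed_35_36:
  assumes "basis4 (x \<cdot> x) (x \<cdot> (x \<cdot> x)) x e" "e \<cdot> e = e"
    and "acts1 e x t" "acts1 e (x \<cdot> x) t" "acts1 e (x \<cdot> (x \<cdot> x)) t" "t \<in> {(1, 1), (0, 0)}"
    and "x \<cdot> (x \<cdot> (x \<cdot> x)) = 0"
  shows listed
proof -
  let ?b = "basis_of (x \<cdot> x) (x \<cdot> (x \<cdot> x)) x e"
  have "has_table (entry 35 0 0) ?b \<or> has_table (entry 36 0 0) ?b"
  proof (cases "t = (1, 1)")
    case True
    have "has_table (entry 35 0 0) ?b"
      using assms(2-) True by (simp only: table_simps) (simp add: acts1_def assoc)
    then show ?thesis ..
  next
    case False
    then have "has_table (entry 36 0 0) ?b"
      using assms(2-) by (simp only: table_simps) (simp add: acts1_def assoc)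
    then show ?thesis ..
  qed
  then show ?thesis
    using listedI[OF assms(1)] by (elim disjE) simp_all
qed

text \<open>Radical spanned by \<open>x\<close>, \<open>x x\<close> and a vector \<open>y\<close> of
  another type: first the type of \<open>x\<close>, then that of \<open>y\<close>. The type of
  \<open>x\<close> is diagonal because its square is nonzero.\<close>

definition square_types :: "(nat \<times> (nat \<times> nat) \<times> (nat \<times> nat)) list" where
  "square_types = [(45, (1, 1), (1, 0)), (46, (1, 1), (0, 1)), (47, (0, 0), (0, 1)),
     (48, (0, 0), (1, 0)), (49, (0, 0), (1, 1)), (50, (1, 1), (0, 0))]"

lemma square_listed:
  assumes "basis4 y m x e" "e \<cdot> e = e" "acts1 e x s" "acts1 e m s" "acts1 e y t"
    and "x \<cdot> x = m" "x \<cdot> y = 0" "y \<cdot> x = 0" "y \<cdot> y = 0"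
    and "x \<cdot> m = 0" "m \<cdot> x = 0" "y \<cdot> m = 0" "m \<cdot> y = 0" "m \<cdot> m = 0"
    and "s \<in> {(0, 0), (1, 1)}" "t \<in> {0, 1} \<times> {0, 1}" "s \<noteq> t"
  shows listed
proof -
  have "\<exists>i. (i, s, t) \<in> set square_types"
    using assms(15-17) by (elim insertE emptyE SigmaE; simp add: square_types_def)
  then obtain i where i: "(i, s, t) \<in> set square_types" ..
  have "has_table (entry i 0 0) (basis_of y m x e)"
    using i assms(2-5) unfolding square_types_def list.set insert_iff prod.inject empty_iff acts1_def
    by (elim disjE conjE FalseE; simp only: table_simps) (simp_all add: assms(6-14))
  moreover have "i \<in> {1..72}"
    using i by (auto simp: square_types_def)
  ultimately show ?thesis
    using listedI assms(1) by blast
qed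

text \<open>The indices i, j, l are those of a chain: \<open>x\<close> has type (i, j),
  \<open>y\<close> has type (j, l), and their product has type (i, l).\<close>

definition product_types :: "(nat \<times> nat \<times> nat \<times> nat) list" where
  "product_types = [(39, 1, 0, 1), (40, 0, 1, 0), (41, 1, 0, 0), (42, 0, 0, 1), (43, 0, 1, 1),
     (44, 1, 1, 0)]"

lemma product_listed:
  assumes "basis4 x m y e" "e \<cdot> e = e" "acts1 e x (i, j)" "acts1 e y (j, l)" "acts1 e m (i, l)"
    and "x \<cdot> y = m" "x \<cdot> x = 0" "y \<cdot> x = 0" "y \<cdot> y = 0"
    and "x \<cdot> m = 0" "m \<cdot> x = 0" "y \<cdot> m = 0" "m \<cdot> y = 0" "m \<cdot> m = 0"
    and "{i, j, l} \<subseteq> {0, 1}" "\<not> (i = j \<and> j = l)"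
  shows listed
proof -
  \<comment> \<open>The entries 39 to 44 use the inhomogeneous vector f3 = \<open>x + y\<close>, for
    which both f1 f3 and f3 f3 equal \<open>m\<close>. This is why their tables contain mixed values
    such as f3 - f1.\<close>
  have "basis4 x m (x + y) e"
    using assms(1)
  proof (rule basis4_change)
    have "(x + y) - x \<in> span {x, m, x + y, e}"
      by (rule span_diff; rule span_base; simp)
    then show "{x, m, y, e} \<subseteq> span {x, m, x + y, e}"
      by (simp add: span_base)
  qed
  moreover have "\<exists>n. (n, i, j, l) \<in> set product_types"
    using assms(15,16) by (simp, elim conjE disjE; simp add: product_types_def)
  then obtain n where n: "(n, i, j, l) \<in> set product_types" ..
  have "has_table (entry n 0 0) (basis_of x m (x + y) e)"
    using n assms(2-5) unfolding product_types_def list.set insert_iff prod.inject empty_iff acts1_def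
    by (elim disjE conjE FalseE; simp only: table_simps) (simp_all add: assms(6-14) mult_distribs)
  moreover have "n \<in> {1..72}"
    using n by (auto simp: product_types_def)
  ultimately show ?thesis
    using listedI by blast
qed

section \<open>Normal forms of bilinear forms on a plane\<close>

lemma isotropic_form_listed:
  assumes "basis4 u m v e" "e \<cdot> e = e"
    and "acts1 e u t" "acts1 e v t" "acts1 e m t" "t \<in> {(0, 0), (1, 1)}"
    and "u \<cdot> u = 0" "u \<cdot> v = \<beta> *s m" "v \<cdot> u = \<gamma> *s m" "v \<cdot> v = \<delta> *s m" "\<delta> \<noteq> 0"
    and "u \<cdot> m = 0" "m \<cdot> u = 0" "v \<cdot> m = 0" "m \<cdot> v = 0" "m \<cdot> m = 0"
  shows listed
proof -
  let ?m = "\<delta> *s m"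
  let ?b = "basis_of u ?m v e"
  have basis: "basis4 u ?m v e"
    using assms(1)
  proof (rule basis4_change)
    have "(1 / \<delta>) *s ?m \<in> span {u, ?m, v, e}"
      by (rule span_scale, rule span_base, simp)
    then have "m \<in> span {u, ?m, v, e}"
      using \<open>\<delta> \<noteq> 0\<close> by simp
    then show "{u, m, v, e} \<subseteq> span {u, ?m, v, e}"
      by (simp add: span_base)
  qed
  have "has_table (entry 37 (\<beta> / \<delta>) (\<gamma> / \<delta>)) ?b \<or> has_table (entry 38 (\<beta> / \<delta>) (\<gamma> / \<delta>)) ?b"
  proof (cases "t = (1, 1)")
    case True
    have "has_table (entry 37 (\<beta> / \<delta>) (\<gamma> / \<delta>)) ?b"
      using assms(2-) True by (simp only: table_simps) (simp add: acts1_def mult_distribs)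
    then show ?thesis ..
  next
    case False
    then have "has_table (entry 38 (\<beta> / \<delta>) (\<gamma> / \<delta>)) ?b"
      using assms(2-) by (simp only: table_simps) (simp add: acts1_def mult_distribs)
    then show ?thesis ..
  qed
  then show ?thesis
    using listedI[OF basis] by (elim disjE) simp_all
qed

lemma alternating_form_listed:
  assumes "basis4 u m v e" "e \<cdot> e = e"
    and "acts1 e u t" "acts1 e v t" "acts1 e m t" "t \<in> {(0, 0), (1, 1)}"
    and "u \<cdot> u = 0" "u \<cdot> v = \<beta> *s m" "v \<cdot> u = - \<beta> *s m" "v \<cdot> v = 0" "\<beta> \<noteq> 0"
    and "u \<cdot> m = 0" "m \<cdot> u = 0" "v \<cdot> m = 0" "m \<cdot> v = 0" "m \<cdot> m = 0"
  shows listed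
proof -
  let ?m = "\<beta> *s m"
  let ?b = "basis_of u ?m v e"
  have basis: "basis4 u ?m v e"
    using assms(1)
  proof (rule basis4_change)
    have "(1 / \<beta>) *s ?m \<in> span {u, ?m, v, e}"
      by (rule span_scale, rule span_base, simp)
    then have "m \<in> span {u, ?m, v, e}"
      using \<open>\<beta> \<noteq> 0\<close> by simp
    then show "{u, m, v, e} \<subseteq> span {u, ?m, v, e}"
      by (simp add: span_base)
  qed
  have "has_table (entry 51 0 0) ?b \<or> has_table (entry 52 0 0) ?b"
  proof (cases "t = (1, 1)")
    case True
    have "has_table (entry 51 0 0) ?b"
      using assms(2-) True by (simp only: table_simps) (simp add: acts1_def mult_distribs)
    then show ?thesis ..
  next
    case False
    then have "has_table (entry 52 0 0) ?b"
      using assms(2-) by (simp only: table_simps) (simp add: acts1_def mult_distribs)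
    then show ?thesis ..
  qed
  then show ?thesis
    using listedI[OF basis] by (elim disjE) simp_all
qed

lemma acts1_add: "acts1 e x t \<Longrightarrow> acts1 e y t \<Longrightarrow> acts1 e (x + y) t"
  and acts1_scale: "acts1 e x t \<Longrightarrow> acts1 e (c *s x) t"
  by (auto simp: acts1_def mult_distribs)

text \<open>Over the complex numbers the form has an isotropic vector \<open>u\<close>. If a second
  basis vector, possibly after adding \<open>u\<close>, is anisotropic, the form belongs to the
  families 37 and 38; otherwise it is alternating and belongs to 51 and 52.\<close>

lemma form_listed:
  assumes basis: "basis4 x m y e" and "e \<cdot> e = e"
    and acts: "acts1 e x t" "acts1 e y t" "acts1 e m t" and t: "t \<in> {(0, 0), (1, 1)}"
    and prods: "x \<cdot> x = \<alpha> *s m" "x \<cdot> y = \<beta> *s m" "y \<cdot> x = \<gamma> *s m" "y \<cdot> y = \<delta> *s m"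
    and nonzero: "\<alpha> \<noteq> 0 \<or> \<beta> \<noteq> 0 \<or> \<gamma> \<noteq> 0 \<or> \<delta> \<noteq> 0"
    and m: "x \<cdot> m = 0" "m \<cdot> x = 0" "y \<cdot> m = 0" "m \<cdot> y = 0" "m \<cdot> m = 0"
  shows listed
proof -
  have isotropic: listed
    if basis: "basis4 u m v e" and acts': "acts1 e u t" "acts1 e v t"
      and prods: "u \<cdot> u = 0" "u \<cdot> v = \<beta> *s m" "v \<cdot> u = \<gamma> *s m" "v \<cdot> v = \<delta> *s m"
      and nonzero: "\<beta> \<noteq> 0 \<or> \<gamma> \<noteq> 0 \<or> \<delta> \<noteq> 0"
      and m': "u \<cdot> m = 0" "m \<cdot> u = 0" "v \<cdot> m = 0" "m \<cdot> v = 0" for u v \<beta> \<gamma> \<delta>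
  proof -
    consider "\<delta> \<noteq> 0" | "\<delta> = 0" "\<beta> + \<gamma> \<noteq> 0" | "\<delta> = 0" "\<gamma> = - \<beta>" "\<beta> \<noteq> 0"
      using nonzero by (metis add_eq_0_iff neg_equal_0_iff_equal)
    then show ?thesis
    proof cases
      case 1
      show ?thesis
        by (rule isotropic_form_listed[OF basis \<open>e \<cdot> e = e\<close> acts' acts(3) t prods 1 m' m(5)])
    next
      case 2
      \<comment> \<open>When \<open>u\<close> and \<open>v\<close> are both isotropic, the square of
        \<open>v + u\<close> is (\<beta> + \<gamma>) \<open>m\<close>, which is nonzero
        here.\<close>
      have "basis4 u m (v + u) e"
        using basis
      proof (rule basis4_change)
        have "(v + u) - u \<in> span {u, m, v + u, e}"
          by (rule span_diff; rule span_base; simp)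
        then show "{u, m, v, e} \<subseteq> span {u, m, v + u, e}"
          by (simp add: span_base)
      qed
      then show ?thesis
        by (rule isotropic_form_listed[of u m "v + u" e t \<beta> \<gamma> "\<beta> + \<gamma>"])
          (use 2 prods m m' acts acts' acts1_add \<open>e \<cdot> e = e\<close> t in
            \<open>simp_all add: mult_distribs scale_left_distrib add.commute\<close>)
    next
      case 3
      show ?thesis
        by (rule alternating_form_listed[OF basis \<open>e \<cdot> e = e\<close> acts' acts(3) t, of \<beta>])
          (use 3 prods m m' in simp_all)
    qed
  qed
  show ?thesis
  proof (cases "\<alpha> = 0")
    case True
    show ?thesis
      by (rule isotropic[OF basis acts(1,2), of \<beta> \<gamma> \<delta>]) (use True prods nonzero m in simp_all)
  next
    case False
    \<comment> \<open>A root of \<alpha> s^2 + (\<beta> + \<gamma>) s + \<delta>, the coefficient of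
      \<open>m\<close> in the square of \<open>s x + y\<close>.\<close>
    define s where "s = (- (\<beta> + \<gamma>) + csqrt ((\<beta> + \<gamma>)\<^sup>2 - 4 * \<alpha> * \<delta>)) / (2 * \<alpha>)"
    have "2 * \<alpha> * s = csqrt ((\<beta> + \<gamma>)\<^sup>2 - 4 * \<alpha> * \<delta>) - (\<beta> + \<gamma>)"
      using False by (simp add: s_def)
    then have "(2 * \<alpha> * s + (\<beta> + \<gamma>))\<^sup>2 = (\<beta> + \<gamma>)\<^sup>2 - 4 * \<alpha> * \<delta>"
      by simp
    then have "4 * \<alpha> * (\<alpha> * s * s + (\<beta> + \<gamma>) * s + \<delta>) = 0"
      by (simp add: power2_eq_square algebra_simps)
    then have root: "s * (s * \<alpha>) + s * \<beta> + (s * \<gamma> + \<delta>) = 0"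
      using False unfolding mult_eq_0_iff by (simp add: algebra_simps)
    let ?u = "s *s x + y"
    have basis': "basis4 ?u m x e"
      using basis
    proof (rule basis4_change)
      have "?u - s *s x \<in> span {?u, m, x, e}"
        by (rule span_diff, rule span_base, simp, rule span_scale, rule span_base, simp)
      then show "{x, m, y, e} \<subseteq> span {?u, m, x, e}"
        by (simp add: span_base)
    qed
    have "?u \<cdot> ?u = (s * (s * \<alpha>) + s * \<beta> + (s * \<gamma> + \<delta>)) *s m"
      by (simp add: mult_distribs prods scale_left_distrib algebra_simps)
    then have "?u \<cdot> ?u = 0"
      by (simp only: root scale_zero_left)
    moreover have "?u \<cdot> x = (s * \<alpha> + \<gamma>) *s m" "x \<cdot> ?u = (s * \<alpha> + \<beta>) *s m"
      by (simp_all add: mult_distribs prods scale_left_distrib)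
    ultimately show ?thesis
      by (intro isotropic[OF basis', of "s * \<alpha> + \<gamma>" "s * \<alpha> + \<beta>" \<alpha>])
        (use False acts m prods in \<open>simp_all add: acts1_add acts1_scale mult_distribs\<close>)
  qed
qed

end

section \<open>Powers of a nil ideal\<close>

context complex_algebra
begin

lemma nil_left_eigenvector:
  assumes "nil S" "b \<in> S" "mult b x = scale c x"
  shows "mult b x = 0"
proof (cases "c = 0")
  case False
  then show ?thesis
    using nil_product_not_fixed[OF assms] by simp
qed (use assms(3) in simp)

text \<open>The powers are built from the left, but \<open>x\<close> meets the new factor
  \<open>b\<close> first, so the scalars still multiply up to a power of \<open>c\<close>.\<close>

lemma nil_right_eigenvector:
  assumes "nil S" "b \<in> S" "mult x b = scale c x"
  shows "mult x b = 0"
proof (cases "c = 0")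
  case False
  obtain n where n: "set_power S n \<subseteq> {0}"
    using assms(1) by (auto simp: nil_def)
  have "\<exists>t\<in>set_power S n. \<exists>d. d \<noteq> 0 \<and> mult x t = scale d x" for n
  proof (induction n)
    case 0
    then show ?case
      using assms(2,3) False by auto
  next
    case (Suc n)
    then obtain t d where t: "t \<in> set_power S n" "d \<noteq> 0" "mult x t = scale d x"
      by blast
    have "mult b t \<in> set_power S (Suc n)"
      using assms(2) t(1) by (simp add: productsI)
    moreover have "mult x (mult b t) = scale (c * d) x"
      unfolding assoc[symmetric] by (simp add: assms(3) t(3) mult_scale_left)
    moreover have "c * d \<noteq> 0"
      using False t(2) by simp
    ultimately show ?case
      by blast
  qed
  then obtain t d where "t \<in> set_power S n" "d \<noteq> 0" "mult x t = scale d x"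
    by blast
  then have "x = 0"
    using n by fastforce
  then show ?thesis
    by simp
qed (use assms(3) in simp)

lemma subspace_mult_left_preimage: "subspace T \<Longrightarrow> subspace {y. mult x y \<in> T}"
  and subspace_mult_right_preimage: "subspace T \<Longrightarrow> subspace {y. mult y x \<in> T}"
  by (auto intro!: subspaceI simp: mult_distribs subspace_0 subspace_add subspace_scale)

lemma mult_span_products:
  assumes "x \<in> S" "y \<in> span (products S' T)" "products S S' \<subseteq> S''"
  shows "mult x y \<in> span (products S'' T)"
  using assms(2)
proof (induction rule: span_products_induct)
  case (prod s t)
  then have "mult (mult x s) t \<in> products S'' T"
    using assms(1,3) by (intro productsI) (auto simp: products_def)
  then show ?case
    by (simp add: assoc span_base)
next
  case subspace
  show ?case
    using subspace_mult_left_preimage[OF subspace_span] .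
qed

text \<open>Nakayama's argument: iterating T = R T gives T = R^n T, which is zero for large
  n.\<close>

lemma nil_span_products_neq:
  assumes "nil R" "span (products R T) = T"
  shows "T \<subseteq> {0}"
proof -
  obtain n where n: "set_power R n \<subseteq> {0}"
    using assms(1) by (auto simp: nil_def)
  have "T \<subseteq> span (products (set_power R n) T)" for n
  proof (induction n)
    case (Suc n)
    have "mult r t \<in> span (products (set_power R (Suc n)) T)" if "r \<in> R" "t \<in> T" for r t
      using mult_span_products[of r R t "set_power R n" T] that Suc by auto
    then have "products R T \<subseteq> span (products (set_power R (Suc n)) T)"
      by (auto simp: products_def)
    then show ?case
      using assms(2) span_minimal[OF _ subspace_span] by blast
  qed (simp add: assms(2))
  moreover have "products (set_power R n) T \<subseteq> {0}"
    using n by (auto simp: products_def)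
  then have "span (products (set_power R n) T) \<subseteq> {0}"
    by (intro span_minimal) (simp_all add: subspace_single_0)
  ultimately show ?thesis
    by blast
qed

text \<open>Regrouping (R R) r as R (R r) turns information on left products into information on
  right products; powers here are formed from the left only.\<close>

lemma span_square_mult:
  assumes "s \<in> span (products R R)" "\<And>r'. r' \<in> R \<Longrightarrow> mult r' r \<in> T"
  shows "mult s r \<in> span (products R T)"
  using assms(1)
proof (induction rule: span_products_induct)
  case (prod r1 r2)
  then have "mult r1 (mult r2 r) \<in> products R T"
    using assms(2) by (intro productsI)
  then show ?case
    by (simp add: assoc span_base)
next
  case subspace
  show ?case
    using subspace_mult_right_preimage[OF subspace_span] .
qed

lemma closed_span:
  assumes "products S S \<subseteq> span S"
  shows "closed (span S)"
proof -
  have 1: "mult s y \<in> span S" if "s \<in> S" "y \<in> span S" for s y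
    using span_minimal[OF _ subspace_mult_left_preimage[OF subspace_span], of S s S] that assms
      productsI by blast
  have "mult x y \<in> span S" if "x \<in> span S" "y \<in> span S" for x y
    using span_minimal[OF _ subspace_mult_right_preimage[OF subspace_span], of S y S] that 1
      by blast
  then show ?thesis
    by (auto simp: closed_def products_def)
qed

text \<open>If R is spanned by \<open>u\<close> and R^2, then R^2 is spanned by u^2 and R^3, and R^3
  by u^3 and R^4: write each factor as a power of \<open>u\<close> times a scalar plus an element of
  the next power of R and expand.\<close>

lemma square_generated:
  assumes "closed R" "u \<in> R" "R \<subseteq> span (insert u (span (products R R)))"
  defines "S \<equiv> span (products R R)"
  shows "S \<subseteq> span (insert (mult u u) (span (products R S)))"
    and "span (products R S) \<subseteq>
      span (insert (mult u (mult u u)) (span (products R (span (products R S)))))"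
proof -
  define T where "T = span (products R S)"
  have RR: "mult r r' \<in> S" if "r \<in> R" "r' \<in> R" for r r'
    unfolding S_def using that by (intro span_base productsI)
  have SR: "S \<subseteq> R"
    unfolding S_def using assms(1) by (intro span_minimal) (simp_all add: closed_def)
  have RS: "mult r s \<in> T" if "r \<in> R" "s \<in> S" for r s
    unfolding T_def using that by (intro span_base productsI)
  have SR': "mult s r \<in> T" if "s \<in> S" "r \<in> R" for s r
    using span_square_mult[of s R r S] that RR by (simp add: S_def T_def)
  have SS: "mult s s' \<in> span (products R T)" if "s \<in> S" "s' \<in> S" for s s'
    using span_square_mult[of s R s' T] that RS by (simp add: S_def)
  have RT: "mult r t \<in> span (products R T)" if "r \<in> R" "t \<in> T" for r t
    using that by (intro span_base productsI)
  have R_u: "\<exists>a. r - scale a u \<in> S" if "r \<in> R" for r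
    using that assms(3) by (auto simp: span_breakdown_eq S_def span_span)
  have S_u: "mult r r' \<in> span (insert (mult u u) T)" if rr': "r \<in> R" "r' \<in> R" for r r'
  proof -
    obtain a b where ab: "r - scale a u \<in> S" "r' - scale b u \<in> S"
      using R_u rr' by blast
    have "mult r r' = scale (a * b) (mult u u) +
        (mult (r - scale a u) r' + scale a (mult u (r' - scale b u)))"
      by (simp add: mult_distribs scale_right_diff_distrib)
    moreover have "mult (r - scale a u) r' \<in> T" "mult u (r' - scale b u) \<in> T"
      using SR' RS ab rr'(2) assms(2) by blast+
    ultimately show ?thesis
      by (simp add: span_add span_scale span_base)
  qed
  then have "products R R \<subseteq> span (insert (mult u u) T)"
    by (auto simp: products_def)
  then have S_sub: "S \<subseteq> span (insert (mult u u) T)"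
    unfolding S_def by (rule span_minimal[OF _ subspace_span])
  then show "S \<subseteq> span (insert (mult u u) (span (products R S)))"
    by (simp only: T_def)
  have "mult r s \<in> span (insert (mult u (mult u u)) (span (products R T)))"
    if rs: "r \<in> R" "s \<in> S" for r s
  proof -
    obtain a where a: "r - scale a u \<in> S"
      using R_u rs by blast
    have "s \<in> span (insert (mult u u) T)"
      using rs S_sub by blast
    moreover have "span T = T"
      by (simp add: T_def span_span)
    ultimately obtain b where b: "s - scale b (mult u u) \<in> T"
      by (auto simp: span_breakdown_eq)
    have "mult r s = scale (a * b) (mult u (mult u u)) +
        (mult (r - scale a u) s + scale a (mult u (s - scale b (mult u u))))"
      by (simp add: mult_distribs scale_right_diff_distrib)
    moreover have "mult (r - scale a u) s \<in> span (products R T)"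
      "mult u (s - scale b (mult u u)) \<in> span (products R T)"
      using SS RT a b rs(2) assms(2) by blast+
    ultimately show ?thesis
      by (simp add: span_add span_scale span_base)
  qed
  then have "products R S \<subseteq> span (insert (mult u (mult u u)) (span (products R T)))"
    by (auto simp: products_def)
  then show "span (products R S) \<subseteq>
      span (insert (mult u (mult u u)) (span (products R (span (products R S)))))"
    unfolding T_def by (rule span_minimal[OF _ subspace_span])
qed

end

context fin_dim_algebra
begin

text \<open>By the Nakayama argument the chain of powers drops strictly until it reaches 0.\<close>

lemma dim_products_less:
  assumes "nil R" "subspace T" "products R T \<subseteq> T" "\<not> T \<subseteq> {0}"
  shows "dim (span (products R T)) < dim T"
proof -
  have "span (products R T) \<subseteq> T"
    by (rule span_minimal[OF assms(3,2)])
  moreover have "span (products R T) \<noteq> T"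
    using nil_span_products_neq[OF assms(1)] assms(4) by blast
  ultimately show ?thesis
    using dim_psubset[of "span (products R T)" T] span_eq_iff[THEN iffD2, OF assms(2)]
    by (simp only: span_span psubset_eq) simp
qed

end

section \<open>Uniqueness of types and the dimension of the radical\<close>

context maximal_idempotents
begin

lemma left_part_piece:
  assumes "x \<in> piece i' j'" "i' \<le> k" "i \<le> k"
  shows "left_part i x = (if i = i' then x else 0)"
proof -
  have "(\<Sum>a=1..k. e a \<cdot> x) = (\<Sum>a=1..k. if a = i' then x else 0)"
    by (intro sum.cong refl pieceD(1)[OF assms(1)])
  then have "(\<Sum>a=1..k. e a \<cdot> x) = (if i' = 0 then 0 else x)"
    using assms(2) by auto
  then show ?thesis
    using assms(3) pieceD(1)[OF assms(1), of i] by (auto simp: left_part_def simp del: One_nat_def)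
qed

lemma right_part_piece:
  assumes "x \<in> piece i' j'" "j' \<le> k" "j \<le> k"
  shows "right_part j x = (if j = j' then x else 0)"
proof -
  have "(\<Sum>a=1..k. x \<cdot> e a) = (\<Sum>a=1..k. if a = j' then x else 0)"
    by (intro sum.cong refl pieceD(2)[OF assms(1)])
  then have "(\<Sum>a=1..k. x \<cdot> e a) = (if j' = 0 then 0 else x)"
    using assms(2) by auto
  then show ?thesis
    using assms(3) pieceD(2)[OF assms(1), of j] by (auto simp: right_part_def simp del: One_nat_def)
qed

lemma part_linear:
  "left_part i (a *s x + b *s y) = a *s left_part i x + b *s left_part i y"
  "right_part i (a *s x + b *s y) = a *s right_part i x + b *s right_part i y"
  by (simp_all add: left_part_def right_part_def mult_distribs sum.distrib scale_right_diff_distrib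
      scale_sum_right)

text \<open>Projecting the equation to the piece of \<open>z\<close> deletes every term of another
  type.\<close>

lemma homogeneous_combination:
  assumes "z \<in> piece i j" "x \<in> piece i1 j1" "y \<in> piece i2 j2" "z = a *s x + b *s y"
    and "i \<le> k" "j \<le> k" "i1 \<le> k" "j1 \<le> k" "i2 \<le> k" "j2 \<le> k"
  shows "z = (if i = i1 \<and> j = j1 then a *s x else 0) + (if i = i2 \<and> j = j2 then b *s y else 0)"
proof -
  have part: "right_part j (left_part i w) = (if i = i' \<and> j = j' then w else 0)"
    if "w \<in> piece i' j'" "i' \<le> k" "j' \<le> k" for w i' j'
  proof -
    have "right_part j 0 = 0"
      by (simp add: right_part_def)
    then show ?thesis
      using left_part_piece[OF that(1,2) assms(5)] right_part_piece[OF that(1,3) assms(6)] by auto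
  qed
  have "z = right_part j (left_part i z)"
    using part[OF assms(1,5,6)] by simp
  also have "\<dots> = a *s right_part j (left_part i x) + b *s right_part j (left_part i y)"
    unfolding assms(4) part_linear ..
  finally show ?thesis
    using part[OF assms(2,7,8)] part[OF assms(3,9,10)] by simp
qed

lemma piece_unique:
  assumes "x \<in> piece i j" "x \<in> piece i' j'" "x \<noteq> 0" "i \<le> k" "j \<le> k" "i' \<le> k" "j' \<le> k"
  shows "i = i'" "j = j'"
proof -
  have "x = 1 *s x + 0 *s x"
    by simp
  from homogeneous_combination[OF assms(1,2,2) this assms(4-7) assms(6,7)]
  show "i = i'" "j = j'"
    using assms(3) by (auto split: if_splits)
qed

text \<open>In an expansion of a radical element by the idempotents and \<open>W\<close>, the
  idempotent part is again in the radical span, hence zero.\<close>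

lemma span_homogeneous_subset:
  assumes "W \<subseteq> span homogeneous" "span (e ` {1..k} \<union> W) = UNIV"
  shows "span homogeneous \<subseteq> span W"
proof
  fix z assume z: "z \<in> span homogeneous"
  have "z \<in> span (e ` {1..k} \<union> W)"
    using assms(2) by simp
  then obtain s t where st: "z = s + t" "s \<in> span (e ` {1..k})" "t \<in> span W"
    by (auto simp: span_Un)
  have "t \<in> span homogeneous"
    using st(3) span_minimal[OF assms(1) subspace_span] by blast
  then have s: "s \<in> span homogeneous"
    using z span_diff[of z homogeneous t] st(1) by simp
  obtain g where "s = (\<Sum>v\<in>e ` {1..k}. g v *s v)"
    using st(2) span_finite[of "e ` {1..k}"] by auto
  then have s_eq: "s = (\<Sum>a=1..k. g (e a) *s e a)"
    by (simp add: sum.reindex[OF inj_on_idempotents] del: One_nat_def)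
  have "g (e b) = 0" if "b \<in> {1..k}" for b
    using idempotents_independent_mod_homogeneous[of "\<lambda>a. g (e a)"] s that unfolding s_eq
      by blast
  then have "s = 0"
    unfolding s_eq by (intro sum.neutral) simp
  then show "z \<in> span W"
    using st by simp
qed

lemma dim_idempotents: "dim (e ` {1..k}) = k"
  using dim_eq_card_independent[OF independent_idempotents] card_image[OF inj_on_idempotents]
    by simp

end

section \<open>Dimension four with two, three or four idempotents\<close>

locale maximal_idempotents_4 = maximal_idempotents scale mult Basis k e +
  four_dim_algebra scale mult Basis
  for scale :: "complex \<Rightarrow> 'a::ab_group_add \<Rightarrow> 'a" (infixr \<open>*s\<close> 75)
    and mult :: "'a \<Rightarrow> 'a \<Rightarrow> 'a" (infixl \<open>\<cdot>\<close> 70)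
    and Basis :: "'a set" and k :: nat and e :: "nat \<Rightarrow> 'a"
begin

lemma span_eq_UNIV_iff: "span S = UNIV \<longleftrightarrow> dim S = 4"
  using dim_eq_full[of S] dim_4 by (simp add: dimension_def)

text \<open>Repeated use builds a basis of homogeneous vectors on top of the idempotents.\<close>

lemma extend_homogeneous:
  assumes "e ` {1..k} \<subseteq> span S" "dim S = n" "n < 4"
  shows "\<exists>i j x. i \<le> k \<and> j \<le> k \<and> x \<in> rad i j \<and> dim (insert x S) = Suc n"
proof -
  have "span S \<noteq> UNIV"
    using assms(2,3) span_eq_UNIV_iff by auto
  then obtain i j x where "i \<le> k" "j \<le> k" "x \<in> rad i j" "x \<notin> span S"
    using ex_homogeneous_notin[OF subspace_span _ assms(1)] by blast
  then show ?thesis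
    using assms(2) dim_insert[of x S] by auto
qed

lemma e1: "k \<ge> 1 \<Longrightarrow> e 1 \<cdot> e 1 = e 1"
  by (simp add: e_mult)

lemma acts1_piece: "k = 1 \<Longrightarrow> x \<in> piece i j \<Longrightarrow> acts1 (e 1) x (i, j)"
  using pieceD[of x i j 1] by (auto simp: acts1_def)

lemma acts2_piece: "k = 2 \<Longrightarrow> x \<in> piece i j \<Longrightarrow> acts2 (e 1) (e 2) x (i, j)"
  using pieceD[of x i j 1] pieceD[of x i j 2] by (auto simp: acts2_def)

lemma listed_k4:
  assumes "k = 4"
  shows listed
proof -
  have "e ` {1..4} = {e 1, e 2, e 3, e 4}"
    unfolding atLeastAtMost_1_4 by simp
  then have "basis4 (e 1) (e 2) (e 3) (e 4)"
    using dim_idempotents assms span_eq_UNIV_iff by (simp add: basis4_def)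
  then show ?thesis
    by (rule listed_2) (use e_mult assms in auto)
qed

lemma listed_k3:
  assumes "k = 3" and rad: rad_closed
  shows listed
proof -
  have "\<exists>i j x. i \<le> k \<and> j \<le> k \<and> x \<in> rad i j \<and> dim (insert x (e ` {1..k})) = Suc k"
    by (rule extend_homogeneous) (use dim_idempotents assms(1) span_superset in auto)
  then obtain i j x where x: "i \<le> 3" "j \<le> 3" "x \<in> rad i j" "dim (insert x (e ` {1..3})) = 4"
    unfolding assms(1) by auto
  have xp: "x \<in> piece i j"
    using rad_in_piece x(1,3) assms(1) by simp
  have span: "span (e ` {1..k} \<union> {x}) = UNIV"
    using x(4) span_eq_UNIV_iff assms(1) by simp
  have x_hom: "x \<in> homogeneous"
    using homogeneousI x(1-3) assms(1) by simp
  have xx: "x \<cdot> x = 0"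
  proof (cases "i = j")
    case True
    then have "x \<cdot> x \<in> homogeneous"
      using rad_mult[OF rad, of i i i x x] x(1-3) assms(1) homogeneousI[of i i "x \<cdot> x"]
        by simp
    then have "x \<cdot> x \<in> span {x}"
      using span_homogeneous_subset[OF _ span] x_hom by (auto intro: span_base)
    then obtain c where "x \<cdot> x = c *s x"
      by (auto simp: span_singleton)
    then show ?thesis
      using nil_left_eigenvector[OF nil_rad_diag, of i x x c] x(1,3) True assms(1) by simp
  next
    case False
    then show ?thesis
      using piece_mult_eq_0[OF xp xp] x(1,2) assms(1) by auto
  qed
  have "\<exists>a b c. distinct [a, b, c] \<and> {a, b, c} = {1..3} \<and>
      (i, j) \<in> {(a, b), (0, a), (a, 0), (a, a), (0, 0)}"
  proof -
    have set: "{1..3} = {1, 2, 3::nat}"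
      by auto
    have third: "\<exists>c. distinct [a, b, c] \<and> {a, b, c} = {1..3}"
      if "a \<in> {1, 2, 3}" "b \<in> {1, 2, 3}" "a \<noteq> b" for a b :: nat
    proof -
      \<comment> \<open>The third index is 6 - a - b because 1 + 2 + 3 = 6.\<close>
      have "distinct [a, b, 6 - a - b] \<and> {a, b, 6 - a - b} = {1, 2, 3}"
        using that by (elim insertE emptyE) (simp_all add: insert_commute)
      then show ?thesis
        unfolding set by blast
    qed
    have other: "\<exists>b\<in>{1, 2, 3}. a \<noteq> b" for a :: nat
      by (cases "a = 1") auto
    have ij: "i = 0 \<or> i \<in> {1, 2, 3}" "j = 0 \<or> j \<in> {1, 2, 3}"
      using x(1,2) by auto
    \<comment> \<open>\<open>a\<close> is the nonzero index of the type; the value 1 for type (0, 0)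
      is arbitrary.\<close>
    define a where "a = (if i \<noteq> 0 then i else if j \<noteq> 0 then j else 1)"
    have a: "a \<in> {1, 2, 3}"
      using ij by (auto simp: a_def)
    show ?thesis
    proof (cases "i \<noteq> 0 \<and> j \<noteq> 0 \<and> i \<noteq> j")
      case True
      then have "i \<in> {1, 2, 3}" "j \<in> {1, 2, 3}" "i \<noteq> j"
        using ij by auto
      from third[OF this] show ?thesis
        by blast
    next
      case False
      then have "(i, j) \<in> {(0, a), (a, 0), (a, a), (0, 0)}"
        by (auto simp: a_def)
      moreover obtain b where "b \<in> {1, 2, 3}" "a \<noteq> b"
        using other by blast
      moreover from third[OF a this] obtain c where "distinct [a, b, c] \<and> {a, b, c} = {1..3}" ..
      ultimately show ?thesis
        by blast
    qed
  qed
  then obtain a b c where abc: "distinct [a, b, c]" "{a, b, c} = {1..3}"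
      "(i, j) \<in> {(a, b), (0, a), (a, 0), (a, a), (0, 0)}"
    by blast
  have "e ` {1..3} = {e a, e b, e c}"
    unfolding abc(2)[symmetric] by simp
  then have "basis4 x (e a) (e b) (e c)"
    using x(4) span_eq_UNIV_iff by (simp add: basis4_def)
  then show ?thesis
    by (rule listed_3_7[of _ e _ _ _ i j])
      (use abc e_mult pieceD[OF xp] xx assms(1) in \<open>auto simp del: One_nat_def\<close>)
qed

text \<open>A product is a multiple of the basis vector of its own type, if there is one. It is then
  an eigenvector equation for \<open>x\<close> or \<open>y\<close> acting from a nil diagonal piece,
  so the multiple is zero.\<close>

lemma two_types_products:
  assumes rad: rad_closed
    and x: "x \<in> rad i j" "i \<le> k" "j \<le> k" and y: "y \<in> rad i' j'" "i' \<le> k" "j' \<le> k"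
    and types: "(i, j) \<noteq> (i', j')" and span: "span homogeneous \<subseteq> span {x, y}"
  shows "x \<cdot> x = 0" "x \<cdot> y = 0"
proof -
  have xp: "x \<in> piece i j" and yp: "y \<in> piece i' j'"
    using rad_in_piece x y by auto
  have comb: "w = (if (a, b) = (i, j) then c *s x else 0) + (if (a, b) = (i', j') then d *s y else 0)"
    if "w \<in> rad a b" "a \<le> k" "b \<le> k" "w = c *s x + d *s y" for w a b c d
    using homogeneous_combination[OF rad_in_piece[OF that(2,1)] xp yp that(4)] that x y by auto
  have expand: "\<exists>c d. w = c *s x + d *s y" if "w \<in> rad a b" "a \<le> k" "b \<le> k" for w a b
  proof -
    have "w \<in> span {x, y}"
      using homogeneousI[OF that(2,3,1)] span span_base by blast
    then obtain c d where "w - c *s x - d *s y = 0"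
      by (auto simp: span_breakdown_eq)
    then have "w = c *s x + d *s y"
      by (simp add: algebra_simps)
    then show ?thesis
      by blast
  qed
  show "x \<cdot> x = 0"
  proof (cases "i = j")
    case True
    then have xx: "x \<cdot> x \<in> rad i j"
      using rad_mult[OF rad, of i i i x x] x by simp
    then obtain c d where cd: "x \<cdot> x = c *s x + d *s y"
      using expand x by blast
    have "x \<cdot> x = c *s x"
      using comb[OF xx x(2,3) cd] types by auto
    then show ?thesis
      using nil_left_eigenvector[OF nil_rad_diag[OF x(2)], of x x c] x True by simp
  next
    case False
    then show ?thesis
      using piece_mult_eq_0[OF xp xp] x by auto
  qed
  show "x \<cdot> y = 0"
  proof (cases "j = i'")
    case True
    then have xy: "x \<cdot> y \<in> rad i j'"
      using rad_mult[OF rad, of i j j' x y] x y by simp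
    then obtain c d where cd: "x \<cdot> y = c *s x + d *s y"
      using expand x y by blast
    note comb' = comb[OF xy x(2) y(3) cd]
    consider "j' = j" | "i = i'" | "j' \<noteq> j" "i \<noteq> i'"
      by blast
    then show ?thesis
    proof cases
      case 1
      then have "x \<cdot> y = c *s x"
        using comb' types True by auto
      then show ?thesis
        using nil_right_eigenvector[OF nil_rad_diag[OF y(2)], of y x c] y 1 True by simp
    next
      case 2
      then have "x \<cdot> y = d *s y"
        using comb' types True by auto
      then show ?thesis
        using nil_left_eigenvector[OF nil_rad_diag[OF x(2)], of x y d] x 2 True by simp
    next
      case 3
      then show ?thesis
        using comb' by auto
    qed
  next
    case False
    then show ?thesis
      using piece_mult_eq_0[OF xp yp] x y by auto
  qed
qed

text \<open>A nonzero square leaves only the dimensions 2, 1, 0 for R, R^2, R^3, and any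
  \<open>u\<close> outside R^2 generates.\<close>

lemma nil_square_dim_2:
  assumes "closed R" "nil R" "dim R \<le> 2" "\<not> products R R \<subseteq> {0}"
  obtains u where "u \<in> R" "R \<subseteq> span {u, u \<cdot> u}" "u \<cdot> (u \<cdot> u) = 0"
proof -
  let ?S = "span (products R R)"
  have R: "subspace R" "products R R \<subseteq> R"
    using assms(1) by (simp_all add: closed_def)
  have S: "?S \<subseteq> R"
    by (rule span_minimal[OF R(2,1)])
  have S0: "\<not> ?S \<subseteq> {0}"
    using assms(4) span_superset by blast
  have RS: "products R ?S \<subseteq> ?S"
    using S span_superset[of "products R R"] products_mono[of R R ?S R] by blast
  have "\<not> R \<subseteq> {0}"
    using S S0 by blast
  then have "dim ?S < dim R"
    using dim_products_less[OF assms(2) R] by simp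
  moreover have "dim (span (products R ?S)) < dim ?S"
    by (rule dim_products_less[OF assms(2) subspace_span RS S0])
  ultimately have dims: "dim (span (products R ?S)) = 0" "dim ?S = 1" "dim R = 2"
    using assms(3) by linarith+
  then have T0: "span (products R ?S) \<subseteq> {0}"
    by (simp only: dim_eq_0)
  have "\<not> R \<subseteq> ?S"
    using dim_subset[of R ?S] dims by auto
  then obtain u where u: "u \<in> R" "u \<notin> ?S"
    by blast
  have "span (insert u ?S) = R"
  proof (rule subspace_dim_equal[OF subspace_span R(1)])
    show "span (insert u ?S) \<subseteq> R"
      using u S R(1) by (intro span_minimal) auto
    show "dim R \<le> dim (span (insert u ?S))"
      using u(2) dims dim_insert[of u ?S] by (simp add: span_span)
  qed
  then have R_sub: "R \<subseteq> span (insert u ?S)"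
    by simp
  have "?S \<subseteq> span (insert (u \<cdot> u) (span (products R ?S)))"
    by (rule square_generated(1)[OF assms(1) u(1) R_sub])
  also have "\<dots> \<subseteq> span (insert (u \<cdot> u) {0})"
    using T0 by (intro span_mono) auto
  finally have S_sub: "?S \<subseteq> span {u \<cdot> u}"
    by (simp add: insert_commute)
  have "insert u ?S \<subseteq> span {u, u \<cdot> u}"
    using S_sub span_mono[of "{u \<cdot> u}" "{u, u \<cdot> u}"] by (auto simp: span_base)
  then have "R \<subseteq> span {u, u \<cdot> u}"
    using R_sub span_minimal[OF _ subspace_span] by blast
  moreover have "u \<cdot> u \<in> ?S"
    using u(1) by (intro span_base productsI)
  then have "u \<cdot> (u \<cdot> u) \<in> span (products R ?S)"
    using u(1) by (intro span_base productsI)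
  then have "u \<cdot> (u \<cdot> u) = 0"
    using T0 by blast
  ultimately show thesis
    using that u(1) by blast
qed

lemma closed_homogeneous:
  assumes rad: rad_closed
  shows "closed (span homogeneous)"
proof (rule closed_span)
  have "x \<cdot> y \<in> span homogeneous"
    if "x \<in> rad i j" "y \<in> rad i' j'" "i \<le> k" "j \<le> k" "i' \<le> k" "j' \<le> k" for x y i j i' j'
  proof (cases "j = i'")
    case True
    then show ?thesis
      using homogeneousI[of i j' "x \<cdot> y"] rad_mult[OF rad, of i j j' x y] that
        by (simp add: span_base)
  next
    case False
    then have "x \<cdot> y = 0"
      using piece_mult_eq_0[of x i j y i' j'] rad_in_piece that by simp
    then show ?thesis
      by (simp add: span_zero)
  qed
  then show "products homogeneous homogeneous \<subseteq> span homogeneous"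
    by (auto simp: products_def homogeneous_def)
qed

lemma listed_k2:
  assumes k: "k = 2" and rad: rad_closed
  shows listed
proof -
  have eset: "e ` {1..k} = {e 1, e 2}"
  proof -
    have "{1..2::nat} = {1, 2}"
      by auto
    then show ?thesis
      by (simp add: k)
  qed
  have ee: "e 1 \<cdot> e 1 = e 1" "e 2 \<cdot> e 2 = e 2" "e 1 \<cdot> e 2 = 0" "e 2 \<cdot> e 1 = 0"
    using e_mult[of 1 1] e_mult[of 2 2] e_mult[of 1 2] e_mult[of 2 1] k by auto
  have dim2: "dim {e 1, e 2} = 2"
    using dim_idempotents eset k by simp
  have sub2: "e ` {1..k} \<subseteq> span {e 1, e 2}"
    unfolding eset by (rule span_superset)
  obtain i j x where x: "i \<le> k" "j \<le> k" "x \<in> rad i j" and dim3: "dim {x, e 1, e 2} = 3"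
    using extend_homogeneous[OF sub2 dim2] by auto
  have sub3: "e ` {1..k} \<subseteq> span {x, e 1, e 2}"
    unfolding eset by (rule order_trans[OF _ span_superset]) auto
  obtain i' j' y where y: "i' \<le> k" "j' \<le> k" "y \<in> rad i' j'" and dim4: "dim {y, x, e 1, e 2} = 4"
    using extend_homogeneous[OF sub3 dim3] by auto
  have basis: "basis4 x y (e 1) (e 2)"
    using dim4 span_eq_UNIV_iff by (simp add: basis4_def insert_commute)
  have hom: "x \<in> homogeneous" "y \<in> homogeneous"
    using homogeneousI x y by blast+
  have "span (e ` {1..k} \<union> {x, y}) = UNIV"
    using basis unfolding eset basis4_def by (simp add: insert_commute)
  then have span: "span homogeneous \<subseteq> span {x, y}"
    using hom by (intro span_homogeneous_subset) (auto intro: span_base)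
  have acts: "acts2 (e 1) (e 2) x (i, j)" "acts2 (e 1) (e 2) y (i', j')"
    using acts2_piece[OF k] rad_in_piece x y by blast+
  have null: listed if "x \<cdot> x = 0" "x \<cdot> y = 0" "y \<cdot> x = 0" "y \<cdot> y = 0"
  proof -
    have "null2 (i, j) (i', j')"
      unfolding null2_def using basis ee acts that
      by (intro exI[of _ x] exI[of _ y] exI[of _ "e 1"] exI[of _ "e 2"]) simp
    moreover have "{(i, j), (i', j')} \<subseteq> {0, 1, 2} \<times> {0, 1, 2}"
    proof -
      have "a \<in> {0, 1, 2}" if "a \<le> k" for a
        using that unfolding k insert_iff empty_iff by arith
      then show ?thesis
        unfolding insert_subset using x(1,2) y(1,2) by (intro conjI SigmaI empty_subsetI)
    qed
    ultimately show ?thesis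
      by (rule null2_listed)
  qed
  show ?thesis
  proof (cases "(i, j) = (i', j')")
    case False
    have "x \<cdot> x = 0" "x \<cdot> y = 0"
      using two_types_products[OF rad x(3,1,2) y(3,1,2) False span] by auto
    moreover have "span homogeneous \<subseteq> span {y, x}"
      using span by (simp add: insert_commute)
    then have "y \<cdot> y = 0" "y \<cdot> x = 0"
      using two_types_products[OF rad y(3,1,2) x(3,1,2) False[symmetric]] by auto
    ultimately show ?thesis
      using null by blast
  next
    case same: True
    show ?thesis
    proof (cases "i = j")
      case False
      have "u \<cdot> v = 0" if "u \<in> {x, y}" "v \<in> {x, y}" for u v
        using piece_mult_eq_0[of u i j v i j] rad_in_piece x y same False that by auto
      then show ?thesis
        using null by blast
    next
      case True
      let ?R = "span {x, y}"
      have "?R \<subseteq> rad i i"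
        using x y same True subspace_rad by (intro span_minimal) auto
      then have nilR: "nil ?R" and R_piece: "?R \<subseteq> piece i i"
        using nil_mono[OF nil_rad_diag[OF x(1)]] rad_in_piece[OF x(1)] by auto
      have "span homogeneous = ?R"
        using span hom
          by (intro subset_antisym span_minimal[OF _ subspace_span]) (auto intro: span_base)
      then have closedR: "closed ?R"
        using closed_homogeneous[OF rad] by simp
      have "dim ?R \<le> card {x, y}"
        unfolding dim_span by (rule dim_le_card) (auto intro: span_base)
      also have "\<dots> \<le> 2"
        using card_length[of "[x, y]"] by simp
      finally have dimR: "dim ?R \<le> 2" .
      show ?thesis
      proof (cases "products ?R ?R \<subseteq> {0}")
        case True
        have "u \<cdot> v = 0" if "u \<in> {x, y}" "v \<in> {x, y}" for u v
          using productsI[of u ?R v ?R] True that span_base[of _ "{x, y}"] by blast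
        then show ?thesis
          using null by blast
      next
        case False
        obtain u where u: "u \<in> ?R" "?R \<subseteq> span {u, u \<cdot> u}" "u \<cdot> (u \<cdot> u) = 0"
          using nil_square_dim_2[OF closedR nilR dimR False] .
        have up: "u \<in> piece i i" "u \<cdot> u \<in> piece i i"
          using u(1) R_piece piece_mult by blast+
        have basis': "basis4 (u \<cdot> u) u (e 1) (e 2)"
          using basis
        proof (rule basis4_change)
          have "span {u, u \<cdot> u} \<subseteq> span {u \<cdot> u, u, e 1, e 2}"
            by (rule span_mono) auto
          moreover have "x \<in> ?R" "y \<in> ?R"
            by (auto intro: span_base)
          ultimately show "{x, y, e 1, e 2} \<subseteq> span {u \<cdot> u, u, e 1, e 2}"
            using u(2) by (auto intro: span_base)
        qed
        have acts': "acts2 (e 1) (e 2) u (i, i)" "acts2 (e 1) (e 2) (u \<cdot> u) (i, i)"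
          using acts2_piece[OF k] up by blast+
        show ?thesis
        \<comment> \<open>Entry 8 attaches the nilpotent vectors to its first idempotent, so for i =
          2 the idempotents are exchanged.\<close>
        proof (cases "i = 2")
          case True
          have "acts2 (e 2) (e 1) u (1, 1)" "acts2 (e 2) (e 1) (u \<cdot> u) (1, 1)"
            using acts'[THEN acts2_swap12] True by (simp_all add: swap12_def)
          moreover have "basis4 (u \<cdot> u) u (e 2) (e 1)"
            using basis' by (simp add: basis4_def insert_commute)
          ultimately show ?thesis
            using listed_8_9[of u "e 2" "e 1" "(1, 1)"] ee u(3) by simp
        next
          case False
          then have "(i, i) \<in> {(1, 1), (0, 0)}"
            using x(1) k by auto
          then show ?thesis
            using listed_8_9[OF basis' ee acts'] u(3) by simp
        qed
      qed
    qed
  qed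
qed

end

section \<open>Local algebras and completeness\<close>

lemma (in complex_algebra) span_productsI:
  "s \<in> S \<Longrightarrow> t \<in> T \<Longrightarrow> mult s t \<in> span (products S T)"
  by (rule span_base) (rule productsI)

context maximal_idempotents
begin

lemma e_mult_span_homogeneous:
  assumes "r \<in> span homogeneous" "a \<in> {1..k}"
  shows "e a \<cdot> r \<in> span homogeneous" "r \<cdot> e a \<in> span homogeneous"
proof -
  have hom: "e a \<cdot> x \<in> span homogeneous \<and> x \<cdot> e a \<in> span homogeneous" if "x \<in> homogeneous" for x
  proof -
    obtain i j where "i \<le> k" "j \<le> k" "x \<in> rad i j"
      using \<open>x \<in> homogeneous\<close> unfolding homogeneous_def by blast
    then have "x \<in> piece i j"
      using rad_in_piece by blast
    then show ?thesis
      using pieceD[OF _ assms(2), of x i j] that span_base[OF that] span_zero by auto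
  qed
  show "e a \<cdot> r \<in> span homogeneous"
    using span_minimal[OF _ subspace_mult_left_preimage[OF subspace_span], of homogeneous "e a" homogeneous]
      hom assms(1) by blast
  show "r \<cdot> e a \<in> span homogeneous"
    using span_minimal[OF _ subspace_mult_right_preimage[OF subspace_span], of homogeneous "e a" homogeneous]
      hom assms(1) by blast
qed

lemma e_notin_span_homogeneous:
  assumes "b \<in> {1..k}"
  shows "e b \<notin> span homogeneous"
proof
  assume "e b \<in> span homogeneous"
  moreover have "(\<Sum>a=1..k. (if a = b then 1 else 0) *s e a) = (\<Sum>a=1..k. if a = b then e a else 0)"
    by (intro sum.cong) auto
  then have "(\<Sum>a=1..k. (if a = b then 1 else 0) *s e a) = e b"
    using assms by simp
  ultimately show False
    using idempotents_independent_mod_homogeneous[of "\<lambda>a. if a = b then 1 else 0" b] assms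
    by (simp only: refl if_True) simp
qed

end

context maximal_idempotents_4
begin

text \<open>If \<open>f\<close> were a nonzero idempotent in the span \<open>R\<close> of the radical pieces, the algebra annihilated
  by \<open>f\<close> on both sides would be nil; but it contains the compression of \<open>e\<^sub>1\<close>, all powers of which
  are congruent to \<open>e\<^sub>1\<close> modulo \<open>R\<close>.\<close>

lemma nil_span_homogeneous:
  assumes k: "k = 1" and rad: rad_closed
  shows "nil (span homogeneous)"
proof (rule ccontr)
  let ?R = "span homogeneous"
  let ?E = "e 1"
  note closedR = closed_homogeneous[OF rad]
  assume "\<not> nil ?R"
  then obtain f where f: "f \<in> ?R" "f \<noteq> 0" "f \<cdot> f = f"
    using nonnil_has_idempotent[OF closedR] by blast
  define C where "C = {x. f \<cdot> x = 0 \<and> x \<cdot> f = 0}"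
  have "x \<cdot> y \<in> C" if "x \<in> C" "y \<in> C" for x y
  proof -
    have "f \<cdot> (x \<cdot> y) = (f \<cdot> x) \<cdot> y" "(x \<cdot> y) \<cdot> f = x \<cdot> (y \<cdot> f)"
      by (simp_all only: assoc)
    then show ?thesis
      using that by (simp add: C_def)
  qed
  then have closedC: "closed C"
    by (auto simp: closed_def products_def C_def mult_distribs intro!: subspaceI)
  have nilC: "nil C"
  proof (rule ccontr)
    assume "\<not> nil C"
    then obtain g where g: "g \<in> C" "g \<noteq> 0" "g \<cdot> g = g"
      using nonnil_has_idempotent[OF closedC] by blast
    have "{1..Suc k} = {1, 2}"
      using k by auto
    then have "orthogonal_idempotents (Suc k) (\<lambda>n. if n = 1 then f else g)"
      using f g by (simp add: orthogonal_idempotents_def C_def)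
    then show False
      using maximal by blast
  qed
  have E: "?E \<cdot> ?E = ?E" and E_in: "1 \<in> {1..k}"
    using e_mult[of 1 1] k by simp_all
  note ER = e_mult_span_homogeneous[OF _ E_in]
  \<comment> \<open>This is (1 - f) e1 (1 - f), multiplied out because 1 is not an element.\<close>
  define y where "y = ?E - ?E \<cdot> f - f \<cdot> ?E + f \<cdot> (?E \<cdot> f)"
  have ff: "f \<cdot> (f \<cdot> x) = f \<cdot> x" for x
    unfolding assoc[symmetric] f(3) ..
  have yC: "y \<in> C"
    unfolding C_def y_def by (simp add: mult_distribs assoc f(3) ff)
  have yR: "y - ?E \<in> ?R"
  proof -
    have "f \<cdot> (?E \<cdot> f) - ?E \<cdot> f - f \<cdot> ?E \<in> ?R"
      using ER f(1) closedD[OF closedR] by (intro span_diff) auto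
    moreover have "y - ?E = f \<cdot> (?E \<cdot> f) - ?E \<cdot> f - f \<cdot> ?E"
      by (simp add: y_def)
    ultimately show ?thesis
      by (simp only:)
  qed
  have "\<exists>t\<in>set_power C n. t - ?E \<in> ?R" for n
  proof (induction n)
    case 0
    then show ?case
      using yC yR by auto
  next
    case (Suc n)
    then obtain t where t: "t \<in> set_power C n" "t - ?E \<in> ?R"
      by blast
    have "y \<cdot> t - ?E = ?E \<cdot> (t - ?E) + (y - ?E) \<cdot> ?E + (y - ?E) \<cdot> (t - ?E)"
      using E by (simp add: mult_distribs del: One_nat_def)
    moreover have "?E \<cdot> (t - ?E) + (y - ?E) \<cdot> ?E + (y - ?E) \<cdot> (t - ?E) \<in> ?R"
      using ER[OF t(2)] ER[OF yR] closedD[OF closedR yR t(2)] by (intro span_add)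
    ultimately have "y \<cdot> t - ?E \<in> ?R"
      by (simp only:)
    moreover have "y \<cdot> t \<in> set_power C (Suc n)"
      using yC t(1) by (simp add: productsI)
    ultimately show ?case
      by blast
  qed
  moreover obtain n where "set_power C n \<subseteq> {0}"
    using nilC by (auto simp: nil_def)
  ultimately have "0 - ?E \<in> ?R"
    by fastforce
  then have "?E \<in> ?R"
    using span_neg[of "- ?E" homogeneous] by simp
  then show False
    using e_notin_span_homogeneous[OF E_in] by blast
qed

text \<open>\<open>S\<close> is the square of the radical, a line that the radical annihilates. A
  line has only one type, and since \<open>x\<close> and \<open>y\<close> differ in type, only one
  of the four products can be nonzero. The hypothesis \<open>nonzero\<close> covers
  \<open>x x\<close> and \<open>x y\<close>; the other two follow by exchanging \<open>x\<close> and
  \<open>y\<close>.\<close>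

lemma listed_two_generators:
  assumes k: "k = 1"
    and x: "x \<in> piece i j" "i \<le> k" "j \<le> k" and y: "y \<in> piece i' j'" "i' \<le> k" "j' \<le> k"
    and types: "(i, j) \<noteq> (i', j')"
    and basis: "\<And>m. m \<in> S \<Longrightarrow> m \<noteq> 0 \<Longrightarrow> basis4 x m y (e 1)"
    and line: "\<And>m s. m \<in> S \<Longrightarrow> m \<noteq> 0 \<Longrightarrow> s \<in> S \<Longrightarrow> \<exists>c. s = c *s m"
    and in_S: "x \<cdot> x \<in> S" "x \<cdot> y \<in> S" "y \<cdot> x \<in> S" "y \<cdot> y \<in> S"
    and ann: "\<And>s. s \<in> S \<Longrightarrow> x \<cdot> s = 0 \<and> s \<cdot> x = 0 \<and> y \<cdot> s = 0 \<and> s \<cdot> y = 0"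
    and SS: "\<And>s. s \<in> S \<Longrightarrow> s \<cdot> s = 0"
    and nonzero: "x \<cdot> x \<noteq> 0 \<or> y \<cdot> y = 0 \<and> x \<cdot> y \<noteq> 0"
  shows listed
proof -
  have E: "e 1 \<cdot> e 1 = e 1"
    using e1 k by simp
  have bits: "a \<in> {0, 1}" if "a \<le> k" for a
    using that unfolding k insert_iff empty_iff by arith
  have multiple_types: "a = i0 \<and> b = j0"
    if "s \<in> S" "s \<noteq> 0" "m \<in> S" "m \<noteq> 0" "s \<in> piece a b" "m \<in> piece i0 j0"
      "a \<le> k" "b \<le> k" "i0 \<le> k" "j0 \<le> k" for s m a b i0 j0
  proof -
    from line[OF that(3,4,1)] obtain c where "s = c *s m" ..
    then have "s \<in> piece i0 j0"
      using that(6) subspace_scale[OF subspace_piece] by blast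
    then show ?thesis
      using piece_unique[OF that(5) _ that(2) that(7-10)] by blast
  qed
  show ?thesis
  proof (cases "x \<cdot> x = 0")
    case False
    then have ij: "j = i"
      using piece_mult_eq_0[OF x(1) x(1)] x(2,3) by auto
    have m: "x \<cdot> x \<in> piece i i"
      using piece_mult[of x i i x i] x(1) ij by simp
    have xy: "x \<cdot> y = 0"
    proof (rule ccontr)
      assume nz: "x \<cdot> y \<noteq> 0"
      then have i': "i' = i"
        using piece_mult_eq_0[OF x(1) y(1)] x(2,3) y(2) ij by auto
      then have "x \<cdot> y \<in> piece i j'"
        using piece_mult[of x i i y j'] x(1) y(1) ij by simp
      then show False
        using multiple_types[OF in_S(2) nz in_S(1) False _ m x(2) y(3) x(2) x(2)] types ij i'
          by simp
    qed
    have yx: "y \<cdot> x = 0"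
    proof (rule ccontr)
      assume nz: "y \<cdot> x \<noteq> 0"
      then have j': "j' = i"
        using piece_mult_eq_0[OF y(1) x(1)] x(2,3) y(3) ij by auto
      then have "y \<cdot> x \<in> piece i' i"
        using piece_mult[of y i' i x i] x(1) y(1) ij by simp
      then show False
        using multiple_types[OF in_S(3) nz in_S(1) False _ m y(2) x(2) x(2) x(2)] types ij j'
          by simp
    qed
    have yy: "y \<cdot> y = 0"
    proof (rule ccontr)
      assume nz: "y \<cdot> y \<noteq> 0"
      then have j': "j' = i'"
        using piece_mult_eq_0[OF y(1) y(1)] y(2,3) by auto
      then have "y \<cdot> y \<in> piece i' i'"
        using piece_mult[of y i' i' y i'] y(1) by simp
      then show False
        using multiple_types[OF in_S(4) nz in_S(1) False _ m y(2) y(2) x(2) x(2)] types ij j'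
          by simp
    qed
    have "basis4 y (x \<cdot> x) x (e 1)"
      using basis[OF in_S(1) False] by (simp add: basis4_def insert_commute)
    moreover have "acts1 (e 1) x (i, i)" "acts1 (e 1) (x \<cdot> x) (i, i)" "acts1 (e 1) y (i', j')"
      using acts1_piece[OF k] x(1) y(1) m ij by blast+
    moreover have "(i, i) \<in> {(0, 0), (1, 1)}"
      using bits[OF x(2)] by auto
    moreover have "(i', j') \<in> {0, 1} \<times> {0, 1}"
      using bits y by (intro SigmaI)
    moreover have "(i, i) \<noteq> (i', j')"
      using types ij by simp
    ultimately show ?thesis
      using square_listed[of y "x \<cdot> x" x "e 1" "(i, i)" "(i', j')"] E xy yx yy
        ann[OF in_S(1)] SS[OF in_S(1)] by blast
  next
    case True
    then have nz: "x \<cdot> y \<noteq> 0" and yy: "y \<cdot> y = 0"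
      using nonzero by auto
    then have i': "i' = j"
      using piece_mult_eq_0[OF x(1) y(1)] x(3) y(2) by auto
    have m: "x \<cdot> y \<in> piece i j'"
      using piece_mult[of x i j y j'] x(1) y(1) i' by simp
    have yx: "y \<cdot> x = 0"
    proof (rule ccontr)
      assume nz': "y \<cdot> x \<noteq> 0"
      then have j': "j' = i"
        using piece_mult_eq_0[OF y(1) x(1)] x(2) y(3) by auto
      then have "y \<cdot> x \<in> piece j j"
        using piece_mult[of y j i x j] x(1) y(1) i' by simp
      then show False
        using multiple_types[OF in_S(3) nz' in_S(2) nz _ m x(3) x(3) x(2) y(3)] types i' j' by simp
    qed
    have "acts1 (e 1) x (i, j)" "acts1 (e 1) y (j, j')" "acts1 (e 1) (x \<cdot> y) (i, j')"
      using acts1_piece[OF k] x(1) y(1) m i' by blast+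
    moreover have "{i, j, j'} \<subseteq> {0, 1}"
      using bits[OF x(2)] bits[OF x(3)] bits[OF y(3)] by blast
    moreover have "\<not> (i = j \<and> j = j')"
      using types i' by auto
    ultimately show ?thesis
      using product_listed[OF basis[OF in_S(2) nz] E] True yy yx
        ann[OF in_S(2)] SS[OF in_S(2)] by blast
  qed
qed

text \<open>The radical R has dimension 3, so R^2 has dimension at most 2. Dimension 0 leaves only
  types, dimension 2 makes R generated by one element, and dimension 1 gives a product with values
  in a line.\<close>

lemma listed_k1:
  assumes k: "k = 1" and rad: rad_closed
  shows listed
proof -
  let ?R = "span homogeneous"
  let ?S = "span (products ?R ?R)"
  let ?T = "span (products ?R ?S)"
  let ?Q = "span (products ?R ?T)"
  let ?E = "e 1"
  note closedR = closed_homogeneous[OF rad] and nilR = nil_span_homogeneous[OF k rad]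
  have eset: "e ` {1..k} = {?E}"
    by (simp add: k)
  have E: "?E \<cdot> ?E = ?E"
    using e1 k by simp
  have E_notin: "?E \<notin> ?R"
    using e_notin_span_homogeneous[of 1] k by simp
  have bits: "a \<in> {0, 1}" if "a \<le> k" for a
    using that unfolding k insert_iff empty_iff by arith
  have "span ({?E} \<union> homogeneous) \<subseteq> span (insert ?E ?R)"
    by (intro span_mono) (auto intro: span_base)
  then have "span (insert ?E ?R) = UNIV"
    using span_homogeneous unfolding eset by blast
  then have "dim (insert ?E ?R) = 4"
    by (simp only: span_eq_UNIV_iff)
  then have dimR: "dim ?R = 3"
    using E_notin dim_insert[of ?E ?R] by (simp only: span_span) simp
  have R: "subspace ?R" "products ?R ?R \<subseteq> ?R"
    using closedR by (simp_all add: closed_def)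
  have SR: "?S \<subseteq> ?R"
    by (rule span_minimal[OF R(2,1)])
  have RS: "products ?R ?S \<subseteq> ?S"
    using SR span_superset[of "products ?R ?R"] products_mono[of ?R ?R ?S ?R] by blast
  have TS: "?T \<subseteq> ?S"
    by (rule span_minimal[OF RS subspace_span])
  have RT: "products ?R ?T \<subseteq> ?T"
    using TS span_superset[of "products ?R ?S"] products_mono[of ?R ?R ?T ?S] by blast
  have "\<not> ?R \<subseteq> {0}"
    using dimR by (metis dim_eq_0 zero_neq_numeral)
  then have dimS: "dim ?S < 3"
    using dim_products_less[OF nilR R] dimR by simp
  have E_notin_S: "?E \<notin> span ?S"
    using E_notin SR by (auto simp: span_span)
  have dimES: "dim (insert ?E ?S) = Suc (dim ?S)"
    using E_notin_S dim_insert[of ?E ?S] by simp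
  have E_span: "e ` {1..k} \<subseteq> span (insert ?E U)" for U
    unfolding eset by (simp add: span_base)
  have rad_R: "x \<in> ?R" if "x \<in> rad i j" "i \<le> k" "j \<le> k" for x i j
    using homogeneousI[OF that(2,3,1)] by (rule span_base)
  consider "dim ?S = 0" | "dim ?S = 2" | "dim ?S = 1"
    using dimS by linarith
  then show ?thesis
  proof cases
    case 1
    then have S0: "?S \<subseteq> {0}"
      by (simp only: dim_eq_0)
    have mult_0: "u \<cdot> v = 0" if "u \<in> ?R" "v \<in> ?R" for u v
      using S0 span_productsI[OF that] by blast
    have dim1: "dim {?E} = 1"
      using e_nonzero[of 1] k by simp
    obtain i1 j1 x where x: "i1 \<le> k" "j1 \<le> k" "x \<in> rad i1 j1" and dim2: "dim {x, ?E} = 2"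
      using extend_homogeneous[OF E_span dim1] by auto
    have dim2': "dim {?E, x} = 2"
      using dim2 by (simp add: insert_commute)
    obtain i2 j2 y where y: "i2 \<le> k" "j2 \<le> k" "y \<in> rad i2 j2" and dim3: "dim {y, ?E, x} = 3"
      using extend_homogeneous[OF E_span dim2'] by auto
    have dim3': "dim {?E, y, x} = 3"
      using dim3 by (simp add: insert_commute)
    obtain i3 j3 z where z: "i3 \<le> k" "j3 \<le> k" "z \<in> rad i3 j3" and dim4: "dim {z, ?E, y, x} = 4"
      using extend_homogeneous[OF E_span dim3'] by auto
    have "basis4 x y z ?E"
      using dim4 span_eq_UNIV_iff by (simp add: basis4_def insert_commute)
    moreover have "acts1 ?E x (i1, j1)" "acts1 ?E y (i2, j2)" "acts1 ?E z (i3, j3)"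
      using acts1_piece[OF k] rad_in_piece x y z by blast+
    moreover have "\<forall>u\<in>{x, y, z}. \<forall>v\<in>{x, y, z}. u \<cdot> v = 0"
      using mult_0 rad_R[OF x(3,1,2)] rad_R[OF y(3,1,2)] rad_R[OF z(3,1,2)] by simp
    ultimately have "null1 (i1, j1) (i2, j2) (i3, j3)"
      unfolding null1_def using E
      by (intro exI[of _ x] exI[of _ y] exI[of _ z] exI[of _ ?E] conjI)
    moreover have "{(i1, j1), (i2, j2), (i3, j3)} \<subseteq> {0, 1} \<times> {0, 1}"
      unfolding insert_subset using bits x(1,2) y(1,2) z(1,2)
      by (intro conjI SigmaI empty_subsetI)
    ultimately show ?thesis
      by (rule null1_listed)
  next
    case 2
    \<comment> \<open>R^4 = 0: the dimensions of R, R^2, R^3, R^4 start with 3, 2 and drop strictly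
      until they vanish.\<close>
    have Q0: "?Q \<subseteq> {0}"
    proof (cases "?T \<subseteq> {0}")
      case True
      then have "products ?R ?T \<subseteq> {0}"
        by (auto simp: products_def)
      then show ?thesis
        by (intro span_minimal) (simp_all add: subspace_single_0)
    next
      case False
      have "\<not> ?S \<subseteq> {0}"
        using 2 by (metis dim_eq_0 zero_neq_numeral)
      then have "dim ?T < 2"
        using dim_products_less[OF nilR subspace_span RS] 2 by simp
      moreover have "dim ?Q < dim ?T"
        by (rule dim_products_less[OF nilR subspace_span RT False])
      ultimately have "dim ?Q = 0"
        by linarith
      then show ?thesis
        by (simp only: dim_eq_0)
    qed
    have dim3: "dim (insert ?E ?S) = 3"
      using dimES 2 by simp
    obtain i j x where x: "i \<le> k" "j \<le> k" "x \<in> rad i j" and dim4: "dim (insert x (insert ?E ?S)) = 4"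
      using extend_homogeneous[OF E_span dim3] by auto
    have xR: "x \<in> ?R"
      by (rule rad_R[OF x(3,1,2)])
    have "span (e ` {1..k} \<union> insert x ?S) = UNIV"
      using dim4 span_eq_UNIV_iff unfolding eset by (simp add: insert_commute)
    then have R_sub: "?R \<subseteq> span (insert x ?S)"
      using xR SR by (intro span_homogeneous_subset) auto
    let ?W = "{x \<cdot> x, x \<cdot> (x \<cdot> x), x, ?E}"
    have "?T \<subseteq> span (insert (x \<cdot> (x \<cdot> x)) ?Q)"
      by (rule square_generated(2)[OF closedR xR R_sub])
    also have "\<dots> \<subseteq> span (insert (x \<cdot> (x \<cdot> x)) {0})"
      using Q0 by (intro span_mono) auto
    also have "\<dots> \<subseteq> span ?W"
      by (intro span_minimal subspace_span) (auto intro: span_base span_zero)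
    finally have T_W: "?T \<subseteq> span ?W" .
    have "?S \<subseteq> span (insert (x \<cdot> x) ?T)"
      by (rule square_generated(1)[OF closedR xR R_sub])
    also have "\<dots> \<subseteq> span ?W"
      using T_W by (intro span_minimal subspace_span) (auto intro: span_base)
    finally have "insert x (insert ?E ?S) \<subseteq> span ?W"
      by (auto intro: span_base)
    then have basis: "basis4 (x \<cdot> x) (x \<cdot> (x \<cdot> x)) x ?E"
      using span_minimal[OF _ subspace_span] dim4 span_eq_UNIV_iff unfolding basis4_def by blast
    have xp: "x \<in> piece i j"
      using rad_in_piece x by blast
    have ij: "i = j"
      using piece_mult_eq_0[OF xp xp] x basis4_nonzero(1)[OF basis] by auto
    have "x \<cdot> x \<in> piece i i" "x \<cdot> (x \<cdot> x) \<in> piece i i"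
      using xp ij piece_mult by blast+
    then have acts: "acts1 ?E x (i, i)" "acts1 ?E (x \<cdot> x) (i, i)" "acts1 ?E (x \<cdot> (x \<cdot> x)) (i, i)"
      using acts1_piece[OF k] xp ij by blast+
    have "(i, i) \<in> {(1, 1), (0, 0)}"
      using bits[OF x(1)] by auto
    moreover have "x \<cdot> (x \<cdot> x) \<in> ?T"
      using xR by (intro span_productsI)
    then have "x \<cdot> (x \<cdot> (x \<cdot> x)) \<in> ?Q"
      using xR by (intro span_productsI)
    then have "x \<cdot> (x \<cdot> (x \<cdot> x)) = 0"
      using Q0 by blast
    ultimately show ?thesis
      by (intro listed_35_36[OF basis E acts])
  next
    case 3
    have S0: "\<not> ?S \<subseteq> {0}"
      using 3 by (metis dim_eq_0 zero_neq_one)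
    have "dim ?T < 1"
      using dim_products_less[OF nilR subspace_span RS S0] 3 by simp
    then have T0: "?T \<subseteq> {0}"
      using dim_eq_0[of ?T] by linarith
    have RS0: "r \<cdot> s = 0" if "r \<in> ?R" "s \<in> ?S" for r s
      using T0 span_productsI[OF that] by blast
    have SR0: "s \<cdot> r = 0" if "r \<in> ?R" "s \<in> ?S" for r s
    proof -
      have "s \<cdot> r \<in> ?T"
        using span_square_mult[OF that(2)] span_productsI[OF _ that(1)] by blast
      then show ?thesis
        using T0 by blast
    qed
    have dim2: "dim (insert ?E ?S) = 2"
      using dimES 3 by simp
    obtain i j x where x: "i \<le> k" "j \<le> k" "x \<in> rad i j" and dim3: "dim (insert x (insert ?E ?S)) = 3"
      using extend_homogeneous[OF E_span dim2] by auto
    have dim3': "dim (insert ?E (insert x ?S)) = 3"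
      using dim3 by (simp add: insert_commute)
    obtain i' j' y where y: "i' \<le> k" "j' \<le> k" "y \<in> rad i' j'"
      and dim4: "dim (insert y (insert ?E (insert x ?S))) = 4"
      using extend_homogeneous[OF E_span dim3'] by auto
    have xR: "x \<in> ?R" and yR: "y \<in> ?R"
      by (rule rad_R[OF x(3,1,2)], rule rad_R[OF y(3,1,2)])
    have xp: "x \<in> piece i j" and yp: "y \<in> piece i' j'"
      using rad_in_piece x y by blast+
    have UNIV: "span (insert x (insert y (insert ?E ?S))) = UNIV"
      using dim4 span_eq_UNIV_iff by (simp add: insert_commute)
    have R_sub: "?R \<subseteq> span (insert x (insert y ?S))"
    proof (rule span_homogeneous_subset)
      show "insert x (insert y ?S) \<subseteq> ?R"
        using xR yR SR by blast
      show "span (e ` {1..k} \<union> insert x (insert y ?S)) = UNIV"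
        using UNIV unfolding eset by (simp add: insert_commute)
    qed
    have line: "\<exists>c. s = c *s m" if "m \<in> ?S" "m \<noteq> 0" "s \<in> ?S" for m s
    proof -
      have "span {m} = ?S"
      proof (rule subspace_dim_equal[OF subspace_span subspace_span])
        show "span {m} \<subseteq> ?S"
          using that(1) by (intro span_minimal subspace_span) simp
        show "dim ?S \<le> dim (span {m})"
          using that(2) 3 by (simp only: dim_span dim_singleton) simp
      qed
      then show ?thesis
        using that(3) by (auto simp: span_singleton)
    qed
    have basis: "basis4 x m y ?E" if "m \<in> ?S" "m \<noteq> 0" for m
    proof -
      have "s \<in> span {x, m, y, ?E}" if "s \<in> ?S" for s
        using line[OF \<open>m \<in> ?S\<close> \<open>m \<noteq> 0\<close> that]
          by (auto intro: span_scale span_base)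
      then have "insert x (insert y (insert ?E ?S)) \<subseteq> span {x, m, y, ?E}"
        by (auto intro: span_base)
      then show ?thesis
        using span_minimal[OF _ subspace_span] UNIV unfolding basis4_def by blast
    qed
    have in_S: "u \<cdot> v \<in> ?S" if "u \<in> ?R" "v \<in> ?R" for u v
      using that by (intro span_productsI)
    have ann: "x \<cdot> s = 0 \<and> s \<cdot> x = 0 \<and> y \<cdot> s = 0 \<and> s \<cdot> y = 0" if "s \<in> ?S" for s
      using RS0 SR0 xR yR that by blast
    have SS: "s \<cdot> s = 0" if "s \<in> ?S" for s
      using RS0[OF _ that] SR that by blast
    have nonzero: "\<exists>u\<in>{x, y}. \<exists>v\<in>{x, y}. u \<cdot> v \<noteq> 0"
    proof (rule ccontr)
      assume contr: "\<not> ?thesis"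
      have "u \<cdot> v = 0" if "u \<in> insert x (insert y ?S)" "v \<in> ?R" for u v
      proof -
        have "insert x (insert y ?S) \<subseteq> {v. u \<cdot> v \<in> {0}}"
          using contr that(1) RS0 SR0 xR yR SR by blast
        then have "span (insert x (insert y ?S)) \<subseteq> {v. u \<cdot> v \<in> {0}}"
          by (intro span_minimal subspace_mult_left_preimage subspace_single_0)
        then show ?thesis
          using R_sub that(2) by blast
      qed
      then have "insert x (insert y ?S) \<subseteq> {u. u \<cdot> v \<in> {0}}" if "v \<in> ?R" for v
        using that by blast
      then have "span (insert x (insert y ?S)) \<subseteq> {u. u \<cdot> v \<in> {0}}" if "v \<in> ?R" for v
        using that by (intro span_minimal subspace_mult_right_preimage subspace_single_0)
      then have "products ?R ?R \<subseteq> {0}"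
        using R_sub by (auto simp: products_def)
      then have "?S \<subseteq> {0}"
        by (intro span_minimal) (simp_all add: subspace_single_0)
      then show False
        using S0 by blast
    qed
    show ?thesis
    proof (cases "(i, j) = (i', j')")
      case True
      then have yp': "y \<in> piece i j"
        using yp by simp
      have up: "u \<in> piece i j" if "u \<in> {x, y}" for u
        using that xp yp' by blast
      obtain u v where uv: "u \<in> {x, y}" "v \<in> {x, y}" "u \<cdot> v \<noteq> 0"
        using nonzero by blast
      have ij: "i = j"
        using piece_mult_eq_0[OF up[OF uv(1)] up[OF uv(2)]] uv(3) x by auto
      let ?m = "u \<cdot> v"
      have mS: "?m \<in> ?S"
        using uv xR yR in_S by blast
      have "?m \<in> piece i i"
        using piece_mult[of u i i v i] up uv ij by blast
      then have acts: "acts1 ?E x (i, i)" "acts1 ?E y (i, i)" "acts1 ?E ?m (i, i)"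
        using acts1_piece[OF k] xp yp' ij by blast+
      obtain \<alpha> \<beta> \<gamma> \<delta> where coeffs: "x \<cdot> x = \<alpha> *s ?m" "x \<cdot> y = \<beta> *s ?m" "y \<cdot> x = \<gamma> *s ?m" "y \<cdot> y = \<delta> *s ?m"
        using line[OF mS uv(3)] in_S xR yR by metis
      have "\<alpha> \<noteq> 0 \<or> \<beta> \<noteq> 0 \<or> \<gamma> \<noteq> 0 \<or> \<delta> \<noteq> 0"
      proof (rule ccontr)
        assume "\<not> ?thesis"
        then have "x \<cdot> x = 0" "x \<cdot> y = 0" "y \<cdot> x = 0" "y \<cdot> y = 0"
          using coeffs by simp_all
        then show False
          using nonzero by blast
      qed
      moreover have "(i, i) \<in> {(0, 0), (1, 1)}"
        using bits[OF x(1)] by auto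
      ultimately show ?thesis
        using form_listed[OF basis[OF mS uv(3)] E acts _ coeffs] ann[OF mS] SS[OF mS] by blast
    next
      case False
      have basis': "basis4 y m x ?E" if "m \<in> ?S" "m \<noteq> 0" for m
        using basis[OF that] by (simp add: basis4_def insert_commute)
      have ann': "y \<cdot> s = 0 \<and> s \<cdot> y = 0 \<and> x \<cdot> s = 0 \<and> s \<cdot> x = 0" if "s \<in> ?S" for s
        using ann[OF that] by blast
      note S = in_S[OF xR xR] in_S[OF xR yR] in_S[OF yR xR] in_S[OF yR yR]
      \<comment> \<open>Both orders of the generators are needed: the first handles
        \<open>x x\<close> and \<open>x y\<close>, the second \<open>y y\<close> and
        \<open>y x\<close>.\<close>
      note one = listed_two_generators[where S = ?S, OF k xp x(1,2) yp y(1,2) False basis line S ann SS]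
      note two = listed_two_generators[where S = ?S, OF k yp y(1,2) xp x(1,2) False[symmetric] basis'
          line S(4,3,2,1) ann' SS]
      have "x \<cdot> x \<noteq> 0 \<or> y \<cdot> y = 0 \<and> x \<cdot> y \<noteq> 0 \<or> y \<cdot> y \<noteq> 0 \<or> x \<cdot> x = 0 \<and> y \<cdot> x \<noteq> 0"
        using nonzero by blast
      then show ?thesis
        using one two by blast
    qed
  qed
qed

text \<open>The four elements lie in four different pieces, so they are independent and exhaust
  dimension 4; the algebra is that of 2 by 2 matrices. Compressing a relation by the idempotents
  isolates each coefficient.\<close>

lemma listed_matrix_units:
  assumes "i \<in> {1..k}" "j \<in> {1..k}" "i \<noteq> j" "u \<in> piece i j" "v \<in> piece j i"
    "u \<cdot> v = e i" "v \<cdot> u = e j"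
  shows listed
proof -
  note u = pieceD[OF assms(4,1)] pieceD[OF assms(4,2)]
    and v = pieceD[OF assms(5,1)] pieceD[OF assms(5,2)]
  have "u \<noteq> 0" "v \<noteq> 0"
    using assms(6) e_nonzero[OF assms(1)] by auto
  have uv0: "u \<cdot> u = 0" "v \<cdot> v = 0"
    using piece_mult_eq_0[OF assms(4,4)] piece_mult_eq_0[OF assms(5,5)] assms(1-3) by auto
  have ei: "e i \<in> piece i i" and ej: "e j \<in> piece j j" and le: "i \<le> k" "j \<le> k"
    using e_in_piece assms(1,2) by auto
  note ee = e_mult[OF assms(1,1)] e_mult[OF assms(1,2)] e_mult[OF assms(2,1)] e_mult[OF assms(2,2)]
  have distinct: "distinct [e i, u, v, e j]"
  proof -
    have "w \<noteq> w'" if "w \<in> piece a b" "w' \<in> piece a' b'" "w \<noteq> 0" "(a, b) \<noteq> (a', b')"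
      "a \<le> k" "b \<le> k" "a' \<le> k" "b' \<le> k" for w w' a b a' b'
      using piece_unique[of w a b a' b'] that by blast
    note ne = this
    show ?thesis
      using ne[OF ei assms(4)] ne[OF ei assms(5)] ne[OF ei ej] ne[OF assms(4,5)]
        ne[OF assms(4) ej] ne[OF assms(5) ej] \<open>u \<noteq> 0\<close> \<open>v \<noteq> 0\<close> e_nonzero[OF assms(1)] assms(3) le
      by simp
  qed
  have "independent {e i, u, v, e j}"
  proof (rule independent_if_scalars_zero)
    fix g x assume sum: "(\<Sum>x\<in>{e i, u, v, e j}. g x *s x) = 0" and x: "x \<in> {e i, u, v, e j}"
    have w: "g (e i) *s e i + (g u *s u + (g v *s v + g (e j) *s e j)) = 0" (is "?w = 0")
      using sum distinct by simp
    have "e i \<cdot> ?w \<cdot> e i = g (e i) *s e i" "e i \<cdot> ?w \<cdot> e j = g u *s u"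
      "e j \<cdot> ?w \<cdot> e i = g v *s v" "e j \<cdot> ?w \<cdot> e j = g (e j) *s e j"
      using assms(3) by (simp_all add: mult_distribs u v ee)
    then have "g (e i) *s e i = 0" "g u *s u = 0" "g v *s v = 0" "g (e j) *s e j = 0"
      unfolding w by simp_all
    then show "g x = 0"
      using x \<open>u \<noteq> 0\<close> \<open>v \<noteq> 0\<close> e_nonzero assms(1,2) by auto
  qed simp
  then have "dim {e i, u, v, e j} = card {e i, u, v, e j}"
    by (rule dim_eq_card_independent)
  also have "\<dots> = 4"
    using distinct_card[OF distinct] by simp
  finally have "basis4 (e i) u v (e j)"
    using span_eq_UNIV_iff by (simp add: basis4_def)
  then show ?thesis
    by (rule listed_1) (use assms(3,6,7) ee u v uv0 in simp_all)
qed

end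

text \<open>Orthogonal idempotents are independent, so their number is bounded by 4 and a greatest
  one exists; it is at least 1 by the existence of an idempotent.\<close>

lemma (in four_dim_algebra) nonnil_listed:
  assumes "\<not> nil UNIV"
  shows listed
proof -
  define P where "P k \<longleftrightarrow> (\<exists>e. orthogonal_idempotents k e)" for k
  have bound: "k \<le> 4" if "P k" for k
  proof -
    obtain e where e: "orthogonal_idempotents k e"
      using \<open>P k\<close> by (auto simp: P_def)
    show ?thesis
      using independent_card_le_dim[OF subset_UNIV orthogonal_idempotents_independent[OF e]]
        card_image[OF orthogonal_idempotents_inj_on[OF e]] dim_4 by simp
  qed
  have "closed UNIV"
    by (simp add: closed_def)
  then obtain e0 where "e0 \<noteq> 0" "e0 \<cdot> e0 = e0"
    using nonnil_has_idempotent assms by blast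
  then have "orthogonal_idempotents 1 (\<lambda>_. e0)"
    by (simp add: orthogonal_idempotents_def)
  then have P1: "P 1"
    unfolding P_def by blast
  define k where "k = (GREATEST k. P k)"
  have "P k"
    unfolding k_def using GreatestI_nat[of P 1 4] P1 bound by blast
  then obtain e where e: "orthogonal_idempotents k e"
    by (auto simp: P_def)
  have "\<not> P (Suc k)"
    using Greatest_le_nat[of P "Suc k" 4] bound unfolding k_def by fastforce
  then interpret maximal_idempotents_4 scale mult Basis k e
    by unfold_locales (use e in \<open>auto simp: P_def\<close>)
  have "1 \<le> k"
    unfolding k_def using Greatest_le_nat[of P 1 4] P1 bound by blast
  then consider "k = 1" | "k = 2" | "k = 3" | "k = 4"
    using bound[OF \<open>P k\<close>] by linarith
  then show ?thesis
    by (rule rad_closed_or_matrix_units)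
      (use listed_k1 listed_k2 listed_k3 listed_k4 listed_matrix_units in blast)+
qed

section \<open>Coordinates\<close>

text \<open>The product on coordinate functions: for a concrete entry every identity becomes a
  polynomial identity in finitely many unknowns, which simplification decides.\<close>

definition coord_mult ::
  "(complex \<times> nat \<times> nat \<times> nat) list \<Rightarrow> (nat \<Rightarrow> complex) \<Rightarrow> (nat \<Rightarrow> complex) \<Rightarrow> nat \<Rightarrow> complex" where
  "coord_mult ts X Y l = (\<Sum>(c, i, j, k)\<leftarrow>ts. if k = l then c * X i * Y j else 0)"

definition valid_terms :: "(complex \<times> nat \<times> nat \<times> nat) list \<Rightarrow> bool" where
  "valid_terms ts \<longleftrightarrow> (\<forall>(c, i, j, k)\<in>set ts. i \<in> {1..4} \<and> j \<in> {1..4} \<and> k \<in> {1..4})"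

lemma atLeastAtMost_1_72:
  "{1..72::nat} = {1, 2, 3, 4, 5, 6, 7, 8, 9, 10, 11, 12, 13, 14, 15, 16, 17, 18, 19, 20,
    21, 22, 23, 24, 25, 26, 27, 28, 29, 30, 31, 32, 33, 34, 35, 36, 37, 38, 39, 40,
    41, 42, 43, 44, 45, 46, 47, 48, 49, 50, 51, 52, 53, 54, 55, 56, 57, 58, 59, 60,
    61, 62, 63, 64, 65, 66, 67, 68, 69, 70, 71, 72}"
proof -
  have "{n..72} = insert n {n + 1..72}" if "n \<le> 72" for n :: nat
    using that by auto
  then show ?thesis
    by (simp del: One_nat_def)
qed

lemma valid_entry:
  assumes "i \<in> {1..72}"
  shows "valid_terms (entry i p q)"
  using assms unfolding atLeastAtMost_1_72
  by (elim insertE emptyE; hypsubst; simp only: entry_eqs valid_terms_def list.set ball_simps prod.case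
      atLeastAtMost_1_4 insert_iff simp_thms)

lemma coord_mult_cong:
  assumes "valid_terms ts"
    and "\<And>k. k \<in> {1..4} \<Longrightarrow> X k = X' k" "\<And>k. k \<in> {1..4} \<Longrightarrow> Y k = Y' k"
  shows "coord_mult ts X Y l = coord_mult ts X' Y' l"
  using assms by (induction ts) (auto simp: coord_mult_def valid_terms_def)

lemmas entry_cong = coord_mult_cong[OF valid_entry]

lemmas coord_mult_simps = coord_mult_def entry_eqs list.map sum_list.Cons sum_list.Nil prod.case
  rel_simps refl if_True if_False simp_thms add_0_left add_0_right mult_1_left

lemma coord_mult_entry_assoc:
  assumes "i \<in> {1..72}" "l \<in> {1..4}"
  shows "coord_mult (entry i p q) (coord_mult (entry i p q) X Y) Z l =
    coord_mult (entry i p q) X (coord_mult (entry i p q) Y Z) l"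
proof -
  have "\<forall>l\<in>{1..4}. coord_mult (entry i p q) (coord_mult (entry i p q) X Y) Z l =
    coord_mult (entry i p q) X (coord_mult (entry i p q) Y Z) l"
    using assms(1) unfolding atLeastAtMost_1_72 atLeastAtMost_1_4
    by (elim insertE emptyE; hypsubst; simp only: coord_mult_simps ball_simps; simp add: algebra_simps)
  then show ?thesis
    using assms(2) by blast
qed

section \<open>Coordinates of vectors; every entry is an associative, non-nilpotent algebra\<close>

context four_dim_basis
begin

definition coord :: "nat \<Rightarrow> 'v \<Rightarrow> complex" where
  "coord k x = representation (f ` {1..4}) x (f k)"

lemma coord_add: "coord k (x + y) = coord k x + coord k y"
  and coord_scale: "coord k (scale c x) = c * coord k x"
  by (simp_all add: coord_def representation_add representation_scale independent_basis span_basis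
      del: One_nat_def)

lemma psi_coord: "psi scale f i j k x y = scale (coord i x * coord j y) (f k)"
  by (simp only: psi_def coord_def)

lemma coord_zero: "coord k 0 = 0"
  using coord_scale[of k 0 0] by simp

lemma coord_sum: "coord k (sum g A) = (\<Sum>a\<in>A. coord k (g a))"
  by (induction A rule: infinite_finite_induct) (simp_all add: coord_add coord_zero)

lemma coord_basis:
  assumes "i \<in> {1..4}" "j \<in> {1..4}"
  shows "coord i (f j) = (if i = j then 1 else 0)"
  unfolding coord_def
  using representation_basis[OF independent_basis, of "f j"] inj_onD[OF inj_basis, of i j] assms
  by auto

lemma sum_coord: "(\<Sum>k=1..4. scale (coord k x) (f k)) = x"
proof -
  have "(\<Sum>b\<in>f ` {1..4}. scale (representation (f ` {1..4}) x b) b) = x"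
    by (rule sum_representation_eq) (simp_all add: independent_basis span_basis del: One_nat_def)
  then show ?thesis
    by (simp add: sum.reindex[OF inj_basis] coord_def del: One_nat_def)
qed

lemma coord_eqI:
  assumes "\<And>k. k \<in> {1..4} \<Longrightarrow> coord k x = coord k y"
  shows "x = y"
  using assms sum_coord[of x] sum_coord[of y] by (metis (no_types, lifting) sum.cong)

lemma coord_sum_scale:
  assumes "k \<in> {1..4}"
  shows "coord k (\<Sum>j=1..4. scale (g j) (f j)) = g k"
proof -
  have "coord k (scale (g j) (f j)) = (if j = k then g k else 0)" if "j \<in> {1..4}" for j
    using coord_basis[OF assms that] by (auto simp: coord_scale)
  then show ?thesis
    using assms by (simp add: coord_sum del: One_nat_def atLeastAtMost_iff cong: sum.cong)
qed

lemma coord_sum_of_terms: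
  assumes "valid_terms ts" "l \<in> {1..4}"
  shows "coord l (sum_of_terms scale f ts x y) = coord_mult ts (\<lambda>k. coord k x) (\<lambda>k. coord k y) l"
  using assms(1)
proof (induction ts)
  case Nil
  then show ?case
    by (simp add: sum_of_terms_def coord_mult_def coord_zero)
next
  case (Cons t ts)
  obtain c i j k where t: "t = (c, i, j, k)"
    by (cases t)
  have "coord l (f k) = (if k = l then 1 else 0)"
    using Cons.prems assms(2) coord_basis[of l k] by (auto simp: valid_terms_def t)
  moreover have "valid_terms ts"
    using Cons.prems by (simp add: valid_terms_def)
  ultimately show ?case
    using Cons.IH by (simp add: t sum_of_terms_def coord_mult_def coord_add coord_scale
        psi_coord)
qed

lemma coord_d_mult:
  assumes "i \<in> {1..72}" "l \<in> {1..4}"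
  shows "coord l (d_mult scale f i p q x y) =
    coord_mult (entry i p q) (\<lambda>k. coord k x) (\<lambda>k. coord k y) l"
  unfolding d_mult_entry by (rule coord_sum_of_terms[OF valid_entry[OF assms(1)] assms(2)])

lemma sum_of_terms_linear:
  "Vector_Spaces.linear scale scale (\<lambda>y. sum_of_terms scale f ts x y)"
  "Vector_Spaces.linear scale scale (\<lambda>x. sum_of_terms scale f ts x y)"
proof -
  have "sum_of_terms scale f ts x (y + y') = sum_of_terms scale f ts x y + sum_of_terms scale f ts x y' \<and>
    sum_of_terms scale f ts x (scale a y) = scale a (sum_of_terms scale f ts x y) \<and>
    sum_of_terms scale f ts (y + y') x = sum_of_terms scale f ts y x + sum_of_terms scale f ts y' x \<and>
    sum_of_terms scale f ts (scale a y) x = scale a (sum_of_terms scale f ts y x)" for x y y' a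
    by (induction ts)
      (auto simp: sum_of_terms_def psi_coord coord_add coord_scale scale_left_distrib
        scale_right_distrib algebra_simps)
  then show "Vector_Spaces.linear scale scale (\<lambda>y. sum_of_terms scale f ts x y)"
    "Vector_Spaces.linear scale scale (\<lambda>x. sum_of_terms scale f ts x y)"
    by (simp_all add: Vector_Spaces.linear_iff vector_space_axioms)
qed

lemma d_mult_algebra:
  assumes "i \<in> {1..72}"
  shows "complex_algebra scale (d_mult scale f i p q)"
proof (intro complex_algebra.intro complex_algebra_axioms.intro)
  show "vector_space scale" ..
next
  let ?m = "d_mult scale f i p q"
  show "Vector_Spaces.linear scale scale (\<lambda>y. ?m x y)" for x
    unfolding d_mult_entry by (rule sum_of_terms_linear)
  show "Vector_Spaces.linear scale scale (\<lambda>x. ?m x y)" for y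
    unfolding d_mult_entry by (rule sum_of_terms_linear)
  show "?m (?m x y) z = ?m x (?m y z)" for x y z
  proof (rule coord_eqI)
    fix l :: nat assume l: "l \<in> {1..4}"
    let ?ts = "entry i p q" and ?X = "\<lambda>k. coord k x" and ?Y = "\<lambda>k. coord k y" and ?Z = "\<lambda>k. coord k z"
    have "coord l (?m (?m x y) z) = coord_mult ?ts (coord_mult ?ts ?X ?Y) ?Z l"
      unfolding coord_d_mult[OF assms l]
        by (rule entry_cong[OF assms]) (simp_all only: coord_d_mult[OF assms])
    also have "\<dots> = coord_mult ?ts ?X (coord_mult ?ts ?Y ?Z) l"
      by (rule coord_mult_entry_assoc[OF assms l])
    also have "\<dots> = coord l (?m x (?m y z))"
      unfolding coord_d_mult[OF assms l]
        by (rule entry_cong[OF assms]) (simp_all only: coord_d_mult[OF assms])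
    finally show "coord l (?m (?m x y) z) = coord l (?m x (?m y z))" .
  qed
qed

text \<open>f4 is idempotent in every entry, which is the reason why none is nilpotent.\<close>

lemma d_mult_f4:
  assumes "i \<in> {1..72}"
  shows "d_mult scale f i p q (f 4) (f 4) = f 4"
proof (rule coord_eqI)
  fix l :: nat assume l: "l \<in> {1..4}"
  have "\<forall>l\<in>{1..4}. coord_mult (entry i p q) (\<lambda>k. coord k (f 4)) (\<lambda>k. coord k (f 4)) l = coord l (f 4)"
    using assms unfolding atLeastAtMost_1_72 atLeastAtMost_1_4
    by (elim insertE emptyE; hypsubst; simp only: coord_mult_simps ball_simps; simp add: coord_basis)
  then show "coord l (d_mult scale f i p q (f 4) (f 4)) = coord l (f 4)"
    using coord_d_mult[OF assms l] l by simp
qed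

lemma f_nonzero: "i \<in> {1..4} \<Longrightarrow> f i \<noteq> 0"
  using coord_basis[of i i] by (auto simp: coord_zero)

lemma d_mult_not_nilpotent:
  assumes "i \<in> {1..72}"
  shows "\<not> nilpotent_mult (d_mult scale f i p q)"
proof
  let ?m = "d_mult scale f i p q"
  assume "nilpotent_mult ?m"
  then obtain n where n: "\<And>x xs. Suc (length xs) = n \<Longrightarrow> foldl ?m x xs = 0" "n \<ge> 1"
    unfolding nilpotent_mult_def by blast
  have "foldl ?m (f 4) (replicate l (f 4)) = f 4" for l
    by (induction l) (simp_all add: d_mult_f4[OF assms])
  then show False
    using n(1)[of "replicate (n - 1) (f 4)" "f 4"] n(2) f_nonzero[of 4] by simp
qed

end

text \<open>The isomorphism keeps coordinates and replaces the basis \<open>b\<close> by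
  \<open>f\<close>; by bilinearity both products have the same coordinate formula.\<close>

lemma iso_of_table:
  assumes "complex_algebra scaleA multA" and "four_dim_basis scaleA b"
    and "complex_algebra.has_table scaleA multA ts b"
    and "four_dim_basis scaleV f" and "valid_terms ts"
  shows "algebra_iso scaleA multA scaleV (sum_of_terms scaleV f ts)"
proof -
  interpret A: complex_algebra scaleA multA by fact
  interpret bA: four_dim_basis scaleA b by fact
  interpret V: four_dim_basis scaleV f by fact
  define \<phi> where "\<phi> x = (\<Sum>k=1..4. scaleV (bA.coord k x) (f k))" for x
  define \<psi> where "\<psi> y = (\<Sum>k=1..4. scaleA (V.coord k y) (b k))" for y
  have coord_\<phi>: "V.coord k (\<phi> x) = bA.coord k x" if "k \<in> {1..4}" for k x
    unfolding \<phi>_def by (rule V.coord_sum_scale[OF that])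
  have coord_\<psi>: "bA.coord k (\<psi> x) = V.coord k x" if "k \<in> {1..4}" for k x
    unfolding \<psi>_def by (rule bA.coord_sum_scale[OF that])
  have "bij \<phi>"
  proof (rule o_bij)
    show "\<psi> \<circ> \<phi> = id"
      by (rule ext, rule bA.coord_eqI) (simp add: coord_\<phi> coord_\<psi>)
    show "\<phi> \<circ> \<psi> = id"
      by (rule ext, rule V.coord_eqI) (simp add: coord_\<phi> coord_\<psi>)
  qed
  moreover have "Vector_Spaces.linear scaleA scaleV \<phi>"
    unfolding Vector_Spaces.linear_iff
    by (intro conjI allI A.vector_space_axioms V.vector_space_axioms V.coord_eqI)
      (simp_all add: coord_\<phi> V.coord_add V.coord_scale bA.coord_add bA.coord_scale)
  moreover have "\<phi> (multA x y) = sum_of_terms scaleV f ts (\<phi> x) (\<phi> y)" for x y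
  proof -
    \<comment> \<open>A term contributes only to the summand whose pair (i, j) is its own upper
      index pair, so the double sum collapses to the list of terms.\<close>
    have lists: "(\<Sum>i=1..4. \<Sum>j=1..4. scaleA (X i * Y j)
        (\<Sum>(c, i', j', l)\<leftarrow>ts. if i' = i \<and> j' = j then scaleA c (b l) else 0)) =
      (\<Sum>(c, i, j, l)\<leftarrow>ts. scaleA (c * X i * Y j) (b l))" for X Y
      using \<open>valid_terms ts\<close>
    proof (induction ts)
      case (Cons t ts)
      obtain c i' j' l where t: "t = (c, i', j', l)"
        by (cases t)
      have ij: "i' \<in> {1..4}" "j' \<in> {1..4}" and ts: "valid_terms ts"
        using Cons.prems by (auto simp: valid_terms_def t)
      have "(\<Sum>i=1..4. \<Sum>j=1..4. scaleA (X i * Y j) (if i' = i \<and> j' = j then scaleA c (b l) else 0)) =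
        (\<Sum>i=1..4. \<Sum>j=1..4. if j = j' then if i = i' then scaleA (c * X i * Y j) (b l) else 0 else 0)"
        by (intro sum.cong refl) (auto simp: mult_ac)
      also have "\<dots> = scaleA (c * X i' * Y j') (b l)"
        using ij by (simp del: One_nat_def atLeastAtMost_iff)
      finally show ?case
        using Cons.IH[OF ts] by (simp add: t A.scale_right_distrib sum.distrib del: One_nat_def)
    qed simp
    have "multA x y = multA (\<Sum>i=1..4. scaleA (bA.coord i x) (b i)) (\<Sum>j=1..4. scaleA (bA.coord j y) (b j))"
      by (simp only: bA.sum_coord)
    also have "\<dots> = (\<Sum>i=1..4. scaleA (bA.coord i x)
        (multA (b i) (\<Sum>j=1..4. scaleA (bA.coord j y) (b j))))"
      by (simp only: A.mult_sum_left A.mult_scale_left)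
    also have "\<dots> = (\<Sum>i=1..4. \<Sum>j=1..4. scaleA (bA.coord i x * bA.coord j y) (multA (b i) (b j)))"
      by (simp only: A.mult_sum_right A.mult_scale_right A.scale_sum_right A.scale_scale)
    also have "\<dots> = (\<Sum>i=1..4. \<Sum>j=1..4. scaleA (bA.coord i x * bA.coord j y)
        (\<Sum>(c, i', j', l)\<leftarrow>ts. if i' = i \<and> j' = j then scaleA c (b l) else 0))"
      using assms(3) unfolding A.has_table_def by (intro sum.cong refl) simp
    also have "\<dots> = sum_of_terms scaleA b ts x y"
      unfolding lists by (simp add: sum_of_terms_def bA.psi_coord mult.assoc)
    finally have m: "multA x y = sum_of_terms scaleA b ts x y" .
    show ?thesis
    proof (rule V.coord_eqI)
      fix l :: nat assume l: "l \<in> {1..4}"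
      have "V.coord l (\<phi> (multA x y)) = coord_mult ts (\<lambda>k. bA.coord k x) (\<lambda>k. bA.coord k y) l"
        unfolding coord_\<phi>[OF l] m by (rule bA.coord_sum_of_terms[OF assms(5) l])
      also have "\<dots> = coord_mult ts (\<lambda>k. V.coord k (\<phi> x)) (\<lambda>k. V.coord k (\<phi> y)) l"
        by (rule coord_mult_cong[OF assms(5)]) (simp_all only: coord_\<phi>)
      also have "\<dots> = V.coord l (sum_of_terms scaleV f ts (\<phi> x) (\<phi> y))"
        by (rule V.coord_sum_of_terms[OF assms(5) l, symmetric])
      finally show "V.coord l (\<phi> (multA x y)) = V.coord l (sum_of_terms scaleV f ts (\<phi> x) (\<phi> y))" .
    qed
  qed
  ultimately show ?thesis
    unfolding algebra_iso_def by blast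
qed

section \<open>Characters and traces of the entries\<close>

text \<open>The coordinates that are characters of the algebra \<open>d\<^sub>i\<close>, for \<open>i \<ge> 2\<close>; their common kernel is
  the radical.\<close>

definition characters :: "nat \<Rightarrow> nat set" where
  "characters i = (if i = 2 then {1, 2, 3, 4} else if i \<le> 7 then {2, 3, 4} else if i \<le> 34 then {3, 4} else {4})"

lemma characters_subset: "characters i \<subseteq> {1..4}"
  by (auto simp: characters_def)

lemma in_2_72D: "i \<in> {2..72} \<Longrightarrow> i \<in> {1..72} - {1::nat}"
  by auto

lemmas char_simps = characters_def rel_simps refl if_True if_False simp_thms ball_simps

lemma character_mult:
  assumes "i \<in> {2..72}" "c \<in> characters i"
  shows "coord_mult (entry i p q) X Y c = X c * Y c"
proof -
  have "\<forall>c\<in>characters i. coord_mult (entry i p q) X Y c = X c * Y c"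
    using in_2_72D[OF assms(1)] unfolding atLeastAtMost_1_72 Diff_iff
    by (elim conjE insertE emptyE; hypsubst; (simp only: char_simps coord_mult_simps)?; simp)
  then show ?thesis
    using assms(2) by blast
qed

text \<open>Four factors suffice: the radical R has dimension at most 3, so its strictly descending
  powers give R^4 = 0.\<close>

lemma character_kernel_nil:
  assumes "i \<in> {2..72}" "\<forall>c\<in>characters i. X c = 0" "l \<in> {1..4}"
  shows "coord_mult (entry i p q) X (coord_mult (entry i p q) X (coord_mult (entry i p q) X X)) l = 0"
proof -
  have "(\<forall>c\<in>characters i. X c = 0) \<longrightarrow> (\<forall>l\<in>{1..4}.
    coord_mult (entry i p q) X (coord_mult (entry i p q) X (coord_mult (entry i p q) X X)) l = 0)"
    using in_2_72D[OF assms(1)] unfolding atLeastAtMost_1_72 atLeastAtMost_1_4 Diff_iff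
    by (elim conjE insertE emptyE; hypsubst; (simp only: char_simps coord_mult_simps)?; simp)
  then show ?thesis
    using assms(2,3) by blast
qed

lemma character_units:
  assumes "i \<in> {2..72}" "a \<in> characters i" "b \<in> characters i" "l \<in> {1..4}"
  shows "coord_mult (entry i p q) (\<lambda>k. if k = a then 1 else 0) (\<lambda>k. if k = b then 1 else 0) l =
    (if a = b \<and> l = a then 1 else 0)"
proof -
  have "\<forall>a\<in>characters i. \<forall>b\<in>characters i. \<forall>l\<in>{1..4}.
    coord_mult (entry i p q) (\<lambda>k. if k = a then 1 else 0) (\<lambda>k. if k = b then 1 else 0) l =
    (if a = b \<and> l = a then 1 else 0)"
    using in_2_72D[OF assms(1)] unfolding atLeastAtMost_1_72 atLeastAtMost_1_4 Diff_iff
    by (elim conjE insertE emptyE; hypsubst; (simp only: char_simps coord_mult_simps)?; simp)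
  then show ?thesis
    using assms(2-4) by blast
qed

text \<open>For an entry \<open>i \<ge> 35\<close> and its idempotent \<open>e = f\<^sub>4\<close>: the dimensions of \<open>eA\<close>, \<open>Ae\<close> and \<open>eAe\<close>.\<close>

definition dims1 :: "(nat \<times> nat \<times> nat \<times> nat) list" where
  "dims1 = [
     (35, 4, 4, 4), (36, 1, 1, 1), (37, 4, 4, 4), (38, 1, 1, 1), (39, 3, 3, 2), (40, 2, 2, 1),
     (41, 3, 1, 1), (42, 1, 3, 1), (43, 2, 4, 2), (44, 4, 2, 2), (45, 4, 3, 3), (46, 3, 4, 3),
     (47, 1, 2, 1), (48, 2, 1, 1), (49, 2, 2, 2), (50, 3, 3, 3), (51, 4, 4, 4), (52, 1, 1, 1),
     (53, 2, 3, 1), (54, 3, 2, 1), (55, 4, 1, 1), (56, 1, 4, 1), (57, 3, 3, 2), (58, 3, 2, 2),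
     (59, 2, 3, 2), (60, 2, 2, 1), (61, 4, 2, 2), (62, 2, 4, 2), (63, 3, 1, 1), (64, 1, 3, 1),
     (65, 3, 3, 3), (66, 4, 3, 3), (67, 3, 4, 3), (68, 2, 2, 2), (69, 2, 1, 1), (70, 1, 2, 1),
     (71, 4, 4, 4), (72, 1, 1, 1)]"

text \<open>For the entries 8 to 34, the dimensions of \<open>eA\<close>, \<open>Ae\<close>, \<open>eAe\<close>, \<open>eAe'\<close>, first with \<open>e = f\<^sub>3\<close> and
  \<open>e' = f\<^sub>4\<close>, then with the roles exchanged.\<close>

definition dims2 :: "(nat \<times> (nat \<times> nat \<times> nat \<times> nat) \<times> (nat \<times> nat \<times> nat \<times> nat)) list" where
  "dims2 = [
     (8, (3, 3, 3, 0), (1, 1, 1, 0)), (9, (1, 1, 1, 0), (1, 1, 1, 0)), (10, (3, 1, 1, 1), (1, 2, 1, 0)),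
     (11, (1, 3, 1, 0), (2, 1, 1, 1)), (12, (2, 1, 1, 0), (2, 1, 1, 0)), (13, (1, 2, 1, 0), (1, 2, 1, 0)),
     (14, (2, 1, 1, 0), (1, 2, 1, 0)), (15, (2, 1, 1, 1), (2, 2, 1, 0)), (16, (1, 2, 1, 0), (2, 2, 1, 1)),
     (17, (3, 1, 1, 2), (1, 3, 1, 0)), (18, (3, 1, 1, 0), (1, 1, 1, 0)), (19, (1, 3, 1, 0), (1, 1, 1, 0)),
     (20, (2, 2, 1, 0), (1, 1, 1, 0)), (21, (2, 2, 1, 1), (2, 2, 1, 1)), (22, (3, 2, 2, 0), (1, 1, 1, 0)),
     (23, (2, 3, 2, 0), (1, 1, 1, 0)), (24, (2, 1, 1, 1), (1, 2, 1, 0)), (25, (2, 1, 1, 0), (2, 2, 2, 0)),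
     (26, (1, 2, 1, 0), (2, 2, 2, 0)), (27, (1, 2, 1, 0), (3, 2, 2, 1)), (28, (2, 1, 1, 1), (2, 3, 2, 0)),
     (29, (2, 1, 1, 0), (1, 1, 1, 0)), (30, (1, 2, 1, 0), (1, 1, 1, 0)), (31, (2, 2, 2, 0), (1, 1, 1, 0)),
     (32, (2, 2, 2, 0), (2, 2, 2, 0)), (33, (3, 3, 3, 0), (1, 1, 1, 0)), (34, (1, 1, 1, 0), (1, 1, 1, 0))]"

definition trace_left :: "(complex \<times> nat \<times> nat \<times> nat) list \<Rightarrow> (nat \<Rightarrow> complex) \<Rightarrow> complex" where
  "trace_left ts X = (\<Sum>l\<leftarrow>[1, 2, 3, 4]. coord_mult ts X (\<lambda>k. if k = l then 1 else 0) l)"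

definition trace_right :: "(complex \<times> nat \<times> nat \<times> nat) list \<Rightarrow> (nat \<Rightarrow> complex) \<Rightarrow> complex" where
  "trace_right ts X = (\<Sum>l\<leftarrow>[1, 2, 3, 4]. coord_mult ts (\<lambda>k. if k = l then 1 else 0) X l)"

definition trace_both ::
  "(complex \<times> nat \<times> nat \<times> nat) list \<Rightarrow> (nat \<Rightarrow> complex) \<Rightarrow> (nat \<Rightarrow> complex) \<Rightarrow> complex" where
  "trace_both ts X Y =
     (\<Sum>l\<leftarrow>[1, 2, 3, 4]. coord_mult ts X (coord_mult ts (\<lambda>k. if k = l then 1 else 0) Y) l)"

lemmas trace_simps = trace_left_def trace_right_def trace_both_def

text \<open>For every element, not only for f4, the traces depend on the character coordinate alone.
  Hence all idempotents have the same traces.\<close>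

lemma dims1_traces:
  assumes "(i, a, b, c) \<in> set dims1"
  shows "trace_left (entry i p q) X = of_nat a * X 4 \<and> trace_right (entry i p q) X = of_nat b * X 4 \<and>
    trace_both (entry i p q) X Y = of_nat c * X 4 * Y 4"
  using assms unfolding dims1_def list.set insert_iff prod.inject empty_iff
  by (elim disjE conjE FalseE; hypsubst; simp only: trace_simps coord_mult_simps; simp add: algebra_simps)

lemma dims2_traces:
  assumes "(i, (a, b, c, d), (a', b', c', d')) \<in> set dims2"
  shows "trace_left (entry i p q) X = of_nat a * X 3 + of_nat a' * X 4 \<and>
    trace_right (entry i p q) X = of_nat b * X 3 + of_nat b' * X 4 \<and>
    trace_both (entry i p q) X Y = of_nat c * X 3 * Y 3 + of_nat c' * X 4 * Y 4 +
      of_nat d * X 3 * Y 4 + of_nat d' * X 4 * Y 3"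
  using assms unfolding dims2_def list.set insert_iff prod.inject empty_iff
  by (elim disjE conjE FalseE; hypsubst; simp only: trace_simps coord_mult_simps; simp add: algebra_simps)

lemma ex_dims1:
  assumes "i \<in> {35..72}"
  shows "\<exists>a b c. (i, a, b, c) \<in> set dims1"
proof -
  have "i \<in> {1..72} - {1..34}"
    using assms by auto
  then have "i \<in> fst ` set dims1"
    unfolding atLeastAtMost_1_72 Diff_iff by (elim conjE insertE emptyE; hypsubst;
      (simp only: dims1_def list.set image_insert fst_conv insert_iff rel_simps simp_thms)?; simp?)
  then obtain x where "x \<in> set dims1" "i = fst x"
    by blast
  then show ?thesis
    by (metis prod.collapse)
qed

lemma ex_dims2:
  assumes "i \<in> {8..34}"
  shows "\<exists>u v. (i, u, v) \<in> set dims2"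
proof -
  have "i \<in> {1..72} - {1..7} - {35..72}"
    using assms by auto
  then have "i \<in> fst ` set dims2"
    unfolding atLeastAtMost_1_72 Diff_iff by (elim conjE insertE emptyE; hypsubst;
      (simp only: dims2_def list.set image_insert fst_conv insert_iff rel_simps simp_thms)?; simp?)
  then obtain x where "x \<in> set dims2" "i = fst x"
    by blast
  then show ?thesis
    by (metis prod.collapse)
qed

text \<open>Dimensions coincide only between entries with nonzero products of nilpotent elements (up
  to 52) and entries without (from 53), and inside the two groups whose radical has the single type
  (1, 1) or (0, 0).\<close>

lemma dims1_distinct:
  "\<forall>(i, u)\<in>set dims1. \<forall>(j, v)\<in>set dims1. u = v \<longrightarrow> i = j \<or> i \<ge> 53 \<and> j \<le> 52 \<or> i \<le> 52 \<and> j \<ge> 53 \<or>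
     i \<in> {35, 37, 51} \<and> j \<in> {35, 37, 51} \<or> i \<in> {36, 38, 52} \<and> j \<in> {36, 38, 52}"
  unfolding dims1_def by code_simp

text \<open>Both orders are compared because an isomorphism may exchange the two idempotents. The
  two exceptional pairs differ in whether nilpotent elements have nonzero products.\<close>

lemma dims2_distinct:
  "\<forall>(i, u, v)\<in>set dims2. \<forall>(j, u', v')\<in>set dims2. u = u' \<and> v = v' \<or> u = v' \<and> v = u' \<longrightarrow>
     i = j \<or> {i, j} = {8, 33} \<or> {i, j} = {9, 34}"
  unfolding dims2_def by code_simp

section \<open>Invariants\<close>

lemma algebra_iso_sym:
  assumes "algebra_iso scaleA multA scaleB multB"
  shows "algebra_iso scaleB multB scaleA multA"
proof -
  obtain \<phi> where lin: "Vector_Spaces.linear scaleA scaleB \<phi>" and bij: "bij \<phi>"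
    and mult: "\<And>x y. \<phi> (multA x y) = multB (\<phi> x) (\<phi> y)"
    using assms by (auto simp: algebra_iso_def)
  let ?\<psi> = "inv \<phi>"
  have \<phi>\<psi>: "\<phi> (?\<psi> y) = y" and \<psi>\<phi>: "?\<psi> (\<phi> x) = x" for x y
    using bij by (simp_all add: bij_is_surj bij_is_inj surj_f_inv_f)
  have "Vector_Spaces.linear scaleB scaleA ?\<psi>"
    using lin \<psi>\<phi> \<phi>\<psi> unfolding Vector_Spaces.linear_iff by metis
  moreover have "?\<psi> (multB x y) = multA (?\<psi> x) (?\<psi> y)" for x y
    using mult[of "?\<psi> x" "?\<psi> y"] \<phi>\<psi> \<psi>\<phi> by metis
  ultimately show ?thesis
    using bij_imp_bij_inv[OF bij] unfolding algebra_iso_def by blast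
qed

definition idem :: "('v::ab_group_add \<Rightarrow> 'v \<Rightarrow> 'v) \<Rightarrow> 'v \<Rightarrow> bool" where
  "idem m x \<longleftrightarrow> x \<noteq> 0 \<and> m x x = x"

definition orth :: "('v::ab_group_add \<Rightarrow> 'v \<Rightarrow> 'v) \<Rightarrow> 'v \<Rightarrow> 'v \<Rightarrow> bool" where
  "orth m x y \<longleftrightarrow> idem m x \<and> idem m y \<and> m x y = 0 \<and> m y x = 0"

text \<open>The fourth power vanishes; the exponent 4 covers all nilpotent elements of the entries
  from 2 on.\<close>

definition nilp :: "('v::ab_group_add \<Rightarrow> 'v \<Rightarrow> 'v) \<Rightarrow> 'v \<Rightarrow> bool" where
  "nilp m x \<longleftrightarrow> m x (m x (m x x)) = 0"

text \<open>All invariants below are of existential form, so they only have to be transported along an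
  isomorphism in one direction.\<close>

definition three_orth :: "('v::ab_group_add \<Rightarrow> 'v \<Rightarrow> 'v) \<Rightarrow> bool" where
  "three_orth m \<longleftrightarrow> (\<exists>x y z. orth m x y \<and> orth m x z \<and> orth m y z)"

text \<open>Two opposite off-diagonal matrix units have this property, so it detects the matrix
  algebra.\<close>

definition null_product_idem :: "('v::ab_group_add \<Rightarrow> 'v \<Rightarrow> 'v) \<Rightarrow> bool" where
  "null_product_idem m \<longleftrightarrow> (\<exists>x y. m x x = 0 \<and> m y y = 0 \<and> idem m (m x y))"

definition square_zero :: "('v::ab_group_add \<Rightarrow> 'v \<Rightarrow> 'v) \<Rightarrow> bool" where
  "square_zero m \<longleftrightarrow> (\<exists>x. x \<noteq> 0 \<and> m x x = 0)"

definition left_annihilator :: "('v::ab_group_add \<Rightarrow> 'v \<Rightarrow> 'v) \<Rightarrow> bool" where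
  "left_annihilator m \<longleftrightarrow> (\<exists>x. x \<noteq> 0 \<and> (\<forall>y. m x y = 0))"

definition right_annihilator :: "('v::ab_group_add \<Rightarrow> 'v \<Rightarrow> 'v) \<Rightarrow> bool" where
  "right_annihilator m \<longleftrightarrow> (\<exists>x. x \<noteq> 0 \<and> (\<forall>y. m y x = 0))"

definition noncommutative :: "('v::ab_group_add \<Rightarrow> 'v \<Rightarrow> 'v) \<Rightarrow> bool" where
  "noncommutative m \<longleftrightarrow> (\<exists>x y. m x y \<noteq> m y x)"

definition nilp_product :: "('v::ab_group_add \<Rightarrow> 'v \<Rightarrow> 'v) \<Rightarrow> bool" where
  "nilp_product m \<longleftrightarrow> (\<exists>x y. nilp m x \<and> nilp m y \<and> m x y \<noteq> 0)"

definition nilp_square :: "('v::ab_group_add \<Rightarrow> 'v \<Rightarrow> 'v) \<Rightarrow> bool" where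
  "nilp_square m \<longleftrightarrow> (\<exists>x. nilp m x \<and> m x x \<noteq> 0)"

definition nilp_cube :: "('v::ab_group_add \<Rightarrow> 'v \<Rightarrow> 'v) \<Rightarrow> bool" where
  "nilp_cube m \<longleftrightarrow> (\<exists>x. nilp m x \<and> m x (m x x) \<noteq> 0)"

section \<open>Traces and the transport of invariants\<close>

context four_dim_basis
begin

definition trace :: "('v \<Rightarrow> 'v) \<Rightarrow> complex" where
  "trace T = (\<Sum>k=1..4. coord k (T (f k)))"

lemma coord_linear:
  assumes "Vector_Spaces.linear scale scale T"
  shows "coord i (T x) = (\<Sum>j=1..4. coord j x * coord i (T (f j)))"
proof -
  interpret T: Vector_Spaces.linear scale scale T by fact
  have "coord i (T x) = coord i (T (\<Sum>j=1..4. scale (coord j x) (f j)))"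
    by (simp only: sum_coord)
  then show ?thesis
    by (simp only: T.sum T.scale coord_sum coord_scale)
qed

text \<open>In coordinates, the triple sum for \<phi> T \<phi>^-1 is reordered until \<phi>^-1 meets
  \<phi> and leaves a Kronecker delta.\<close>

lemma trace_conj:
  assumes "Vector_Spaces.linear scale scale \<phi>" "bij \<phi>" "Vector_Spaces.linear scale scale T"
    and conj: "\<And>x. T' (\<phi> x) = \<phi> (T x)"
  shows "trace T' = trace T"
proof -
  define \<psi> where "\<psi> = inv \<phi>"
  have \<phi>\<psi>: "\<phi> (\<psi> y) = y" and \<psi>\<phi>: "\<psi> (\<phi> x) = x" for x y
    using assms(2) by (simp_all add: \<psi>_def bij_is_surj bij_is_inj surj_f_inv_f)
  have \<psi>: "Vector_Spaces.linear scale scale \<psi>"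
    using assms(1) \<psi>\<phi> \<phi>\<psi> unfolding Vector_Spaces.linear_iff by metis
  have "trace T' = (\<Sum>i=1..4. coord i (\<phi> (T (\<psi> (f i)))))"
    unfolding trace_def using conj \<phi>\<psi> by metis
  also have "\<dots> = (\<Sum>i=1..4. \<Sum>k=1..4. (\<Sum>j=1..4. coord j (\<psi> (f i)) * coord k (T (f j))) * coord i (\<phi> (f k)))"
    by (subst coord_linear[OF assms(1)], subst coord_linear[OF assms(3)]) (rule refl)
  also have "\<dots> = (\<Sum>i=1..4. \<Sum>k=1..4. \<Sum>j=1..4. coord k (T (f j)) * (coord i (\<phi> (f k)) * coord j (\<psi> (f i))))"
    by (simp only: sum_distrib_right sum_distrib_left mult_ac)
  also have "\<dots> = (\<Sum>k=1..4. \<Sum>i=1..4. \<Sum>j=1..4. coord k (T (f j)) * (coord i (\<phi> (f k)) * coord j (\<psi> (f i))))"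
    by (rule sum.swap)
  also have "\<dots> = (\<Sum>k=1..4. \<Sum>j=1..4. \<Sum>i=1..4. coord k (T (f j)) * (coord i (\<phi> (f k)) * coord j (\<psi> (f i))))"
    by (rule sum.cong[OF refl], rule sum.swap)
  also have "\<dots> = (\<Sum>k=1..4. \<Sum>j=1..4. coord k (T (f j)) * coord j (\<psi> (\<phi> (f k))))"
    by (simp only: sum_distrib_left[symmetric] coord_linear[OF \<psi>, symmetric])
  also have "\<dots> = (\<Sum>k=1..4. \<Sum>j=1..4. if j = k then coord k (T (f k)) else 0)"
    unfolding \<psi>\<phi> by (intro sum.cong refl) (simp add: coord_basis del: One_nat_def)
  also have "\<dots> = trace T"
    unfolding trace_def by (intro sum.cong refl) simp
  finally show ?thesis .
qed

definition traces1 :: "('v \<Rightarrow> 'v \<Rightarrow> 'v) \<Rightarrow> 'v \<Rightarrow> complex \<times> complex \<times> complex" where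
  "traces1 m x = (trace (\<lambda>z. m x z), trace (\<lambda>z. m z x), trace (\<lambda>z. m x (m z x)))"

definition traces2 :: "('v \<Rightarrow> 'v \<Rightarrow> 'v) \<Rightarrow> 'v \<Rightarrow> 'v \<Rightarrow> complex \<times> complex \<times> complex \<times> complex" where
  "traces2 m x y = (trace (\<lambda>z. m x z), trace (\<lambda>z. m z x), trace (\<lambda>z. m x (m z x)), trace (\<lambda>z. m x (m z y)))"

definition idem_traces where
  "idem_traces m v \<longleftrightarrow> (\<exists>x. idem m x \<and> traces1 m x = v)"

definition orth_traces where
  "orth_traces m v \<longleftrightarrow> (\<exists>x y. orth m x y \<and> traces2 m x y = fst v \<and> traces2 m y x = snd v)"

text \<open>Each property is an equation or inequation between products, preserved by an injective
  homomorphism. The annihilators also need surjectivity, and the traces are conjugation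
  invariant.\<close>

lemma algebra_iso_invariants:
  assumes "algebra_iso scale m scale m'" "complex_algebra scale m"
  shows "three_orth m \<Longrightarrow> three_orth m'" "null_product_idem m \<Longrightarrow> null_product_idem m'"
    "square_zero m \<Longrightarrow> square_zero m'" "left_annihilator m \<Longrightarrow> left_annihilator m'"
    "right_annihilator m \<Longrightarrow> right_annihilator m'" "noncommutative m \<Longrightarrow> noncommutative m'"
    "nilp_product m \<Longrightarrow> nilp_product m'" "nilp_square m \<Longrightarrow> nilp_square m'"
    "nilp_cube m \<Longrightarrow> nilp_cube m'" "idem_traces m v \<Longrightarrow> idem_traces m' v"
    "orth_traces m w \<Longrightarrow> orth_traces m' w"
proof -
  obtain \<phi> where lin: "Vector_Spaces.linear scale scale \<phi>" and bij: "bij \<phi>"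
    and mult: "\<And>x y. m' (\<phi> x) (\<phi> y) = \<phi> (m x y)"
    using assms(1) by (auto simp: algebra_iso_def)
  interpret m: complex_algebra scale m by fact
  interpret \<phi>: Vector_Spaces.linear scale scale \<phi> by fact
  have eq: "\<phi> x = \<phi> y \<longleftrightarrow> x = y" for x y
    using bij by (simp add: bij_is_inj inj_eq)
  have zero: "\<phi> x = 0 \<longleftrightarrow> x = 0" for x
    using eq[of x 0] \<phi>.zero by simp
  have idem: "idem m' (\<phi> x) \<longleftrightarrow> idem m x" for x
    by (simp add: idem_def mult eq zero)
  have orth: "orth m' (\<phi> x) (\<phi> y) \<longleftrightarrow> orth m x y" for x y
    by (simp add: orth_def idem mult zero)
  have nilp: "nilp m' (\<phi> x) \<longleftrightarrow> nilp m x" for x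
    by (simp add: nilp_def mult zero)
  show "three_orth m \<Longrightarrow> three_orth m'"
    unfolding three_orth_def using orth by blast
  show "null_product_idem m \<Longrightarrow> null_product_idem m'"
    unfolding null_product_idem_def using idem mult zero by metis
  show "square_zero m \<Longrightarrow> square_zero m'"
    unfolding square_zero_def using mult zero by metis
  have surj: "\<exists>x. y = \<phi> x" for y
    using bij by (metis bij_pointE)
  show "left_annihilator m \<Longrightarrow> left_annihilator m'"
    unfolding left_annihilator_def using mult zero surj by metis
  show "right_annihilator m \<Longrightarrow> right_annihilator m'"
    unfolding right_annihilator_def using mult zero surj by metis
  show "noncommutative m \<Longrightarrow> noncommutative m'"
    unfolding noncommutative_def using mult eq by metis
  show "nilp_product m \<Longrightarrow> nilp_product m'"
    unfolding nilp_product_def using mult zero nilp by metis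
  show "nilp_square m \<Longrightarrow> nilp_square m'"
    unfolding nilp_square_def using mult zero nilp by metis
  show "nilp_cube m \<Longrightarrow> nilp_cube m'"
    unfolding nilp_cube_def using mult zero nilp by metis
  have lin2: "Vector_Spaces.linear scale scale (\<lambda>z. m x (m z y))" for x y
    by (simp add: Vector_Spaces.linear_iff m.mult_distribs vector_space_axioms)
  have tr: "trace (\<lambda>z. m' (\<phi> x) z) = trace (\<lambda>z. m x z)" "trace (\<lambda>z. m' z (\<phi> x)) = trace (\<lambda>z. m z x)"
    "trace (\<lambda>z. m' (\<phi> x) (m' z (\<phi> y))) = trace (\<lambda>z. m x (m z y))" for x y
    by (rule trace_conj[OF lin bij]; simp add: mult m.linear_left m.linear_right lin2)+
  show "idem_traces m v \<Longrightarrow> idem_traces m' v"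
    unfolding idem_traces_def traces1_def using idem tr by metis
  show "orth_traces m w \<Longrightarrow> orth_traces m' w"
    unfolding orth_traces_def traces2_def using orth tr by metis
qed

abbreviation "d \<equiv> d_mult scale f"

lemma sum_1_4: "(\<Sum>k=1..4::nat. g k) = (\<Sum>k\<leftarrow>[1, 2, 3, 4]. g k)" for g :: "nat \<Rightarrow> complex"
  unfolding atLeastAtMost_1_4 by simp

lemma d_traces:
  assumes "i \<in> {1..72}"
  shows "trace (\<lambda>z. d i p q x z) = trace_left (entry i p q) (\<lambda>k. coord k x)"
    "trace (\<lambda>z. d i p q z x) = trace_right (entry i p q) (\<lambda>k. coord k x)"
    "trace (\<lambda>z. d i p q x (d i p q z y)) = trace_both (entry i p q) (\<lambda>k. coord k x) (\<lambda>k. coord k y)"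
proof -
  have unit: "coord k (f l) = (if k = l then 1 else 0)" if "l \<in> {1..4}" "k \<in> {1..4}" for k l
    using coord_basis that by simp
  have "coord l (d i p q x (f l)) = coord_mult (entry i p q) (\<lambda>k. coord k x) (\<lambda>k. if k = l then 1 else 0) l"
    "coord l (d i p q (f l) x) = coord_mult (entry i p q) (\<lambda>k. if k = l then 1 else 0) (\<lambda>k. coord k x) l"
    "coord l (d i p q x (d i p q (f l) y)) = coord_mult (entry i p q) (\<lambda>k. coord k x)
       (coord_mult (entry i p q) (\<lambda>k. if k = l then 1 else 0) (\<lambda>k. coord k y)) l"
    if "l \<in> {1..4}" for l
    unfolding coord_d_mult[OF assms that]
    by (rule entry_cong[OF assms]; simp add: unit[OF that] coord_d_mult[OF assms]
        entry_cong[OF assms unit[OF that]] del: One_nat_def)+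
  note c = this
  show "trace (\<lambda>z. d i p q x z) = trace_left (entry i p q) (\<lambda>k. coord k x)"
    "trace (\<lambda>z. d i p q z x) = trace_right (entry i p q) (\<lambda>k. coord k x)"
    "trace (\<lambda>z. d i p q x (d i p q z y)) = trace_both (entry i p q) (\<lambda>k. coord k x) (\<lambda>k. coord k y)"
    unfolding trace_def trace_simps sum_1_4 using c by simp_all
qed

section \<open>Nilpotent and idempotent elements seen through the characters\<close>

context
  fixes i :: nat and p q :: complex
  assumes i: "i \<in> {2..72}"
begin

lemma i': "i \<in> {1..72}"
  using i by auto

lemma char_mult: "c \<in> characters i \<Longrightarrow> coord c (d i p q x y) = coord c x * coord c y"
  using coord_d_mult[OF i'] character_mult[OF i] characters_subset by (metis subsetD)

text \<open>A character turns a vanishing fourth power into a vanishing fourth power of a number;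
  conversely the common kernel consists of elements with vanishing fourth power.\<close>

lemma nilp_iff: "nilp (d i p q) x \<longleftrightarrow> (\<forall>c\<in>characters i. coord c x = 0)"
proof
  assume "nilp (d i p q) x"
  then have "d i p q x (d i p q x (d i p q x x)) = 0"
    by (simp add: nilp_def)
  then have "coord c x * (coord c x * (coord c x * coord c x)) = 0" if "c \<in> characters i" for c
    using char_mult[OF that] coord_zero by metis
  then show "\<forall>c\<in>characters i. coord c x = 0"
    by simp
next
  assume *: "\<forall>c\<in>characters i. coord c x = 0"
  let ?X = "\<lambda>k. coord k x"
  have "coord l (d i p q x (d i p q x (d i p q x x))) =
    coord_mult (entry i p q) ?X (coord_mult (entry i p q) ?X (coord_mult (entry i p q) ?X ?X)) l"
    if "l \<in> {1..4}" for l
  proof -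
    have "coord k (d i p q x (d i p q x x)) = coord_mult (entry i p q) ?X (coord_mult (entry i p q) ?X ?X) k"
      if "k \<in> {1..4}" for k
      unfolding coord_d_mult[OF i' that]
        by (rule entry_cong[OF i']) (simp_all only: coord_d_mult[OF i'])
    then show ?thesis
      unfolding coord_d_mult[OF i' that]
        by (intro entry_cong[OF i']) (simp_all only: coord_d_mult[OF i'])
  qed
  then show "nilp (d i p q) x"
    unfolding nilp_def using character_kernel_nil[OF i *]
    by (intro coord_eqI) (simp only: coord_zero)
qed

lemma char_idem: "d i p q x x = x \<Longrightarrow> c \<in> characters i \<Longrightarrow> coord c x = 0 \<or> coord c x = 1"
  using char_mult[of c x x] by (metis mult_cancel_left2)

text \<open>If all characters vanished, the idempotent would be nilpotent.\<close>

lemma idem_char: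
  assumes "idem (d i p q) x"
  shows "\<exists>c\<in>characters i. coord c x = 1"
proof (rule ccontr)
  assume contr: "\<not> ?thesis"
  have xx: "d i p q x x = x"
    using assms by (simp add: idem_def)
  have "nilp (d i p q) x"
    unfolding nilp_iff using contr char_idem[OF xx] by blast
  then have "x = 0"
    by (simp add: nilp_def xx)
  then show False
    using assms by (simp add: idem_def)
qed

lemma orth_char:
  assumes "orth (d i p q) x y" "c \<in> characters i"
  shows "coord c x = 0 \<or> coord c y = 0"
  using assms char_mult[OF assms(2), of x y] by (auto simp: orth_def coord_zero)

text \<open>A character kills a square-zero factor and hence the product, but some character is 1 on
  an idempotent.\<close>

lemma not_null_product_idem: "\<not> null_product_idem (d i p q)"
proof
  assume "null_product_idem (d i p q)"
  then obtain x y where xy: "d i p q x x = 0" "idem (d i p q) (d i p q x y)"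
    by (auto simp: null_product_idem_def)
  have "coord c x = 0" if "c \<in> characters i" for c
    using char_mult[OF that, of x x] xy(1) by (simp add: coord_zero)
  then show False
    using idem_char[OF xy(2)] char_mult by force
qed

lemma d_units:
  assumes "a \<in> characters i" "b \<in> characters i"
  shows "d i p q (f a) (f b) = (if a = b then f a else 0)"
proof (rule coord_eqI)
  fix l :: nat assume l: "l \<in> {1..4}"
  have ab: "a \<in> {1..4}" "b \<in> {1..4}"
    using assms characters_subset by blast+
  have "coord l (d i p q (f a) (f b)) = coord_mult (entry i p q) (\<lambda>k. if k = a then 1 else 0) (\<lambda>k. if k = b then 1 else 0) l"
    unfolding coord_d_mult[OF i' l] by (rule entry_cong[OF i']) (simp_all only: coord_basis ab)
  then show "coord l (d i p q (f a) (f b)) = coord l (if a = b then f a else 0)"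
    using character_units[OF i assms l] coord_basis[OF l ab(1)] by (auto simp: coord_zero)
qed

lemma orth_units:
  assumes "a \<in> characters i" "b \<in> characters i" "a \<noteq> b"
  shows "orth (d i p q) (f a) (f b)"
proof -
  have "f a \<noteq> 0" "f b \<noteq> 0"
    using assms(1,2) f_nonzero characters_subset by blast+
  then show ?thesis
    using assms d_units by (simp add: orth_def idem_def)
qed

end

section \<open>Evaluating the invariants on coordinate vectors\<close>

definition vec :: "(nat \<Rightarrow> complex) \<Rightarrow> 'v" where
  "vec X = (\<Sum>k=1..4. scale (X k) (f k))"

lemma coord_vec: "k \<in> {1..4} \<Longrightarrow> coord k (vec X) = X k"
  unfolding vec_def by (rule coord_sum_scale)

lemma vec_coord: "vec (\<lambda>k. coord k x) = x"
  unfolding vec_def by (rule sum_coord)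

lemma vec_eq_0_iff: "vec X = 0 \<longleftrightarrow> (\<forall>k\<in>{1..4}. X k = 0)"
  using coord_vec coord_eqI[of "vec X" 0] by (metis coord_zero)

lemma d_vec:
  assumes "i \<in> {1..72}"
  shows "d i p q (vec X) (vec Y) = vec (coord_mult (entry i p q) X Y)"
proof (rule coord_eqI)
  fix l :: nat assume l: "l \<in> {1..4}"
  show "coord l (d i p q (vec X) (vec Y)) = coord l (vec (coord_mult (entry i p q) X Y))"
    unfolding coord_d_mult[OF assms l] coord_vec[OF l]
    by (rule entry_cong[OF assms]) (simp_all only: coord_vec)
qed

lemma ex_vec: "(\<exists>x. P x) \<longleftrightarrow> (\<exists>X. P (vec X))"
  by (metis vec_coord)

lemma all_vec: "(\<forall>x. P x) \<longleftrightarrow> (\<forall>X. P (vec X))"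
  by (metis vec_coord)

lemma left_annihilator_d:
  assumes "i \<in> {1..72}"
  shows "left_annihilator (d i p q) \<longleftrightarrow> (\<exists>X. (\<exists>k\<in>{1..4}. X k \<noteq> 0) \<and>
    (\<forall>Y. \<forall>l\<in>{1..4}. coord_mult (entry i p q) X Y l = 0))"
  unfolding left_annihilator_def
  by (subst ex_vec, subst all_vec) (simp only: d_vec[OF assms] vec_eq_0_iff bex_simps ball_simps simp_thms)

lemma right_annihilator_d:
  assumes "i \<in> {1..72}"
  shows "right_annihilator (d i p q) \<longleftrightarrow> (\<exists>X. (\<exists>k\<in>{1..4}. X k \<noteq> 0) \<and>
    (\<forall>Y. \<forall>l\<in>{1..4}. coord_mult (entry i p q) Y X l = 0))"
  unfolding right_annihilator_def
  by (subst ex_vec, subst all_vec) (simp only: d_vec[OF assms] vec_eq_0_iff bex_simps ball_simps simp_thms)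

abbreviation unit_vector :: "nat \<Rightarrow> nat \<Rightarrow> complex" where
  "unit_vector a \<equiv> (\<lambda>k. if k = a then 1 else 0)"

lemma vec_unit: "a \<in> {1..4} \<Longrightarrow> vec (unit_vector a) = f a"
  by (rule coord_eqI) (simp only: coord_vec coord_basis)

lemma annihilators:
  "left_annihilator (d 5 p q)" "left_annihilator (d 7 p q)" "\<not> left_annihilator (d 3 p q)"
  "\<not> left_annihilator (d 4 p q)" "\<not> left_annihilator (d 6 p q)"
  "right_annihilator (d 4 p q)" "right_annihilator (d 7 p q)" "\<not> right_annihilator (d 3 p q)"
  "\<not> right_annihilator (d 5 p q)" "\<not> right_annihilator (d 6 p q)"
proof -
  have left: "left_annihilator (d i p q)"
    if "\<forall>Y. \<forall>l\<in>{1..4}. coord_mult (entry i p q) (unit_vector 1) Y l = 0" "i \<in> {1..72}" for i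
    unfolding left_annihilator_d[OF that(2)] using that(1) by (intro exI[of _ "unit_vector 1"]) auto
  have right: "right_annihilator (d i p q)"
    if "\<forall>Y. \<forall>l\<in>{1..4}. coord_mult (entry i p q) Y (unit_vector 1) l = 0" "i \<in> {1..72}" for i
    unfolding right_annihilator_d[OF that(2)] using that(1)
      by (intro exI[of _ "unit_vector 1"]) auto
  \<comment> \<open>Multiplication by f1 + f2 + f3 + f4 alone already detects every nonzero element
    in the entries without annihilator; the mirrored test is used below.\<close>
  have not_left: "\<not> left_annihilator (d i p q)"
    if "\<And>X. \<forall>l\<in>{1..4}. coord_mult (entry i p q) X (\<lambda>_. 1) l = 0 \<Longrightarrow> \<forall>k\<in>{1..4}. X k = 0" "i \<in> {1..72}" for i
    unfolding left_annihilator_d[OF that(2)] using that(1) by blast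
  have not_right: "\<not> right_annihilator (d i p q)"
    if "\<And>X. \<forall>l\<in>{1..4}. coord_mult (entry i p q) (\<lambda>_. 1) X l = 0 \<Longrightarrow> \<forall>k\<in>{1..4}. X k = 0" "i \<in> {1..72}" for i
    unfolding right_annihilator_d[OF that(2)] using that(1) by blast
  note simps = atLeastAtMost_1_4 ball_simps coord_mult_simps
  show "left_annihilator (d 5 p q)" "left_annihilator (d 7 p q)"
    by (rule left; (simp only: simps)?; simp)+
  show "right_annihilator (d 4 p q)" "right_annihilator (d 7 p q)"
    by (rule right; (simp only: simps)?; simp)+
  show "\<not> left_annihilator (d 3 p q)" "\<not> left_annihilator (d 4 p q)" "\<not> left_annihilator (d 6 p q)"
    by (rule not_left; (simp only: simps)?; auto)+
  show "\<not> right_annihilator (d 3 p q)" "\<not> right_annihilator (d 5 p q)" "\<not> right_annihilator (d 6 p q)"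
    by (rule not_right; (simp only: simps)?; auto)+
qed

text \<open>Among the entries 3 to 7, only 3 and 6 have neither a left nor a right annihilator;
  commutativity tells them apart.\<close>

lemma noncommutative_3: "noncommutative (d 3 p q)"
proof -
  have "vec (coord_mult (entry 3 p q) (unit_vector 2) (unit_vector 1)) \<noteq> 0"
    "vec (coord_mult (entry 3 p q) (unit_vector 1) (unit_vector 2)) = 0"
    unfolding vec_eq_0_iff atLeastAtMost_1_4 by (simp only: ball_simps coord_mult_simps; simp)+
  then have "d 3 p q (vec (unit_vector 2)) (vec (unit_vector 1)) \<noteq> 0"
    "d 3 p q (vec (unit_vector 1)) (vec (unit_vector 2)) = 0"
    using d_vec[of 3] by simp_all
  then show ?thesis
    unfolding noncommutative_def by metis
qed

lemma not_noncommutative_6: "\<not> noncommutative (d 6 p q)"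
proof -
  have "coord_mult (entry 6 p q) X Y l = coord_mult (entry 6 p q) Y X l" for X Y l
    by (simp only: coord_mult_simps) (simp add: algebra_simps)
  then have "d 6 p q (vec X) (vec Y) = d 6 p q (vec Y) (vec X)" for X Y
    using d_vec[of 6] by (simp add: vec_def)
  then show ?thesis
    unfolding noncommutative_def using vec_coord by metis
qed

lemma null_product_idem_1: "null_product_idem (d 1 p q)"
proof -
  have "vec (coord_mult (entry 1 p q) (unit_vector 2) (unit_vector 2)) = 0"
    "vec (coord_mult (entry 1 p q) (unit_vector 3) (unit_vector 3)) = 0"
    unfolding vec_eq_0_iff atLeastAtMost_1_4 by (simp only: ball_simps coord_mult_simps; simp)+
  then have 0: "d 1 p q (f 2) (f 2) = 0" "d 1 p q (f 3) (f 3) = 0"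
    using d_vec[of 1 p q "unit_vector 2" "unit_vector 2"] d_vec[of 1 p q "unit_vector 3" "unit_vector 3"]
      vec_unit[of 2] vec_unit[of 3] by simp_all
  have eq: "vec X = f 1" if "X 1 = 1" "X 2 = 0" "X 3 = 0" "X 4 = 0" for X
  proof (rule coord_eqI)
    fix k :: nat assume k: "k \<in> {1..4}"
    then have "X k = (if k = 1 then 1 else 0)"
      using that unfolding atLeastAtMost_1_4 by auto
    then show "coord k (vec X) = coord k (f 1)"
      using coord_vec[OF k] coord_basis[OF k, of 1] by simp
  qed
  have "vec (coord_mult (entry 1 p q) (unit_vector 2) (unit_vector 3)) = f 1"
    "vec (coord_mult (entry 1 p q) (unit_vector 1) (unit_vector 1)) = f 1"
    by (rule eq; simp only: coord_mult_simps; simp)+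
  then have "d 1 p q (f 2) (f 3) = f 1" "d 1 p q (f 1) (f 1) = f 1"
    using d_vec[of 1 p q "unit_vector 2" "unit_vector 3"] d_vec[of 1 p q "unit_vector 1" "unit_vector 1"]
      vec_unit[of 1] vec_unit[of 2] vec_unit[of 3] by simp_all
  then show ?thesis
    unfolding null_product_idem_def idem_def using 0 f_nonzero[of 1]
      by (intro exI[of _ "f 2"] exI[of _ "f 3"]) simp
qed

lemma three_orth_low:
  assumes "i \<in> {2..7}"
  shows "three_orth (d i p q)"
proof -
  have "i \<in> {2..72}" "{2, 3, 4} \<subseteq> characters i"
    using assms by (auto simp: characters_def)
  then show ?thesis
    unfolding three_orth_def using orth_units[of i 2 3] orth_units[of i 2 4] orth_units[of i 3 4]
    by (intro exI[of _ "f 2"] exI[of _ "f 3"] exI[of _ "f 4"]) simp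
qed

text \<open>Each idempotent has a character with value 1, and orthogonal ones need different
  characters; at most two are available.\<close>

lemma not_three_orth:
  assumes "i \<in> {8..72}"
  shows "\<not> three_orth (d i p q)"
proof
  have i: "i \<in> {2..72}" and chars: "characters i \<subseteq> {3, 4}"
    using assms by (auto simp: characters_def)
  assume "three_orth (d i p q)"
  then obtain x y z where xyz: "orth (d i p q) x y" "orth (d i p q) x z" "orth (d i p q) y z"
    by (auto simp: three_orth_def)
  have "idem (d i p q) x" "idem (d i p q) y" "idem (d i p q) z"
    using xyz by (simp_all add: orth_def)
  then obtain a b c where abc: "a \<in> characters i" "b \<in> characters i" "c \<in> characters i"
    "coord a x = 1" "coord b y = 1" "coord c z = 1"
    using idem_char[OF i] by metis
  have "a \<noteq> b" "a \<noteq> c" "b \<noteq> c"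
    using orth_char[OF i xyz(1) abc(1)] orth_char[OF i xyz(2) abc(1)] orth_char[OF i xyz(3) abc(2)] abc
      by auto
  then show False
    using chars abc(1-3) by blast
qed

lemma square_zero_low:
  assumes "i \<in> {3..7}"
  shows "square_zero (d i p q)"
proof -
  have "i \<in> {3, 4, 5, 6, 7}"
    using assms by auto
  then have "\<forall>k\<in>{1..4}. coord_mult (entry i p q) (unit_vector 1) (unit_vector 1) k = 0"
    unfolding atLeastAtMost_1_4
    by (elim insertE emptyE; hypsubst; simp only: ball_simps coord_mult_simps; simp)
  then have "d i p q (f 1) (f 1) = 0"
    using d_vec[of i p q "unit_vector 1" "unit_vector 1"] vec_unit[of 1] vec_eq_0_iff assms by simp
  then show ?thesis
    unfolding square_zero_def using f_nonzero[of 1] by auto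
qed

lemma not_square_zero_2: "\<not> square_zero (d 2 p q)"
proof
  assume "square_zero (d 2 p q)"
  then obtain x where x: "x \<noteq> 0" "d 2 p q x x = 0"
    by (auto simp: square_zero_def)
  have "coord c x = 0" if "c \<in> {1..4}" for c
    using char_mult[of 2 c p q x x] x(2) that unfolding atLeastAtMost_1_4
    by (simp add: characters_def coord_zero)
  then show False
    using x(1) coord_eqI[of x 0] by (simp add: coord_zero)
qed

definition of_nat3 :: "nat \<times> nat \<times> nat \<Rightarrow> complex \<times> complex \<times> complex" where
  "of_nat3 u = (case u of (a, b, c) \<Rightarrow> (of_nat a, of_nat b, of_nat c))"

definition of_nat4 :: "nat \<times> nat \<times> nat \<times> nat \<Rightarrow> complex \<times> complex \<times> complex \<times> complex" where
  "of_nat4 u = (case u of (a, b, c, e) \<Rightarrow> (of_nat a, of_nat b, of_nat c, of_nat e))"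

lemma of_nat3_eq_iff: "of_nat3 u = of_nat3 v \<longleftrightarrow> u = v"
  by (cases u; cases v) (simp add: of_nat3_def)

lemma of_nat4_eq_iff: "of_nat4 u = of_nat4 v \<longleftrightarrow> u = v"
  by (cases u; cases v) (simp add: of_nat4_def)

text \<open>Every idempotent has fourth coordinate 1, and the traces see nothing else, so the value
  is a true invariant although idempotents are not unique.\<close>

lemma idem_traces_iff:
  assumes "(i, u) \<in> set dims1" "i \<in> {35..72}"
  shows "idem_traces (d i p q) v \<longleftrightarrow> v = of_nat3 u"
proof -
  have i: "i \<in> {2..72}" "i \<in> {1..72}" and chars: "characters i = {4}"
    using assms(2) by (auto simp: characters_def)
  obtain a b c where u: "u = (a, b, c)"
    by (cases u)
  have traces: "traces1 (d i p q) x = of_nat3 u" if "coord 4 x = 1" for x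
    using dims1_traces[OF assms(1)[unfolded u]] that
    unfolding traces1_def d_traces[OF i(2)] by (simp add: of_nat3_def u)
  have "coord 4 x = 1" if "idem (d i p q) x" for x
    using idem_char[OF i(1) that] chars by auto
  moreover have "idem (d i p q) (f 4)"
    using d_mult_f4[OF i(2)] f_nonzero[of 4] by (simp add: idem_def)
  moreover have "coord 4 (f 4) = 1"
    using coord_basis[of 4 4] by simp
  ultimately show ?thesis
    unfolding idem_traces_def using traces by metis
qed

text \<open>The two characters single out one member each of an orthogonal pair, in either
  order.\<close>

lemma orth_traces_iff:
  assumes "(i, u, v) \<in> set dims2" "i \<in> {8..34}"
  shows "orth_traces (d i p q) w \<longleftrightarrow> w = (of_nat4 u, of_nat4 v) \<or> w = (of_nat4 v, of_nat4 u)"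
proof -
  have i: "i \<in> {2..72}" "i \<in> {1..72}" and chars: "characters i = {3, 4}"
    using assms(2) by (auto simp: characters_def)
  obtain a b c e where u: "u = (a, b, c, e)"
    by (cases u)
  obtain a' b' c' e' where v: "v = (a', b', c', e')"
    by (cases v)
  have traces: "traces2 (d i p q) x y = of_nat4 u" "traces2 (d i p q) y x = of_nat4 v"
    if "coord 3 x = 1" "coord 4 x = 0" "coord 3 y = 0" "coord 4 y = 1" for x y
    using dims2_traces[OF assms(1)[unfolded u v]] that
    unfolding traces2_def d_traces[OF i(2)] by (simp_all add: of_nat4_def u v)
  have cases: "coord 3 x = 1 \<and> coord 4 x = 0 \<and> coord 3 y = 0 \<and> coord 4 y = 1 \<or>
      coord 3 y = 1 \<and> coord 4 y = 0 \<and> coord 3 x = 0 \<and> coord 4 x = 1"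
    if "orth (d i p q) x y" for x y
  proof -
    have "idem (d i p q) x" "idem (d i p q) y"
      using that by (simp_all add: orth_def)
    from this[THEN idem_char[OF i(1)]]
    have "coord 3 x = 1 \<or> coord 4 x = 1" "coord 3 y = 1 \<or> coord 4 y = 1"
      using chars by auto
    moreover have "coord 3 x = 0 \<or> coord 3 y = 0" "coord 4 x = 0 \<or> coord 4 y = 0"
      using orth_char[OF i(1) that] chars by auto
    ultimately show ?thesis
      by auto
  qed
  have units: "orth (d i p q) (f 3) (f 4)" "orth (d i p q) (f 4) (f 3)"
    using orth_units[OF i(1)] chars by auto
  have coords: "coord 3 (f 3) = 1" "coord 4 (f 3) = 0" "coord 3 (f 4) = 0" "coord 4 (f 4) = 1"
    using coord_basis[of 3 3] coord_basis[of 4 3] coord_basis[of 3 4] coord_basis[of 4 4]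
      by simp_all
  show ?thesis
  proof
    assume "orth_traces (d i p q) w"
    then obtain x y where xy: "orth (d i p q) x y" "w = (traces2 (d i p q) x y, traces2 (d i p q) y x)"
      unfolding orth_traces_def by (metis prod.collapse)
    then show "w = (of_nat4 u, of_nat4 v) \<or> w = (of_nat4 v, of_nat4 u)"
      using cases[OF xy(1)] traces[of x y] traces[of y x] by auto
  next
    assume "w = (of_nat4 u, of_nat4 v) \<or> w = (of_nat4 v, of_nat4 u)"
    then show "orth_traces (d i p q) w"
    proof
      assume w: "w = (of_nat4 u, of_nat4 v)"
      show ?thesis
        unfolding orth_traces_def
        by (intro exI[of _ "f 3"] exI[of _ "f 4"]) (simp add: units traces[OF coords] w)
    next
      assume w: "w = (of_nat4 v, of_nat4 u)"
      show ?thesis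
        unfolding orth_traces_def
        by (intro exI[of _ "f 4"] exI[of _ "f 3"]) (simp add: units traces[OF coords] w)
    qed
  qed
qed

lemma not_orth_traces:
  assumes "i \<in> {35..72}"
  shows "\<not> orth_traces (d i p q) w"
proof
  have i: "i \<in> {2..72}" and chars: "characters i = {4}"
    using assms by (auto simp: characters_def)
  assume "orth_traces (d i p q) w"
  then obtain x y where xy: "orth (d i p q) x y"
    by (auto simp: orth_traces_def)
  then have "idem (d i p q) x" "idem (d i p q) y"
    by (simp_all add: orth_def)
  then have "coord 4 x = 1" "coord 4 y = 1"
    using idem_char[OF i] chars by auto
  then show False
    using orth_char[OF i xy, of 4] chars by simp
qed

lemma nilp_vec:
  assumes "i \<in> {2..72}"
  shows "nilp (d i p q) (vec X) \<longleftrightarrow> (\<forall>c\<in>characters i. X c = 0)"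
  unfolding nilp_iff[OF assms] using coord_vec characters_subset by (metis subsetD)

lemma nilp_product_d:
  assumes i: "i \<in> {8, 9} \<union> {35..52}"
  shows "nilp_product (d i p q)"
proof -
  have i72: "i \<in> {2..72}" "i \<in> {1..72}"
    using i by auto
  \<comment> \<open>Indices of nilpotent basis vectors with nonzero product: f2 f2 in 8 and 9, f1 f3
    in 39 to 44, 51 and 52, and f3 f3 in the rest.\<close>
  define a b :: nat where "a = (if i \<le> 9 then 2 else if i \<in> {39..44} \<union> {51, 52} then 1 else 3)"
    and "b = (if i \<le> 9 then 2 else 3)"
  have "\<exists>k\<in>{1..4}. coord_mult (entry i p q) (unit_vector a) (unit_vector b) k \<noteq> 0"
  proof -
    have "i \<in> {1..72} - {1..7} - {10..34} - {53..72}"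
      using i by auto
    then show ?thesis
      unfolding atLeastAtMost_1_72 atLeastAtMost_1_4 Diff_iff a_def b_def
      by (elim conjE insertE emptyE; hypsubst; (simp only: bex_simps coord_mult_simps)?; simp)
  qed
  moreover have "nilp (d i p q) (vec (unit_vector a))" "nilp (d i p q) (vec (unit_vector b))"
    unfolding nilp_vec[OF i72(1)] using i by (auto simp: characters_def a_def b_def)
  ultimately show "nilp_product (d i p q)"
    unfolding nilp_product_def using d_vec[OF i72(2)] vec_eq_0_iff by metis
qed

lemma not_nilp_product_d:
  assumes i: "i \<in> {33, 34} \<union> {53..72}"
  shows "\<not> nilp_product (d i p q)"
proof -
  have i72: "i \<in> {2..72}" "i \<in> {1..72}"
    using i by auto
  have "coord_mult (entry i p q) X Y k = 0"
    if "\<forall>c\<in>characters i. X c = 0" "\<forall>c\<in>characters i. Y c = 0" "k \<in> {1..4}" for X Y k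
  proof -
    have "i \<in> {1..72} - {1..32} - {35..52}"
      using i by auto
    then have "(\<forall>c\<in>characters i. X c = 0) \<and> (\<forall>c\<in>characters i. Y c = 0) \<longrightarrow>
      (\<forall>k\<in>{1..4}. coord_mult (entry i p q) X Y k = 0)"
      unfolding atLeastAtMost_1_72 atLeastAtMost_1_4 Diff_iff
      by (elim conjE insertE emptyE; hypsubst; (simp only: char_simps coord_mult_simps)?; simp)
    then show ?thesis
      using that by blast
  qed
  then have "d i p q (vec X) (vec Y) = 0" if "nilp (d i p q) (vec X)" "nilp (d i p q) (vec Y)" for X Y
    using that unfolding nilp_vec[OF i72(1)] d_vec[OF i72(2)] vec_eq_0_iff by blast
  then show "\<not> nilp_product (d i p q)"
    unfolding nilp_product_def by (metis vec_coord)
qed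

lemma nilp_cube_d:
  assumes i: "i \<in> {35, 36}"
  shows "nilp_cube (d i p q)"
proof -
  have i72: "i \<in> {2..72}" "i \<in> {1..72}"
    using i by auto
  have "coord_mult (entry i p q) (unit_vector 3) (coord_mult (entry i p q) (unit_vector 3) (unit_vector 3)) 2 \<noteq> 0"
    using i by (elim insertE emptyE; hypsubst; simp only: coord_mult_simps; simp)
  then have "d i p q (vec (unit_vector 3)) (d i p q (vec (unit_vector 3)) (vec (unit_vector 3))) \<noteq> 0"
    unfolding d_vec[OF i72(2)] vec_eq_0_iff atLeastAtMost_1_4 by blast
  moreover have "nilp (d i p q) (vec (unit_vector 3))"
    unfolding nilp_vec[OF i72(1)] using i by (auto simp: characters_def)
  ultimately show "nilp_cube (d i p q)"
    unfolding nilp_cube_def by blast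
qed

lemma not_nilp_cube_d:
  assumes i: "i \<in> {37, 38, 51, 52}"
  shows "\<not> nilp_cube (d i p q)"
proof -
  have i72: "i \<in> {2..72}" "i \<in> {1..72}" and chars: "characters i = {4}"
    using i by (auto simp: characters_def)
  have "\<forall>k\<in>{1..4}. coord_mult (entry i p q) X (coord_mult (entry i p q) X X) k = 0" if "X 4 = 0" for X
    using i that unfolding atLeastAtMost_1_4
    by (elim insertE emptyE; hypsubst; simp only: ball_simps coord_mult_simps; simp)
  then have "d i p q (vec X) (d i p q (vec X) (vec X)) = 0" if "nilp (d i p q) (vec X)" for X
    using that unfolding nilp_vec[OF i72(1)] d_vec[OF i72(2)] vec_eq_0_iff chars by blast
  then show "\<not> nilp_cube (d i p q)"
    unfolding nilp_cube_def by (metis vec_coord)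
qed

lemma nilp_square_d:
  assumes i: "i \<in> {37, 38}"
  shows "nilp_square (d i p q)"
proof -
  have i72: "i \<in> {2..72}" "i \<in> {1..72}"
    using i by auto
  have "coord_mult (entry i p q) (unit_vector 3) (unit_vector 3) 2 \<noteq> 0"
    using i by (elim insertE emptyE; hypsubst; simp only: coord_mult_simps; simp)
  then have "d i p q (vec (unit_vector 3)) (vec (unit_vector 3)) \<noteq> 0"
    unfolding d_vec[OF i72(2)] vec_eq_0_iff atLeastAtMost_1_4 by blast
  moreover have "nilp (d i p q) (vec (unit_vector 3))"
    unfolding nilp_vec[OF i72(1)] using i by (auto simp: characters_def)
  ultimately show "nilp_square (d i p q)"
    unfolding nilp_square_def by blast
qed

lemma not_nilp_square_d:
  assumes i: "i \<in> {51, 52}"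
  shows "\<not> nilp_square (d i p q)"
proof -
  have i72: "i \<in> {2..72}" "i \<in> {1..72}" and chars: "characters i = {4}"
    using i by (auto simp: characters_def)
  have "\<forall>k\<in>{1..4}. coord_mult (entry i p q) X X k = 0" if "X 4 = 0" for X
    using i that unfolding atLeastAtMost_1_4
    by (elim insertE emptyE; hypsubst; simp only: ball_simps coord_mult_simps; simp)
  then have "d i p q (vec X) (vec X) = 0" if "nilp (d i p q) (vec X)" for X
    using that unfolding nilp_vec[OF i72(1)] d_vec[OF i72(2)] vec_eq_0_iff chars by blast
  then show "\<not> nilp_square (d i p q)"
    unfolding nilp_square_def by (metis vec_coord)
qed

text \<open>The matrix algebra and the diagonal algebra are split off first. The others are ordered
  by the number of orthogonal idempotents, then by traces or annihilators, and the remaining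
  coincidences by products and powers of nilpotent elements.\<close>

lemma d_not_iso_less:
  assumes "i \<in> {1..72}" "j \<in> {1..72}" "i < j"
  shows "\<not> algebra_iso scale (d i p q) scale (d j p' q')"
proof
  assume iso: "algebra_iso scale (d i p q) scale (d j p' q')"
  note fwd = algebra_iso_invariants[OF iso d_mult_algebra[OF assms(1)]]
    and bwd = algebra_iso_invariants[OF algebra_iso_sym[OF iso] d_mult_algebra[OF assms(2)]]
  consider "i = 1" | "i = 2" "j \<in> {3..7}" | "i \<in> {2..7}" "j \<in> {8..72}" | "i \<in> {3..7}" "j \<in> {3..7}"
    | "i \<in> {8..34}" "j \<in> {35..72}" | "i \<in> {8..34}" "j \<in> {8..34}" | "i \<in> {35..72}" "j \<in> {35..72}"
    using assms unfolding atLeastAtMost_iff by linarith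
  then show False
  proof cases
    case 1
    then show False
      using fwd(2) null_product_idem_1 not_null_product_idem[of j] assms by auto
  next
    case 2
    then show False
      using bwd(3) square_zero_low not_square_zero_2 by blast
  next
    case 3
    then show False
      using fwd(1) three_orth_low not_three_orth by blast
  next
    case 4
    then have "i \<in> {3, 4, 5, 6, 7}" "j \<in> {3, 4, 5, 6, 7}"
      by auto
    then show False
      using assms(3) fwd(4,5,6) bwd(4,5,6) annihilators noncommutative_3 not_noncommutative_6
      by (elim insertE emptyE) simp_all
  next
    case 5
    obtain u v where "(i, u, v) \<in> set dims2"
      using ex_dims2[OF 5(1)] by blast
    then have "orth_traces (d i p q) (of_nat4 u, of_nat4 v)"
      using orth_traces_iff[OF _ 5(1)] by blast
    then show False
      using fwd(11) not_orth_traces[OF 5(2)] by blast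
  next
    case 6
    obtain u v u' v' where uv: "(i, u, v) \<in> set dims2" "(j, u', v') \<in> set dims2"
      using ex_dims2[OF 6(1)] ex_dims2[OF 6(2)] by blast
    have "orth_traces (d j p' q') (of_nat4 u, of_nat4 v)"
      using fwd(11) orth_traces_iff[OF uv(1) 6(1)] by blast
    then have "u = u' \<and> v = v' \<or> u = v' \<and> v = u'"
      unfolding orth_traces_iff[OF uv(2) 6(2)] by (simp add: of_nat4_eq_iff)
    then have "{i, j} = {8, 33} \<or> {i, j} = {9, 34}"
      using bspec[OF bspec[OF dims2_distinct uv(1), unfolded prod.case] uv(2), unfolded prod.case] assms(3)
        by blast
    then have "i \<in> {8, 9} \<union> {35..52}" "j \<in> {33, 34} \<union> {53..72}"
      using assms(3) by (auto simp: doubleton_eq_iff)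
    then show False
      using fwd(7) nilp_product_d not_nilp_product_d by blast
  next
    case 7
    obtain a b c a' b' c' where u: "(i, a, b, c) \<in> set dims1" "(j, a', b', c') \<in> set dims1"
      using ex_dims1[OF 7(1)] ex_dims1[OF 7(2)] by blast
    have "idem_traces (d j p' q') (of_nat3 (a, b, c))"
      using fwd(10) idem_traces_iff[OF u(1) 7(1)] by blast
    then have "(a, b, c) = (a', b', c')"
      unfolding idem_traces_iff[OF u(2) 7(2)] of_nat3_eq_iff .
    then have "i \<le> 52 \<and> j \<ge> 53 \<or> i \<in> {35, 37, 51} \<and> j \<in> {35, 37, 51} \<or> i \<in> {36, 38, 52} \<and> j \<in> {36, 38, 52}"
      using bspec[OF bspec[OF dims1_distinct u(1), unfolded prod.case] u(2), unfolded prod.case] assms(3)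
      by auto
    then consider "i \<le> 52" "j \<ge> 53" | "i \<in> {35, 36}" "j \<in> {37, 38, 51, 52}" | "i \<in> {37, 38}" "j \<in> {51, 52}"
      using assms(3) by auto
    then show False
    proof cases
      case 1
      then have "i \<in> {8, 9} \<union> {35..52}" "j \<in> {33, 34} \<union> {53..72}"
        using 7 by auto
      then show False
        using fwd(7) nilp_product_d not_nilp_product_d by blast
    next
      case 2
      then show False
        using fwd(9) nilp_cube_d not_nilp_cube_d by blast
    next
      case 3
      then show False
        using fwd(8) nilp_square_d not_nilp_square_d by blast
    qed
  qed
qed

lemma d_not_iso:
  assumes "i \<in> {1..72}" "j \<in> {1..72}" "i \<noteq> j"
  shows "\<not> algebra_iso scale (d i p q) scale (d j p' q')"
  using d_not_iso_less[OF assms(1,2)] d_not_iso_less[OF assms(2,1)] algebra_iso_sym assms(3)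
  by (metis linorder_neqE_nat)

end

section \<open>The parameters of the families 37 and 38\<close>

context four_dim_basis
begin

lemma has_table_sum_of_terms:
  assumes "valid_terms ts" "a \<in> {1..4}" "b \<in> {1..4}"
  shows "sum_of_terms scale f ts (f a) (f b) =
    (\<Sum>(c, i, j, k)\<leftarrow>ts. if i = a \<and> j = b then scale c (f k) else 0)"
  using assms(1)
proof (induction ts)
  case (Cons t ts)
  obtain c i j k where t: "t = (c, i, j, k)"
    by (cases t)
  have ij: "i \<in> {1..4}" "j \<in> {1..4}" and ts: "valid_terms ts"
    using Cons.prems by (auto simp: valid_terms_def t)
  have "psi scale f i j k (f a) (f b) = (if i = a \<and> j = b then f k else 0)"
    using psi_basis[OF assms(2,3) ij] by auto
  then show ?case
    using Cons.IH[OF ts] by (simp add: sum_of_terms_def t)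
qed (simp add: sum_of_terms_def)

lemma d_table:
  assumes "i \<in> {1..72}"
  shows "\<forall>a\<in>{1, 2, 3, 4}. \<forall>b\<in>{1, 2, 3, 4}. d i p q (f a) (f b) =
    (\<Sum>(c, i, j, k)\<leftarrow>entry i p q. if i = a \<and> j = b then scale c (f k) else 0)"
  using has_table_sum_of_terms[OF valid_entry[OF assms], folded d_mult_entry]
  unfolding atLeastAtMost_1_4 by blast

lemma d_products_37_38:
  assumes "i \<in> {37, 38}"
  shows "d i p q (f 1) (f 1) = 0" "d i p q (f 1) (f 2) = 0" "d i p q (f 1) (f 3) = scale p (f 2)"
    "d i p q (f 2) (f 1) = 0" "d i p q (f 2) (f 2) = 0" "d i p q (f 2) (f 3) = 0"
    "d i p q (f 3) (f 1) = scale q (f 2)" "d i p q (f 3) (f 2) = 0" "d i p q (f 3) (f 3) = f 2" "d i p q (f 4) (f 4) = f 4"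
    "d i p q (f 4) (f 1) = (if i = 37 then f 1 else 0)" "d i p q (f 1) (f 4) = (if i = 37 then f 1 else 0)"
    "d i p q (f 4) (f 2) = (if i = 37 then f 2 else 0)" "d i p q (f 2) (f 4) = (if i = 37 then f 2 else 0)"
    "d i p q (f 4) (f 3) = (if i = 37 then f 3 else 0)" "d i p q (f 3) (f 4) = (if i = 37 then f 3 else 0)"
  using assms d_table[OF subsetD[OF _ assms], of p q]
  by (elim insertE emptyE; hypsubst; simp only: insert_subset empty_subsetI atLeastAtMost_iff
      ball_simps entry_eqs list.map sum_list.Cons sum_list.Nil prod.case rel_simps refl if_True
      if_False simp_thms; simp)+

text \<open>f2 annihilates the radical and receives all its products, so multiplication on the
  radical is a bilinear form in the coordinates 1 and 3.\<close>

lemma d_37_38_nilp_product: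
  assumes "i \<in> {37, 38}" "coord 4 x = 0" "coord 4 y = 0"
  shows "d i p q x y =
    scale (p * coord 1 x * coord 3 y + q * coord 3 x * coord 1 y + coord 3 x * coord 3 y) (f 2)"
proof -
  have i: "i \<in> {1..72}"
    using assms(1) by auto
  interpret d: complex_algebra scale "d i p q"
    by (rule d_mult_algebra[OF i])
  have expand: "u = scale (coord 1 u) (f 1) + scale (coord 2 u) (f 2) + scale (coord 3 u) (f 3)"
    if "coord 4 u = 0" for u
    using sum_coord[of u] that unfolding atLeastAtMost_1_4 by (simp add: add.assoc)
  have "d i p q x y = d i p q (scale (coord 1 x) (f 1) + scale (coord 2 x) (f 2) + scale (coord 3 x) (f 3))
     (scale (coord 1 y) (f 1) + scale (coord 2 y) (f 2) + scale (coord 3 y) (f 3))"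
    using expand assms(2,3) by metis
  also have "\<dots> = scale (p * coord 1 x * coord 3 y + q * coord 3 x * coord 1 y + coord 3 x * coord 3 y) (f 2)"
    unfolding d.mult_distribs d_products_37_38[OF assms(1)]
    by (simp add: scale_left_distrib scale_right_distrib mult_ac add_ac)
  finally show ?thesis .
qed

end

text \<open>Here (a, b) and (c, d) are the coordinates 1 and 3 of the images of f1 and f3, and s is
  the factor by which f2 is scaled. The case b = 0 keeps the isotropic line of f1 and gives t = s /
  (a d); otherwise the line is exchanged and t = - d / a.\<close>

lemma form_parameters:
  fixes a b c d p q p' q' s :: complex
  assumes "p' * a * b + q' * b * a + b * b = 0" "s = p' * c * d + q' * d * c + d * d" "s \<noteq> 0"
    and "p * s = p' * a * d + q' * b * c + b * d" "q * s = p' * c * b + q' * d * a + d * b"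
    and "a \<noteq> 0 \<or> b \<noteq> 0"
  shows "\<exists>t. t \<noteq> 0 \<and> ((p', q') = (t * p, t * q) \<or> (p', q') = (t * q, t * p))"
proof (cases "b = 0")
  case True
  have "d \<noteq> 0" "a \<noteq> 0"
    using assms True by auto
  then have "s / (a * d) \<noteq> 0 \<and> (p', q') = (s / (a * d) * p, s / (a * d) * q)"
    using assms(3-5) True by (auto simp: field_simps)
  then show ?thesis
    by blast
next
  case False
  \<comment> \<open>The cofactor in s = d u, to be cancelled from both parameter equations.\<close>
  define u where "u = (p' + q') * c + d"
  have s: "s = d * u"
    by (simp add: assms(2) u_def algebra_simps)
  have "b * (a * (p' + q') + b) = 0"
    using assms(1) by (simp add: algebra_simps)
  then have b: "b = - (a * (p' + q'))"
    using False by (simp add: add_eq_0_iff)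
  have nz: "a \<noteq> 0" "d \<noteq> 0" "u \<noteq> 0"
    using b False s assms(3) by auto
  have "(p * d) * u = (- a * q') * u" "(q * d) * u = (- a * p') * u"
    using assms(4,5) unfolding s b u_def by (simp_all add: algebra_simps)
  then have "p * d = - a * q'" "q * d = - a * p'"
    using nz(3) by (simp_all only: mult_cancel_right) auto
  then have "- d / a \<noteq> 0 \<and> (p', q') = (- d / a * q, - d / a * p)"
    using nz by (auto simp: field_simps)
  then show ?thesis
    by blast
qed

context four_dim_basis
begin

lemma d_37_38_isoD:
  assumes i: "i \<in> {37, 38}" and iso: "algebra_iso scale (d i p q) scale (d i p' q')"
  shows "\<exists>t. t \<noteq> 0 \<and> ((p', q') = (t * p, t * q) \<or> (p', q') = (t * q, t * p))"
proof -
  obtain \<phi> where lin: "Vector_Spaces.linear scale scale \<phi>" and bij: "bij \<phi>"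
    and mult: "\<And>x y. d i p' q' (\<phi> x) (\<phi> y) = \<phi> (d i p q x y)"
    using iso by (auto simp: algebra_iso_def)
  interpret \<phi>: Vector_Spaces.linear scale scale \<phi> by fact
  have inj: "\<phi> x = \<phi> y \<longleftrightarrow> x = y" for x y
    using bij by (simp add: bij_is_inj inj_eq)
  have i72: "i \<in> {2..72}" and chars: "characters i = {4}"
    using i by (auto simp: characters_def)
  interpret d: complex_algebra scale "d i p q"
    by (rule d_mult_algebra) (use i in auto)
  note prods = d_products_37_38[OF i, of p q]
  have kernel: "coord 4 (\<phi> x) = 0" if "nilp (d i p q) x" for x
  proof -
    have "nilp (d i p' q') (\<phi> x)"
      using that by (simp add: nilp_def mult \<phi>.zero)
    then show ?thesis
      unfolding nilp_iff[OF i72] chars by blast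
  qed
  let ?x = "\<phi> (f 1)" and ?z = "\<phi> (f 3)"
  have x4: "coord 4 ?x = 0" and z4: "coord 4 ?z = 0"
    by (rule kernel; simp add: nilp_def prods del: One_nat_def)+
  note form = d_37_38_nilp_product[OF i, of _ _ p' q']
  define a b c e where "a = coord 1 ?x" and "b = coord 3 ?x" and "c = coord 1 ?z" and "e = coord 3 ?z"
  define s where "s = p' * c * e + q' * e * c + e * e"
  \<comment> \<open>f2 = f3 f3, so its image is the square of the image of f3, again a multiple of
    f2.\<close>
  have y: "\<phi> (f 2) = scale s (f 2)"
    using mult[of "f 3" "f 3"] form[OF z4 z4]
      by (simp add: prods s_def c_def e_def del: One_nat_def)
  have f2: "f 2 \<noteq> 0"
    using f_nonzero[of 2] by simp
  have s: "s \<noteq> 0"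
    using y inj[of "f 2" 0] f2 by (auto simp: \<phi>.zero)
  have "scale (p' * a * b + q' * b * a + b * b) (f 2) = 0"
    using mult[of "f 1" "f 1"] form[OF x4 x4]
      by (simp add: prods a_def b_def \<phi>.zero del: One_nat_def)
  then have 1: "p' * a * b + q' * b * a + b * b = 0"
    using f2 by simp
  have "scale (p' * a * e + q' * b * c + b * e) (f 2) = scale (p * s) (f 2)"
    using mult[of "f 1" "f 3"] form[OF x4 z4]
      by (simp add: prods a_def b_def c_def e_def \<phi>.scale y del: One_nat_def)
  then have 2: "p * s = p' * a * e + q' * b * c + b * e"
    using f2 by simp
  have "scale (p' * c * b + q' * e * a + e * b) (f 2) = scale (q * s) (f 2)"
    using mult[of "f 3" "f 1"] form[OF z4 x4]
      by (simp add: prods a_def b_def c_def e_def \<phi>.scale y del: One_nat_def)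
  then have 3: "q * s = p' * c * b + q' * e * a + e * b"
    using f2 by simp
  \<comment> \<open>Otherwise f1 would be sent into the line of f2, which is already the image of
    that line.\<close>
  have 4: "a \<noteq> 0 \<or> b \<noteq> 0"
  proof (rule ccontr)
    assume "\<not> ?thesis"
    then have "?x = scale (coord 2 ?x) (f 2)"
      using sum_coord[of ?x] x4 unfolding atLeastAtMost_1_4 by (simp add: a_def b_def)
    then have "?x = \<phi> (scale (coord 2 ?x / s) (f 2))"
      using s by (simp add: \<phi>.scale y)
    then have "f 1 = scale (coord 2 ?x / s) (f 2)"
      using inj by blast
    then have "coord 1 (f 1) = coord 2 ?x / s * coord 1 (f 2)"
      by (metis coord_scale)
    then show False
      using coord_basis[of 1 1] coord_basis[of 1 2] by simp
  qed
  show ?thesis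
    by (rule form_parameters[OF 1 s_def s 2 3 4])
qed

text \<open>The last hypothesis says that \<open>scale \<alpha> (f 1) + scale \<gamma> (f 3)\<close>
  is isotropic. Put in place of f1, with the other basis vectors kept, it produces the table with
  the new parameters.\<close>

lemma d_37_38_isoI:
  assumes i: "i \<in> {37, 38}" and "\<alpha> \<noteq> 0" "\<alpha> * \<gamma> * (p + q) + \<gamma> * \<gamma> = 0"
  shows "algebra_iso scale (d i p q) scale (d i (\<alpha> * p + \<gamma>) (\<alpha> * q + \<gamma>))"
proof -
  have i72: "i \<in> {1..72}"
    using i by auto
  interpret d: complex_algebra scale "d i p q"
    by (rule d_mult_algebra[OF i72])
  let ?B = "f ` {1..4}"
  have card: "card ?B = 4"
    using card_image[OF inj_basis] by simp
  interpret d: four_dim_algebra scale "d i p q" ?B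
  proof unfold_locales
    show "dim UNIV = 4"
      using dim_eq_card[of ?B UNIV] span_basis independent_basis card by (simp add: span_UNIV)
  qed (use independent_basis span_basis in simp_all)
  let ?u = "scale \<alpha> (f 1) + scale \<gamma> (f 3)"
  have "d.basis4 ?u (f 2) (f 3) (f 4)"
  proof (rule d.basis4_change)
    show "d.basis4 (f 1) (f 2) (f 3) (f 4)"
      using span_basis unfolding d.basis4_def atLeastAtMost_1_4 by simp
    let ?S = "span {?u, f 2, f 3, f 4}"
    have "scale (1 / \<alpha>) (?u - scale \<gamma> (f 3)) \<in> ?S"
      by (rule span_scale, rule span_diff, rule span_base, simp, rule span_scale, rule span_base, simp)
    then have "f 1 \<in> ?S"
      using \<open>\<alpha> \<noteq> 0\<close> by simp
    then show "{f 1, f 2, f 3, f 4} \<subseteq> ?S"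
      by (simp add: span_base)
  qed
  then have basis: "four_dim_basis scale (basis_of ?u (f 2) (f 3) (f 4))"
    by (rule d.basis4_imp_four_dim_basis)
  have uu: "d i p q ?u ?u = 0"
  proof -
    have "d i p q ?u ?u = scale (\<alpha> * \<gamma> * (p + q) + \<gamma> * \<gamma>) (f 2)"
      unfolding d.mult_distribs d_products_37_38[OF i]
      by (simp add: scale_left_distrib algebra_simps)
    then show ?thesis
      by (simp only: assms(3) scale_zero_left)
  qed
  have u3: "d i p q ?u (f 3) = scale (\<alpha> * p + \<gamma>) (f 2)" "d i p q (f 3) ?u = scale (\<alpha> * q + \<gamma>) (f 2)"
    unfolding d.mult_distribs d_products_37_38[OF i] by (simp_all add: scale_left_distrib)
  have u24: "d i p q ?u (f 2) = 0" "d i p q (f 2) ?u = 0"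
    "d i p q ?u (f 4) = (if i = 37 then ?u else 0)" "d i p q (f 4) ?u = (if i = 37 then ?u else 0)"
    unfolding d.mult_distribs d_products_37_38[OF i] by simp_all
  have "d.has_table (entry i (\<alpha> * p + \<gamma>) (\<alpha> * q + \<gamma>)) (basis_of ?u (f 2) (f 3) (f 4))"
  proof -
    define u where "u = ?u"
    note prods = d_products_37_38[OF i, of p q] uu[folded u_def] u3[folded u_def] u24[folded u_def]
    show ?thesis
      unfolding u_def[symmetric] d.has_table_def using i prods
      by (elim insertE emptyE; hypsubst; simp only: d.table_simps; simp)
  qed
  then show ?thesis
    unfolding d_mult_entry[of _ _ i "\<alpha> * p + \<gamma>"]
    by (rule iso_of_table[OF d.complex_algebra_axioms basis _ four_dim_basis_axioms valid_entry[OF i72]])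
qed

lemma d_37_38_iso_iff:
  assumes "i \<in> {37, 38}"
  shows "algebra_iso scale (d i p q) scale (d i p' q') \<longleftrightarrow>
    (\<exists>t. t \<noteq> 0 \<and> ((p', q') = (t * p, t * q) \<or> (p', q') = (t * q, t * p)))"
proof
  assume "\<exists>t. t \<noteq> 0 \<and> ((p', q') = (t * p, t * q) \<or> (p', q') = (t * q, t * p))"
  then obtain t where t: "t \<noteq> 0" "(p', q') = (t * p, t * q) \<or> (p', q') = (t * q, t * p)"
    by blast
  from t(2) show "algebra_iso scale (d i p q) scale (d i p' q')"
  proof
    assume "(p', q') = (t * p, t * q)"
    then show ?thesis
      using d_37_38_isoI[OF assms t(1), of 0 p q] by simp
  next
    assume *: "(p', q') = (t * q, t * p)"
    \<comment> \<open>With \<alpha> = - t and \<gamma> = t (p + q) the new vector spans the second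
      isotropic line, and the parameters become (t q, t p).\<close>
    have "- t * (t * (p + q)) * (p + q) + t * (p + q) * (t * (p + q)) = 0"
      by (simp add: algebra_simps)
    moreover have "- t * p + t * (p + q) = t * q" "- t * q + t * (p + q) = t * p"
      by (simp_all add: algebra_simps)
    ultimately show ?thesis
      using d_37_38_isoI[OF assms, of "- t" "t * (p + q)" p q] t(1) * by simp
  qed
qed (rule d_37_38_isoD[OF assms])

end

lemma nonnilpotent_iso_d_mult:
  assumes "four_dim_basis scaleV f" and A: "complex_algebra scaleA multA"
    and dim: "vector_space.dim scaleA UNIV = 4" and nonnilpotent: "\<not> nilpotent_mult multA"
  shows "\<exists>i\<in>{1..72}. \<exists>p q. algebra_iso scaleA multA scaleV (d_mult scaleV f i p q)"
proof -
  interpret A: complex_algebra scaleA multA by fact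
  obtain B where B: "A.independent B" "UNIV \<subseteq> A.span B" "card B = A.dim UNIV"
    using A.basis_exists[of UNIV] by metis
  interpret A: four_dim_algebra scaleA multA B
  proof unfold_locales
    show "finite B"
      using B(3) dim by (metis card.infinite zero_neq_numeral)
    show "A.dim UNIV = 4"
      by (rule dim)
  qed (use B in auto)
  have "\<not> A.nil UNIV"
    using A.nilpotent_multI nonnilpotent by blast
  then have A.listed
    by (rule A.nonnil_listed)
  then obtain i p q b where i: "i \<in> {1..72}" and b: "four_dim_basis scaleA b" "A.has_table (entry i p q) b"
    unfolding A.listed_def by blast
  have "algebra_iso scaleA multA scaleV (d_mult scaleV f i p q)"
    unfolding d_mult_entry by (rule iso_of_table[OF A b assms(1) valid_entry[OF i]])
  then show ?thesis
    using i by blast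
qed

theorem mainTheorem1:
  fixes scaleV :: "complex \<Rightarrow> 'v::ab_group_add \<Rightarrow> 'v"
    and f :: "nat \<Rightarrow> 'v"
  assumes "four_dim_basis scaleV f"
  shows
    "(\<forall>i\<in>{1..72}. \<forall>p q.
        complex_algebra scaleV (d_mult scaleV f i p q) \<and> \<not> nilpotent_mult (d_mult scaleV f i p q)) \<and>
     (\<forall>(scaleA :: complex \<Rightarrow> 'a::ab_group_add \<Rightarrow> 'a) multA.
        complex_algebra scaleA multA \<and> vector_space.dim scaleA (UNIV :: 'a set) = 4 \<and>
        \<not> nilpotent_mult multA \<longrightarrow>
        (\<exists>i\<in>{1..72}. \<exists>p q. algebra_iso scaleA multA scaleV (d_mult scaleV f i p q))) \<and>
     (\<forall>i\<in>{1..72}. \<forall>j\<in>{1..72}. \<forall>p q p' q'. i \<noteq> j \<longrightarrow>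
        \<not> algebra_iso scaleV (d_mult scaleV f i p q) scaleV (d_mult scaleV f j p' q')) \<and>
     (\<forall>i\<in>{37, 38}. \<forall>p q p' q'.
        algebra_iso scaleV (d_mult scaleV f i p q) scaleV (d_mult scaleV f i p' q') \<longleftrightarrow>
        (\<exists>t. t \<noteq> 0 \<and> ((p', q') = (t * p, t * q) \<or> (p', q') = (t * q, t * p))))"
proof -
  interpret four_dim_basis scaleV f
    by (rule assms)
  show ?thesis
    using d_mult_algebra d_mult_not_nilpotent nonnilpotent_iso_d_mult[OF assms] d_not_iso d_37_38_iso_iff
    by (intro conjI ballI allI impI) blast+
qed

end
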